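(* Let $(M^n,g,e^{-f}dV)$, $m$, $k$, $p$, $G$, $s$ be as in the context. For $C^2$ functions $u$ on $M\setminus\{p\}$ define $$\mathcal L_f u=\Delta_f u+\frac{2-m}{s^2}\langle\nabla s^2,\nabla u\rangle=\Delta_f u+2\langle\nabla\log G,\nabla u\rangle=G^{-2}\,\mathrm{div}_f(G^2\nabla u)$$ (these three expressions coincide). Then on $M\setminus\{p\}$ $$\mathcal L_f\bigl(4|\nabla s|^2+ks^2\bigr)=\frac{2}{s^2}\Bigl[|\mathring{\mathrm{Hess}}\,s^2|^2+D_m+\bigl(\mathrm{Ric}_f^m-(m-1)kg\bigr)(\nabla s^2,\nabla s^2)\Bigr].$$
   Context: $(M^n,g)$ is a closed, connected smooth Riemannian manifold, $n\ge3$, $f\in C^\infty(M)$, $m>n$ and $k>0$ are real. $\Delta=\mathrm{div}\nabla$, $\Delta_f u=\Delta u-\langle\nabla f,\nabla u\rangle$, $\mathrm{div}_f Z=e^f\mathrm{div}(e^{-f}Z)$, $\mathrm{Ric}_f^m=\mathrm{Ric}+\mathrm{Hess}\,f-\frac{df\otimes df}{m-n}$, and it is a standing assumption that $\mathrm{Ric}_f^m\ge(m-1)kg$. $p\in M$ is fixed and $G$ is the positive Green function with pole $p$ of $-\Delta_f+\frac{m(m-2)k}{4}$: smooth and positive on $M\setminus\{p\}$, with $\int_M G\,(-\Delta_f\phi+\frac{m(m-2)k}{4}\phi)e^{-f}dV=\kappa\phi(p)$ for all $\phi\in C^\infty(M)$, $\kappa>0$ a fixed constant; in particular $\Delta_fG=\frac{m(m-2)k}{4}G$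 on $M\setminus\{p\}$. $s=\frac12G^{1/(2-m)}$, so $G=(2s)^{2-m}$. $\mathring{\mathrm{Hess}}\,s^2=\mathrm{Hess}\,s^2-\frac{\Delta s^2}{n}g$ and $D_m=\frac{n}{m(m-n)}\bigl(\frac{m-n}{n}\Delta s^2+\langle\nabla f,\nabla s^2\rangle\bigr)^2$. *)

theory Defs
  imports "HOL-Analysis.Analysis"
begin

text \<open>
  A manifold of dimension \<open>CARD('n)\<close> is a type \<open>'a\<close> of points (Hausdorff and second countable by
  its type class) with a smooth atlas. Tensor fields are given by their components in every chart
  of the atlas. Scalars built from them (inner products of gradients, divergences, ...) do not
  depend on the chart; as functions on the manifold they are evaluated at each point in a chosen
  chart around that point.
\<close>


section \<open>\<open>C\<^sup>k\<close> functions on open subsets of Euclidean space\<close>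

definition partial_deriv :: "'n::finite \<Rightarrow> (real^'n \<Rightarrow> real) \<Rightarrow> real^'n \<Rightarrow> real" where
  "partial_deriv i h y = frechet_derivative h (at y) (axis i 1)"

text \<open>Meant for open \<open>S\<close> only.\<close>

primrec Ck_on :: "nat \<Rightarrow> (real^'n::finite) set \<Rightarrow> (real^'n \<Rightarrow> real) \<Rightarrow> bool" where
  "Ck_on 0 S h \<longleftrightarrow> continuous_on S h"
| "Ck_on (Suc k) S h \<longleftrightarrow> h differentiable_on S \<and> (\<forall>i. Ck_on k S (partial_deriv i h))"

definition Cinf_on :: "(real^'n::finite) set \<Rightarrow> (real^'n \<Rightarrow> real) \<Rightarrow> bool" where
  "Cinf_on S h \<longleftrightarrow> (\<forall>k. Ck_on k S h)"


section \<open>Smooth manifolds\<close>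

type_synonym ('a, 'n) chart = "'a set \<times> ('a \<Rightarrow> real^'n)"

definition chart_inv :: "('a, 'n::finite) chart \<Rightarrow> real^'n \<Rightarrow> 'a" where
  "chart_inv c = inv_into (fst c) (snd c)"

definition is_chart :: "('a::topological_space, 'n::finite) chart \<Rightarrow> bool" where
  "is_chart c \<longleftrightarrow> open (fst c) \<and> open (snd c ` fst c) \<and>
     homeomorphism (fst c) (snd c ` fst c) (snd c) (chart_inv c)"

text \<open>The atlas is not required to be maximal.\<close>

definition smooth_atlas :: "('a::topological_space, 'n::finite) chart set \<Rightarrow> bool" where
  "smooth_atlas A \<longleftrightarrow>
     (\<forall>c\<in>A. is_chart c) \<and> (\<Union>c\<in>A. fst c) = UNIV \<and>
     (\<forall>c\<in>A. \<forall>d\<in>A. \<forall>i. Cinf_on (snd c ` (fst c \<inter> fst d)) (\<lambda>y. snd d (chart_inv c y) $ i))"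

definition chart_at :: "('a, 'n::finite) chart set \<Rightarrow> 'a \<Rightarrow> ('a, 'n) chart" where
  "chart_at A x = (SOME c. c \<in> A \<and> x \<in> fst c)"

definition Ck_fun :: "('a, 'n::finite) chart set \<Rightarrow> nat \<Rightarrow> 'a set \<Rightarrow> ('a \<Rightarrow> real) \<Rightarrow> bool" where
  "Ck_fun A k W u \<longleftrightarrow> (\<forall>c\<in>A. Ck_on k (snd c ` (fst c \<inter> W)) (u \<circ> chart_inv c))"

definition smooth_fun :: "('a, 'n::finite) chart set \<Rightarrow> 'a set \<Rightarrow> ('a \<Rightarrow> real) \<Rightarrow> bool" where
  "smooth_fun A W u \<longleftrightarrow> (\<forall>k. Ck_fun A k W u)"

text \<open>\<open>pd c i u\<close> is the function \<open>\<partial>u/\<partial>x\<^sup>i\<close> on the domain of the chart \<open>c\<close>.\<close>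

definition pd :: "('a, 'n::finite) chart \<Rightarrow> 'n \<Rightarrow> ('a \<Rightarrow> real) \<Rightarrow> 'a \<Rightarrow> real" where
  "pd c i u x = partial_deriv i (u \<circ> chart_inv c) (snd c x)"


section \<open>Riemannian metrics\<close>

type_synonym ('a, 'n) metric = "('a, 'n) chart \<Rightarrow> 'a \<Rightarrow> real^'n^'n"

definition riemannian_metric :: "('a, 'n::finite) chart set \<Rightarrow> ('a, 'n) metric \<Rightarrow> bool" where
  "riemannian_metric A g \<longleftrightarrow>
     (\<forall>c\<in>A. \<forall>x\<in>fst c. transpose (g c x) = g c x \<and> (\<forall>v. v \<noteq> 0 \<longrightarrow> v \<bullet> (g c x *v v) > 0)) \<and>
     (\<forall>c\<in>A. \<forall>i j. Cinf_on (snd c ` fst c) (\<lambda>y. g c (chart_inv c y) $ i $ j)) \<and>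
     (\<forall>c\<in>A. \<forall>d\<in>A. \<forall>x\<in>fst c \<inter> fst d. \<forall>i j.
        g c x $ i $ j =
          (\<Sum>a\<in>UNIV. \<Sum>b\<in>UNIV. pd c i (\<lambda>z. snd d z $ a) x * pd c j (\<lambda>z. snd d z $ b) x * g d x $ a $ b))"

definition ginv :: "('a, 'n::finite) metric \<Rightarrow> ('a, 'n) metric" where
  "ginv g c x = matrix_inv (g c x)"

text \<open>\<open>christoffel g c k i j\<close> is \<open>\<Gamma>\<^sup>k\<^sub>i\<^sub>j\<close>.\<close>

definition christoffel ::
  "('a, 'n::finite) metric \<Rightarrow> ('a, 'n) chart \<Rightarrow> 'n \<Rightarrow> 'n \<Rightarrow> 'n \<Rightarrow> 'a \<Rightarrow> real" where
  "christoffel g c k i j x =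
     (1/2) * (\<Sum>l\<in>UNIV. ginv g c x $ k $ l *
        (pd c i (\<lambda>z. g c z $ j $ l) x + pd c j (\<lambda>z. g c z $ i $ l) x - pd c l (\<lambda>z. g c z $ i $ j) x))"

text \<open>\<open>riemann g c l k i j\<close> is the \<open>l\<close>-th component of \<open>R(\<partial>\<^sub>i, \<partial>\<^sub>j)\<partial>\<^sub>k\<close>, and the Ricci tensor is
  \<open>Ric(Y,Z) = tr (X \<mapsto> R(X,Y)Z)\<close>; the round sphere has positive Ricci curvature.\<close>

definition riemann ::
  "('a, 'n::finite) metric \<Rightarrow> ('a, 'n) chart \<Rightarrow> 'n \<Rightarrow> 'n \<Rightarrow> 'n \<Rightarrow> 'n \<Rightarrow> 'a \<Rightarrow> real" where
  "riemann g c l k i j x =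
     pd c i (christoffel g c l j k) x - pd c j (christoffel g c l i k) x
     + (\<Sum>q\<in>UNIV. christoffel g c l i q x * christoffel g c q j k x
                 - christoffel g c l j q x * christoffel g c q i k x)"

definition ricci :: "('a, 'n::finite) metric \<Rightarrow> ('a, 'n) chart \<Rightarrow> 'a \<Rightarrow> real^'n^'n" where
  "ricci g c x = (\<chi> j k. \<Sum>i\<in>UNIV. riemann g c i k i j x)"

definition hess ::
  "('a, 'n::finite) metric \<Rightarrow> ('a, 'n) chart \<Rightarrow> ('a \<Rightarrow> real) \<Rightarrow> 'a \<Rightarrow> real^'n^'n" where
  "hess g c u x = (\<chi> i j. pd c i (pd c j u) x - (\<Sum>k\<in>UNIV. christoffel g c k i j x * pd c k u x))"

definition grad ::
  "('a, 'n::finite) metric \<Rightarrow> ('a, 'n) chart \<Rightarrow> ('a \<Rightarrow> real) \<Rightarrow> 'a \<Rightarrow> real^'n" where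
  "grad g c u x = (\<chi> i. \<Sum>j\<in>UNIV. ginv g c x $ i $ j * pd c j u x)"

text \<open>\<open>\<langle>\<nabla>u, \<nabla>v\<rangle>\<close>.\<close>

definition grad_inner ::
  "('a, 'n::finite) chart set \<Rightarrow> ('a, 'n) metric \<Rightarrow> ('a \<Rightarrow> real) \<Rightarrow> ('a \<Rightarrow> real) \<Rightarrow> 'a \<Rightarrow> real" where
  "grad_inner A g u v x =
     (let c = chart_at A x in grad g c u x \<bullet> (g c x *v grad g c v x))"

text \<open>The divergence is the trace of the covariant derivative, \<open>\<nabla>\<^sub>i Z\<^sup>i\<close>.\<close>

definition divergence ::
  "('a, 'n::finite) chart set \<Rightarrow> ('a, 'n) metric \<Rightarrow> (('a, 'n) chart \<Rightarrow> 'a \<Rightarrow> real^'n) \<Rightarrow> 'a \<Rightarrow> real" where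
  "divergence A g Z x =
     (let c = chart_at A x in
        \<Sum>i\<in>UNIV. pd c i (\<lambda>z. Z c z $ i) x + (\<Sum>j\<in>UNIV. christoffel g c i i j x * Z c x $ j))"

definition laplacian ::
  "('a, 'n::finite) chart set \<Rightarrow> ('a, 'n) metric \<Rightarrow> ('a \<Rightarrow> real) \<Rightarrow> 'a \<Rightarrow> real" where
  "laplacian A g u = divergence A g (\<lambda>c. grad g c u)"

text \<open>\<open>|T|\<^sup>2 = g\<^sup>i\<^sup>a g\<^sup>j\<^sup>b T\<^sub>i\<^sub>j T\<^sub>a\<^sub>b\<close> for a \<open>(0,2)\<close>-tensor at \<open>x\<close>.\<close>

definition tensor_norm2 ::
  "('a, 'n::finite) metric \<Rightarrow> ('a, 'n) chart \<Rightarrow> 'a \<Rightarrow> real^'n^'n \<Rightarrow> real" where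
  "tensor_norm2 g c x T =
     (\<Sum>i\<in>UNIV. \<Sum>j\<in>UNIV. \<Sum>a\<in>UNIV. \<Sum>b\<in>UNIV.
        ginv g c x $ i $ a * ginv g c x $ j $ b * T $ i $ j * T $ a $ b)"

text \<open>The Riemannian volume measure: the Borel measure with density \<open>sqrt (det g)\<close> with respect to
  Lebesgue measure in every chart.\<close>

definition riemannian_volume ::
  "('a::topological_space, 'n::finite) chart set \<Rightarrow> ('a, 'n) metric \<Rightarrow> 'a measure \<Rightarrow> bool" where
  "riemannian_volume A g dV \<longleftrightarrow>
     sets dV = sets borel \<and>
     (\<forall>c\<in>A. \<forall>B\<in>sets borel. B \<subseteq> fst c \<longrightarrow>
        emeasure dV B = (\<integral>\<^sup>+ y\<in>snd c ` B. ennreal (sqrt (det (g c (chart_inv c y)))) \<partial>lborel))"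

definition closed_connected_riemannian ::
  "('a::{t2_space, second_countable_topology}, 'n::finite) chart set \<Rightarrow> ('a, 'n) metric \<Rightarrow> bool" where
  "closed_connected_riemannian A g \<longleftrightarrow>
     smooth_atlas A \<and> riemannian_metric A g \<and> compact (UNIV :: 'a set) \<and> connected (UNIV :: 'a set)"


section \<open>Weighted manifolds\<close>

definition weighted_laplacian ::
  "('a, 'n::finite) chart set \<Rightarrow> ('a, 'n) metric \<Rightarrow> ('a \<Rightarrow> real) \<Rightarrow> ('a \<Rightarrow> real) \<Rightarrow> 'a \<Rightarrow> real" where
  "weighted_laplacian A g f u x = laplacian A g u x - grad_inner A g f u x"

definition weighted_divergence ::
  "('a, 'n::finite) chart set \<Rightarrow> ('a, 'n) metric \<Rightarrow> ('a \<Rightarrow> real) \<Rightarrow>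
    (('a, 'n) chart \<Rightarrow> 'a \<Rightarrow> real^'n) \<Rightarrow> 'a \<Rightarrow> real" where
  "weighted_divergence A g f Z x = exp (f x) * divergence A g (\<lambda>c z. exp (- f z) *\<^sub>R Z c z) x"

text \<open>\<open>Ric + Hess f - df \<otimes> df / (m - n)\<close>.\<close>

definition ricci_fm ::
  "('a, 'n::finite) metric \<Rightarrow> ('a \<Rightarrow> real) \<Rightarrow> real \<Rightarrow> ('a, 'n) chart \<Rightarrow> 'a \<Rightarrow> real^'n^'n" where
  "ricci_fm g f m c x =
     ricci g c x + hess g c f x
     - (1 / (m - real CARD('n))) *\<^sub>R (\<chi> i j. pd c i f x * pd c j f x)"

definition ricci_fm_bounded_below ::
  "('a, 'n::finite) chart set \<Rightarrow> ('a, 'n) metric \<Rightarrow> ('a \<Rightarrow> real) \<Rightarrow> real \<Rightarrow> real \<Rightarrow> bool" where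
  "ricci_fm_bounded_below A g f m K \<longleftrightarrow>
     (\<forall>c\<in>A. \<forall>x\<in>fst c. \<forall>v. v \<bullet> (ricci_fm g f m c x *v v) \<ge> K * (v \<bullet> (g c x *v v)))"

text \<open>The positive Green function with pole \<open>p\<close> of \<open>-\<Delta>\<^sub>f + m (m - 2) k / 4\<close>, normalised by \<open>\<kappa>\<close>.
  The value \<open>G p\<close> is irrelevant, as \<open>{p}\<close> is a null set.\<close>

definition green_function ::
  "('a, 'n::finite) chart set \<Rightarrow> ('a, 'n) metric \<Rightarrow> 'a measure \<Rightarrow> ('a \<Rightarrow> real) \<Rightarrow> real \<Rightarrow> real \<Rightarrow>
    real \<Rightarrow> 'a \<Rightarrow> ('a \<Rightarrow> real) \<Rightarrow> bool" where
  "green_function A g dV f m k \<kappa> p G \<longleftrightarrow>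
     smooth_fun A (- {p}) G \<and> (\<forall>x. x \<noteq> p \<longrightarrow> G x > 0) \<and>
     (\<forall>\<phi>. smooth_fun A UNIV \<phi> \<longrightarrow>
        has_bochner_integral dV
          (\<lambda>x. G x * (- weighted_laplacian A g f \<phi> x + m * (m - 2) * k / 4 * \<phi> x) * exp (- f x))
          (\<kappa> * \<phi> p))"

definition L_op ::
  "('a, 'n::finite) chart set \<Rightarrow> ('a, 'n) metric \<Rightarrow> ('a \<Rightarrow> real) \<Rightarrow> real \<Rightarrow> ('a \<Rightarrow> real) \<Rightarrow>
    ('a \<Rightarrow> real) \<Rightarrow> 'a \<Rightarrow> real" where
  "L_op A g f m s u x =
     weighted_laplacian A g f u x + (2 - m) / (s x)\<^sup>2 * grad_inner A g (\<lambda>y. (s y)\<^sup>2) u x"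

definition hess_traceless ::
  "('a, 'n::finite) chart set \<Rightarrow> ('a, 'n) metric \<Rightarrow> ('a, 'n) chart \<Rightarrow> ('a \<Rightarrow> real) \<Rightarrow> 'a \<Rightarrow> real^'n^'n" where
  "hess_traceless A g c u x = hess g c u x - (laplacian A g u x / real CARD('n)) *\<^sub>R g c x"

definition D_term ::
  "('a, 'n::finite) chart set \<Rightarrow> ('a, 'n) metric \<Rightarrow> ('a \<Rightarrow> real) \<Rightarrow> real \<Rightarrow> ('a \<Rightarrow> real) \<Rightarrow> 'a \<Rightarrow> real" where
  "D_term A g f m s x =
     (let n = real CARD('n) in
        n / (m * (m - n)) *
          ((m - n) / n * laplacian A g (\<lambda>y. (s y)\<^sup>2) x + grad_inner A g f (\<lambda>y. (s y)\<^sup>2) x)\<^sup>2)"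

end

(*
  Put v = s^2, so that G is a power of v, and w = 4 |grad s|^2 + k s^2. The equation for G becomes
  Delta_f v = (m/2) (w - 2 k v), and |grad v|^2 = v w - k v^2. Applying Delta_f to the second relation
  and comparing with the Bochner formula for Delta_f |grad v|^2 gives an expression for
  v Delta_f w + (2 - m) <grad v, grad w>; the rest is algebra.

  The hypothesis on G is only distributional. The pointwise equation follows by testing with bump
  functions, using Green's identity in a chart. That the Laplacian does not depend on the chart follows
  from Koszul's formula, which expresses the Hessian by inner products of gradients.
*)
theory Submission
  imports Defs
begin

section \<open>Calculus of \<open>C\<^sup>k\<close> functions\<close>

text \<open>The invariant operators evaluate at each point in a chart picked for that point, so a
  function such as \<open>grad_inner A g s s\<close> shows no smoothness as it stands and cannot be
  differentiated. Hence the versions with a fixed chart, \<open>chart_inner\<close>,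
  \<open>chart_laplacian\<close>, \<open>chart_wlaplacian\<close>: the calculus is done with these,
  and the comparison of charts replaces the one kind by the other on a whole neighbourhood. The
  exponent in s is what closes the equation for v: v = G^b / 4 with b = 2 / (2 - m), and b (b - 1) =
  (m/2) b^2, so the gradient term of Delta_f v is the multiple 2 m |grad s|^2. The drift coefficient
  2 - m is then 2 from the product rule for Delta_f (v w) minus m from twice <grad v, grad Delta_f
  v>. Eliminating w leaves |Hess v|^2 - (Delta_f v)^2 / m, and D_m is the square that remains once
  the trace part (Delta v)^2 / n and the term <grad f, grad v>^2 / (m - n) are split off.\<close>

lemma partial_deriv_eq:
  "(h has_derivative D) (at y) \<Longrightarrow> partial_deriv i h y = D (axis i 1)"
  unfolding partial_deriv_def by (metis frechet_derivative_at)

lemma frechet_derivative_axis_expand: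
  fixes h :: "real^'n::finite \<Rightarrow> real"
  assumes "h differentiable at y"
  shows "frechet_derivative h (at y) v = (\<Sum>a\<in>UNIV. v $ a * partial_deriv a h y)"
proof -
  have lin: "linear (frechet_derivative h (at y))"
    using assms linear_frechet_derivative by blast
  have "v = (\<Sum>a\<in>UNIV. v $ a *\<^sub>R axis a 1)"
    using basis_expansion[of v] by (simp add: scalar_mult_eq_scaleR)
  then have "frechet_derivative h (at y) v
      = frechet_derivative h (at y) (\<Sum>a\<in>UNIV. v $ a *\<^sub>R axis a 1)" by simp
  also have "\<dots> = (\<Sum>a\<in>UNIV. v $ a * partial_deriv a h y)"
    by (simp add: linear_sum[OF lin] linear_cmul[OF lin] partial_deriv_def)
  finally show ?thesis .
qed

lemma partial_deriv_cong:
  assumes "open S" "y \<in> S" "\<And>z. z \<in> S \<Longrightarrow> h z = h' z"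
  shows "partial_deriv i h y = partial_deriv i h' y"
proof -
  have "(h has_derivative D) (at y) \<longleftrightarrow> (h' has_derivative D) (at y)" for D
    using assms has_derivative_transform_within_open[of _ D y UNIV S]
    by (metis (no_types, lifting))
  then show ?thesis unfolding partial_deriv_def frechet_derivative_def by simp
qed

lemma partial_deriv_const [simp]: "partial_deriv i (\<lambda>_. c) y = 0"
  by (rule partial_deriv_eq[of _ "\<lambda>_. 0"]) simp

lemma partial_deriv_component: "partial_deriv i (\<lambda>y. y $ j) y = axis i 1 $ j"
  by (rule partial_deriv_eq) (rule bounded_linear.has_derivative[OF bounded_linear_vec_nth has_derivative_ident])

lemma partial_deriv_add:
  assumes "h differentiable at y" "h' differentiable at y"
  shows "partial_deriv i (\<lambda>z. h z + h' z) y = partial_deriv i h y + partial_deriv i h' y"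
  using assms unfolding frechet_derivative_works
  by (subst partial_deriv_eq[OF has_derivative_add]) (auto simp: partial_deriv_def)

lemma partial_deriv_mult:
  assumes "h differentiable at y" "h' differentiable at y"
  shows "partial_deriv i (\<lambda>z. h z * h' z) y = partial_deriv i h y * h' y + h y * partial_deriv i h' y"
  using assms unfolding frechet_derivative_works
  by (subst partial_deriv_eq[OF has_derivative_mult]) (auto simp: partial_deriv_def)

lemma partial_deriv_compose_real:
  assumes "h differentiable at y" "(F has_real_derivative F') (at (h y))"
  shows "partial_deriv i (\<lambda>z. F (h z)) y = F' * partial_deriv i h y"
    and "(\<lambda>z. F (h z)) differentiable at y"
proof -
  have "((\<lambda>z. F (h z)) has_derivative (\<lambda>v. F' * frechet_derivative h (at y) v)) (at y)"
    using assms(1)[unfolded frechet_derivative_works] assms(2)[unfolded has_field_derivative_def]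
    by (rule has_derivative_compose)
  then show "partial_deriv i (\<lambda>z. F (h z)) y = F' * partial_deriv i h y"
    and "(\<lambda>z. F (h z)) differentiable at y"
    by (auto simp: partial_deriv_eq partial_deriv_def[symmetric] differentiable_def)
qed

lemma partial_deriv_compose:
  fixes \<psi> :: "real^'m::finite \<Rightarrow> real^'n::finite"
  assumes \<psi>: "\<And>a. (\<lambda>z. \<psi> z $ a) differentiable at y" and b: "b differentiable at (\<psi> y)"
  shows "partial_deriv i (\<lambda>z. b (\<psi> z)) y
      = (\<Sum>a\<in>UNIV. partial_deriv i (\<lambda>z. \<psi> z $ a) y * partial_deriv a b (\<psi> y))"
    and "(\<lambda>z. b (\<psi> z)) differentiable at y"
proof -
  define D where "D v = (\<chi> a. frechet_derivative (\<lambda>z. \<psi> z $ a) (at y) v)" for v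
  have "(\<psi> has_derivative D) (at y)"
    unfolding has_derivative_componentwise_within[of \<psi> D y UNIV]
    using \<psi>[unfolded frechet_derivative_works]
    by (auto simp: Basis_vec_def inner_axis D_def)
  then have "((\<lambda>z. b (\<psi> z)) has_derivative (\<lambda>v. frechet_derivative b (at (\<psi> y)) (D v))) (at y)"
    using b[unfolded frechet_derivative_works] by (rule has_derivative_compose)
  then show "partial_deriv i (\<lambda>z. b (\<psi> z)) y
      = (\<Sum>a\<in>UNIV. partial_deriv i (\<lambda>z. \<psi> z $ a) y * partial_deriv a b (\<psi> y))"
    and "(\<lambda>z. b (\<psi> z)) differentiable at y"
    by (auto simp: partial_deriv_eq frechet_derivative_axis_expand[OF b] D_def differentiable_def
        partial_deriv_def[of i "\<lambda>z. \<psi> z $ _"])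
qed

section \<open>Closure properties of the classes \<open>Ck_on\<close>\<close>

lemma Ck_on_SucD: "Ck_on (Suc k) S h \<Longrightarrow> Ck_on k S h"
proof (induction k arbitrary: h)
  case 0
  then show ?case by (simp add: differentiable_imp_continuous_on)
qed auto

lemma Ck_on_mono: "Ck_on l S h \<Longrightarrow> k \<le> l \<Longrightarrow> Ck_on k S h"
  by (induction l) (auto simp: le_Suc_eq simp del: Ck_on.simps dest: Ck_on_SucD)

lemma Ck_on_subset: "Ck_on k S h \<Longrightarrow> T \<subseteq> S \<Longrightarrow> Ck_on k T h"
  by (induction k arbitrary: h) (auto intro: continuous_on_subset differentiable_on_subset)

lemma Ck_on_differentiable: "Ck_on (Suc k) S h \<Longrightarrow> open S \<Longrightarrow> y \<in> S \<Longrightarrow> h differentiable at y"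
  by (simp add: differentiable_on_eq_differentiable_at)

lemma Ck_on_continuous: "Ck_on k S h \<Longrightarrow> continuous_on S h"
  by (cases k) (auto simp: differentiable_imp_continuous_on)

text \<open>Openness of \<open>S\<close> makes the partial derivatives of \<open>h\<close> and
  \<open>h'\<close> agree on \<open>S\<close>, which is what the induction hypothesis asks of
  them.\<close>

lemma Ck_on_cong:
  assumes "Ck_on k S h" "open S" "\<And>y. y \<in> S \<Longrightarrow> h y = h' y"
  shows "Ck_on k S h'"
  using assms(1,3)
proof (induction k arbitrary: h h')
  case 0
  then show ?case by (simp cong: continuous_on_cong)
next
  case (Suc k)
  have "h' differentiable_on S"
    unfolding differentiable_on_def
  proof
    fix y assume y: "y \<in> S"
    then have "h differentiable (at y within S)"
      using Suc.prems(1) by (simp add: differentiable_on_def)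
    then show "h' differentiable (at y within S)"
      by (rule differentiable_transform_within[OF _ zero_less_one y]) (use Suc.prems(2) in auto)
  qed
  moreover have "Ck_on k S (partial_deriv i h')" for i
  proof (rule Suc.IH)
    show "Ck_on k S (partial_deriv i h)" using Suc.prems by simp
    show "partial_deriv i h y = partial_deriv i h' y" if "y \<in> S" for y
      using partial_deriv_cong[OF \<open>open S\<close> that] Suc.prems by blast
  qed
  ultimately show ?case by simp
qed

text \<open>Used to glue: a function given on a chart image is joined to zero outside a compact
  set.\<close>

lemma Ck_on_local:
  assumes "\<And>y. y \<in> S \<Longrightarrow> \<exists>T. open T \<and> y \<in> T \<and> Ck_on k T h"
  shows "Ck_on k S h"
  using assms
proof (induction k arbitrary: h)
  case 0
  then show ?case
    by (auto intro!: continuous_at_imp_continuous_on simp: continuous_on_eq_continuous_at)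
      (metis continuous_on_eq_continuous_at)
next
  case (Suc k)
  have "h differentiable_on S"
    unfolding differentiable_on_def
    using Suc.prems Ck_on_differentiable differentiable_at_withinI by blast
  moreover have "Ck_on k S (partial_deriv i h)" for i
    by (rule Suc.IH) (use Suc.prems in force)
  ultimately show ?case by simp
qed

lemma Ck_on_const: "Ck_on k S (\<lambda>_. c)"
  by (induction k arbitrary: c) (auto simp: partial_deriv_const[abs_def])

lemma Ck_on_component: "Ck_on k S (\<lambda>y. y $ j)"
proof (cases k)
  case 0
  then show ?thesis by (simp add: continuous_on_component)
next
  case (Suc l)
  have "(\<lambda>y::real^'a. y $ j) differentiable_on S"
    unfolding differentiable_on_def
    by (metis bounded_linear_vec_nth bounded_linear_imp_differentiable differentiable_at_withinI)
  then show ?thesis using Suc by (simp add: partial_deriv_component[abs_def] Ck_on_const)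
qed

lemma Ck_on_add:
  assumes "Ck_on k S h" "Ck_on k S h'" "open S"
  shows "Ck_on k S (\<lambda>y. h y + h' y)"
  using assms(1,2)
proof (induction k arbitrary: h h')
  case 0
  then show ?case by (simp add: continuous_on_add)
next
  case (Suc k)
  have "Ck_on k S (partial_deriv i (\<lambda>y. h y + h' y))" for i
  proof (rule Ck_on_cong[OF _ \<open>open S\<close>])
    show "Ck_on k S (\<lambda>y. partial_deriv i h y + partial_deriv i h' y)"
      using Suc by simp
  qed (use Suc.prems Ck_on_differentiable[OF _ \<open>open S\<close>] in \<open>auto intro!: partial_deriv_add[symmetric] simp del: Ck_on.simps\<close>)
  then show ?case using Suc.prems by simp
qed

lemma Ck_on_mult:
  assumes "Ck_on k S h" "Ck_on k S h'" "open S"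
  shows "Ck_on k S (\<lambda>y. h y * h' y)"
  using assms(1,2)
proof (induction k arbitrary: h h')
  case 0
  then show ?case by (simp add: continuous_on_mult)
next
  case (Suc k)
  have "Ck_on k S (partial_deriv i (\<lambda>y. h y * h' y))" for i
  proof (rule Ck_on_cong[OF _ \<open>open S\<close>])
    show "Ck_on k S (\<lambda>y. partial_deriv i h y * h' y + h y * partial_deriv i h' y)"
      using Suc.prems by (intro Ck_on_add Suc.IH \<open>open S\<close>) (auto dest: Ck_on_SucD[of k] simp del: Ck_on.simps, auto)
  qed (use Suc.prems Ck_on_differentiable[OF _ \<open>open S\<close>] in \<open>auto intro!: partial_deriv_mult[symmetric] simp del: Ck_on.simps\<close>)
  then show ?case using Suc.prems by (simp add: differentiable_on_mult)
qed

lemma Ck_on_cmult: "Ck_on k S h \<Longrightarrow> open S \<Longrightarrow> Ck_on k S (\<lambda>y. c * h y)"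
  by (rule Ck_on_mult[OF Ck_on_const])

lemma Ck_on_diff:
  "Ck_on k S h \<Longrightarrow> Ck_on k S h' \<Longrightarrow> open S \<Longrightarrow> Ck_on k S (\<lambda>y. h y - h' y)"
  using Ck_on_add[of k S h "\<lambda>y. (-1) * h' y"] Ck_on_cmult[of k S h' "-1"] by simp

lemma Ck_on_sum:
  "(\<And>i. i \<in> I \<Longrightarrow> Ck_on k S (h i)) \<Longrightarrow> open S \<Longrightarrow> Ck_on k S (\<lambda>y. \<Sum>i\<in>I. h i y)"
  by (induction I rule: infinite_finite_induct) (auto intro: Ck_on_const Ck_on_add)

lemma Ck_on_prod:
  "(\<And>i. i \<in> I \<Longrightarrow> Ck_on k S (h i)) \<Longrightarrow> open S \<Longrightarrow> Ck_on k S (\<lambda>y. \<Prod>i\<in>I. h i y)"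
  by (induction I rule: infinite_finite_induct) (auto intro: Ck_on_const Ck_on_mult)

text \<open>The outer function comes as a sequence \<open>F\<close> in which each member is the
  derivative of the one before. The chain rule turns \<open>F j\<close> into
  \<open>F (Suc j)\<close> times a partial derivative of \<open>h\<close>, so the induction on
  \<open>k\<close> stays within the family.\<close>

lemma Ck_on_compose_real:
  fixes h :: "real^'n::finite \<Rightarrow> real"
  assumes F: "\<And>j t. t \<in> T \<Longrightarrow> (F j has_real_derivative F (Suc j) t) (at t)"
    and h: "Ck_on k S h" "h ` S \<subseteq> T" "open S"
  shows "Ck_on k S (\<lambda>y. F j (h y))"
  using h(1)
proof (induction k arbitrary: j)
  case 0
  have "continuous_on T (F j)"
    using F DERIV_continuous_on has_field_derivative_at_within by blast
  then show ?case using 0 h(2) by (auto intro: continuous_on_compose2[of T "F j" S h])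
next
  case (Suc k)
  have d: "h differentiable at y" if "y \<in> S" for y
    using Ck_on_differentiable[OF Suc.prems \<open>open S\<close> that] .
  have "Ck_on k S (partial_deriv i (\<lambda>y. F j (h y)))" for i
  proof (rule Ck_on_cong[OF _ \<open>open S\<close>])
    show "Ck_on k S (\<lambda>y. F (Suc j) (h y) * partial_deriv i h y)"
      using Suc.prems by (intro Ck_on_mult \<open>open S\<close> Suc.IH[OF Ck_on_SucD]) auto
    show "F (Suc j) (h y) * partial_deriv i h y = partial_deriv i (\<lambda>y. F j (h y)) y"
      if "y \<in> S" for y
      using partial_deriv_compose_real(1)[OF d[OF that] F[of _ j], of i] h(2) that by auto
  qed
  moreover have "(\<lambda>y. F j (h y)) differentiable_on S"
    unfolding differentiable_on_def
    using partial_deriv_compose_real(2)[OF d F[of _ j]] h(2)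
    by (auto intro: differentiable_at_withinI)
  ultimately show ?case by simp
qed

text \<open>The chain rule puts partial derivatives of \<open>b\<close> in the place of
  \<open>b\<close>; the induction therefore runs over all \<open>b\<close> at once.\<close>

lemma Ck_on_compose:
  fixes \<psi> :: "real^'m::finite \<Rightarrow> real^'n::finite"
  assumes "\<And>a. Ck_on k S (\<lambda>y. \<psi> y $ a)" "Ck_on k T b" "open S" "open T" "\<psi> ` S \<subseteq> T"
  shows "Ck_on k S (\<lambda>y. b (\<psi> y))"
  using assms(1,2)
proof (induction k arbitrary: b)
  case 0
  then have "continuous_on S \<psi>"
    using continuous_on_vec_lambda[of S "\<lambda>a y. \<psi> y $ a"] by simp
  then show ?case using 0 assms(5) by (auto intro: continuous_on_compose2[of T b S \<psi>])
next
  case (Suc k)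
  have d: "(\<lambda>y. \<psi> y $ a) differentiable at y" "b differentiable at (\<psi> y)" if "y \<in> S" for y a
    using Ck_on_differentiable[OF Suc.prems(1) \<open>open S\<close> that]
      Ck_on_differentiable[OF Suc.prems(2) \<open>open T\<close>] that assms(5) by blast+
  have "Ck_on k S (partial_deriv i (\<lambda>y. b (\<psi> y)))" for i
  proof (rule Ck_on_cong[OF _ \<open>open S\<close>])
    show "Ck_on k S (\<lambda>y. \<Sum>a\<in>UNIV. partial_deriv i (\<lambda>z. \<psi> z $ a) y * partial_deriv a b (\<psi> y))"
    proof (rule Ck_on_sum[OF Ck_on_mult[OF _ _ \<open>open S\<close>] \<open>open S\<close>])
      show "Ck_on k S (\<lambda>y. partial_deriv a b (\<psi> y))" for a
      proof (rule Suc.IH)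
        show "Ck_on k S (\<lambda>y. \<psi> y $ a)" for a
          using Suc.prems(1) by (rule Ck_on_SucD)
        show "Ck_on k T (partial_deriv a b)" using Suc.prems(2) by simp
      qed
      show "Ck_on k S (partial_deriv i (\<lambda>z. \<psi> z $ a))" for a
        using Suc.prems(1)[of a] by simp
    qed
    show "(\<Sum>a\<in>UNIV. partial_deriv i (\<lambda>z. \<psi> z $ a) y * partial_deriv a b (\<psi> y))
        = partial_deriv i (\<lambda>y. b (\<psi> y)) y" if "y \<in> S" for y
      using partial_deriv_compose(1)[OF d[OF that], of i] by simp
  qed
  moreover have "(\<lambda>y. b (\<psi> y)) differentiable_on S"
    unfolding differentiable_on_def
    using partial_deriv_compose(2)[OF d] by (auto intro: differentiable_at_withinI)
  ultimately show ?case by simp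
qed

lemma Ck_on_inverse:
  fixes h :: "real^'n::finite \<Rightarrow> real"
  assumes "Ck_on k S h" "open S" "\<And>y. y \<in> S \<Longrightarrow> h y \<noteq> 0"
  shows "Ck_on k S (\<lambda>y. inverse (h y))"
proof -
  \<comment> \<open>The j-th derivative of 1/t.\<close>
  define F :: "nat \<Rightarrow> real \<Rightarrow> real" where "F j t = (-1) ^ j * fact j * inverse t ^ Suc j" for j t
  have "(F j has_real_derivative F (Suc j) t) (at t)" if "t \<in> - {0}" for j t
    unfolding F_def using that
      DERIV_cmult[OF DERIV_power[OF DERIV_inverse[of t UNIV], of "Suc j"], of "(-1) ^ j * fact j"]
    by (auto simp: algebra_simps)
  then have "Ck_on k S (\<lambda>y. F 0 (h y))"
    by (rule Ck_on_compose_real[where T = "- {0}"]) (use assms in auto)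
  then show ?thesis by (simp add: F_def)
qed

lemma Ck_on_powr:
  fixes h :: "real^'n::finite \<Rightarrow> real"
  assumes "Ck_on k S h" "open S" "\<And>y. y \<in> S \<Longrightarrow> h y > 0"
  shows "Ck_on k S (\<lambda>y. h y powr a)"
proof -
  \<comment> \<open>The j-th derivative of t^a, with the falling factorial a (a - 1) ... (a - j + 1)
    as coefficient.\<close>
  define F :: "nat \<Rightarrow> real \<Rightarrow> real" where "F j t = (\<Prod>i<j. a - real i) * t powr (a - real j)" for j t
  have "(F j has_real_derivative F (Suc j) t) (at t)" if "t \<in> {0<..}" for j t
    unfolding F_def using that
    by (auto intro!: derivative_eq_intros simp: field_simps)
  then have "Ck_on k S (\<lambda>y. F 0 (h y))"
    by (rule Ck_on_compose_real[where T = "{0<..}"]) (use assms in auto)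
  then show ?thesis by (simp add: F_def)
qed

lemma Ck_on_exp: "Ck_on k S h \<Longrightarrow> open S \<Longrightarrow> Ck_on k S (\<lambda>y. exp (h y))"
  by (rule Ck_on_compose_real[where F = "\<lambda>_. exp" and T = UNIV]) (auto intro: DERIV_exp)

text \<open>Both mixed derivatives are the limit of the same second difference quotient.\<close>

lemma second_difference:
  fixes h :: "real^'n::finite \<Rightarrow> real"
  assumes "Ck_on 2 S h" "open S" and t: "t > 0"
    and sub: "\<And>a b. 0 \<le> a \<Longrightarrow> a \<le> t \<Longrightarrow> 0 \<le> b \<Longrightarrow> b \<le> t \<Longrightarrow> y + a *\<^sub>R axis i 1 + b *\<^sub>R axis j 1 \<in> S"
  obtains a b where "0 < a" "a < t" "0 < b" "b < t"
    "h (y + t *\<^sub>R axis i 1 + t *\<^sub>R axis j 1) - h (y + t *\<^sub>R axis i 1) - h (y + t *\<^sub>R axis j 1) + h y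
      = t * t * partial_deriv j (partial_deriv i h) (y + a *\<^sub>R axis i 1 + b *\<^sub>R axis j 1)"
proof -
  let ?p = "\<lambda>a b. y + a *\<^sub>R axis i 1 + b *\<^sub>R axis j (1::real)"
  have C1: "Ck_on (Suc 0) S h" and C1': "Ck_on (Suc 0) S (partial_deriv i h)"
    using assms(1) Ck_on_SucD[of "Suc 0" S h] by (auto simp: numeral_2_eq_2)
  have dir: "((\<lambda>a. u (z + a *\<^sub>R axis l 1)) has_real_derivative partial_deriv l u (z + a *\<^sub>R axis l 1)) (at a)"
    if "Ck_on (Suc 0) S u" "z + a *\<^sub>R axis l 1 \<in> S" for u :: "real^'n \<Rightarrow> real" and z l a
  proof -
    have "u differentiable at (z + a *\<^sub>R axis l 1)"
      using Ck_on_differentiable[OF that(1) \<open>open S\<close> that(2)] .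
    then have D: "(u has_derivative frechet_derivative u (at (z + a *\<^sub>R axis l 1))) (at (z + a *\<^sub>R axis l 1))"
      by (simp add: frechet_derivative_works)
    have "((\<lambda>a. z + a *\<^sub>R axis l (1::real)) has_derivative (\<lambda>a. a *\<^sub>R axis l 1)) (at a)"
      by (auto intro!: derivative_eq_intros)
    from has_derivative_compose[OF this D] show ?thesis
      unfolding has_field_derivative_def partial_deriv_def
      using linear_cmul[OF has_derivative_linear[OF D]] by (simp add: mult.commute[of _ "frechet_derivative u _ _"])
  qed
  \<comment> \<open>Mean value theorem in direction \<open>i\<close>, applied to the difference of
    \<open>h\<close> in direction \<open>j\<close>; that difference is then resolved by a second
    mean value theorem.\<close>
  have "\<exists>a>0. a < t \<and> (h (?p t t) - h (?p t 0)) - (h (?p 0 t) - h (?p 0 0))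
      = (t - 0) * (partial_deriv i h (?p a t) - partial_deriv i h (?p a 0))"
  proof (rule MVT2[OF t])
    show "((\<lambda>a. h (?p a t) - h (?p a 0)) has_real_derivative
        partial_deriv i h (?p a t) - partial_deriv i h (?p a 0)) (at a)" if "0 \<le> a" "a \<le> t" for a
      using dir[OF C1, of "y + t *\<^sub>R axis j 1" a i] dir[OF C1, of y a i] sub[of a t] sub[of a 0] that t
      by (intro DERIV_diff) (auto simp: add.commute add.left_commute)
  qed
  then obtain a where a: "0 < a" "a < t"
    "(h (?p t t) - h (?p t 0)) - (h (?p 0 t) - h (?p 0 0))
      = t * (partial_deriv i h (?p a t) - partial_deriv i h (?p a 0))"
    by auto
  have "\<exists>b>0. b < t \<and> partial_deriv i h (?p a t) - partial_deriv i h (?p a 0)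
      = (t - 0) * partial_deriv j (partial_deriv i h) (?p a b)"
    by (rule MVT2[OF t]) (use sub a in \<open>auto intro!: dir[OF C1']\<close>)
  then obtain b where b: "0 < b" "b < t"
    "partial_deriv i h (?p a t) - partial_deriv i h (?p a 0)
      = t * partial_deriv j (partial_deriv i h) (?p a b)"
    by auto
  show ?thesis by (rule that[OF a(1,2) b(1,2)]) (use a(3) b(3) in \<open>simp add: algebra_simps\<close>)
qed

lemma partial_deriv_commute:
  fixes h :: "real^'n::finite \<Rightarrow> real"
  assumes C2: "Ck_on 2 S h" and "open S" "y \<in> S"
  shows "partial_deriv i (partial_deriv j h) y = partial_deriv j (partial_deriv i h) y"
proof (rule ccontr)
  let ?A = "partial_deriv i (partial_deriv j h)" and ?B = "partial_deriv j (partial_deriv i h)"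
  assume ne: "?A y \<noteq> ?B y"
  \<comment> \<open>Both mixed derivatives take a common value at points where each is within
    \<open>e\<close> of its value at \<open>y\<close>. This puts \<open>?A y\<close> and
    \<open>?B y\<close> less than \<open>2 * e\<close> apart, which is exactly their
    distance.\<close>
  define e where "e = \<bar>?A y - ?B y\<bar> / 2"
  have "e > 0" using ne by (simp add: e_def)
  have "continuous_on S ?A" "continuous_on S ?B"
    using C2 by (auto simp: numeral_2_eq_2)
  then have "isCont ?A y" "isCont ?B y"
    using assms by (auto simp: continuous_on_eq_continuous_at)
  then obtain d1 d2 where d: "d1 > 0" "\<And>z. dist z y < d1 \<Longrightarrow> dist (?A z) (?A y) < e"
      "d2 > 0" "\<And>z. dist z y < d2 \<Longrightarrow> dist (?B z) (?B y) < e"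
    using \<open>e > 0\<close> unfolding continuous_at_eps_delta by metis
  obtain d3 where d3: "d3 > 0" "ball y d3 \<subseteq> S"
    using assms open_contains_ball by blast
  \<comment> \<open>Division by 3 keeps a displacement of at most \<open>t\<close> in each of two
    directions strictly below all three radii.\<close>
  define t where "t = min d1 (min d2 d3) / 3"
  have t: "t > 0" using d d3 by (simp add: t_def)
  have near: "dist (y + a *\<^sub>R axis l 1 + b *\<^sub>R axis q 1) y < min d1 (min d2 d3)"
    if "0 \<le> a" "a \<le> t" "0 \<le> b" "b \<le> t" for a b and l q :: 'n
  proof -
    have "dist (y + a *\<^sub>R axis l 1 + b *\<^sub>R axis q 1) y = norm (a *\<^sub>R axis l 1 + b *\<^sub>R axis q (1::real))"
      by (simp add: dist_norm)
    also have "\<dots> \<le> a + b" using that norm_triangle_ineq[of "a *\<^sub>R axis l 1" "b *\<^sub>R axis q (1::real)"] by simp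
    also have "\<dots> < min d1 (min d2 d3)" using that t by (simp add: t_def)
    finally show ?thesis .
  qed
  have sub: "y + a *\<^sub>R axis l 1 + b *\<^sub>R axis q 1 \<in> S"
    if "0 \<le> a" "a \<le> t" "0 \<le> b" "b \<le> t" for a b and l q :: 'n
    using near[OF that] d3 by (auto simp: dist_commute)
  obtain a b where ab: "0 < a" "a < t" "0 < b" "b < t"
    "h (y + t *\<^sub>R axis i 1 + t *\<^sub>R axis j 1) - h (y + t *\<^sub>R axis i 1) - h (y + t *\<^sub>R axis j 1) + h y
      = t * t * ?B (y + a *\<^sub>R axis i 1 + b *\<^sub>R axis j 1)"
    by (rule second_difference[OF C2 \<open>open S\<close> t, of y i j]) (use sub in blast)+
  obtain a' b' where ab': "0 < a'" "a' < t" "0 < b'" "b' < t"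
    "h (y + t *\<^sub>R axis j 1 + t *\<^sub>R axis i 1) - h (y + t *\<^sub>R axis j 1) - h (y + t *\<^sub>R axis i 1) + h y
      = t * t * ?A (y + a' *\<^sub>R axis j 1 + b' *\<^sub>R axis i 1)"
    by (rule second_difference[OF C2 \<open>open S\<close> t, of y j i]) (use sub in blast)+
  have "t * t * ?A (y + a' *\<^sub>R axis j 1 + b' *\<^sub>R axis i 1)
      = t * t * ?B (y + a *\<^sub>R axis i 1 + b *\<^sub>R axis j 1)"
    unfolding ab(5)[symmetric] ab'(5)[symmetric] by (simp add: add.commute add.left_commute)
  then have "?A (y + a' *\<^sub>R axis j 1 + b' *\<^sub>R axis i 1) = ?B (y + a *\<^sub>R axis i 1 + b *\<^sub>R axis j 1)"
    using t by simp
  moreover have "\<bar>?A (y + a' *\<^sub>R axis j 1 + b' *\<^sub>R axis i 1) - ?A y\<bar> < e"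
    using d(2)[of "y + a' *\<^sub>R axis j 1 + b' *\<^sub>R axis i 1"] near[of a' b' j i] ab' by (simp add: dist_real_def)
  moreover have "\<bar>?B (y + a *\<^sub>R axis i 1 + b *\<^sub>R axis j 1) - ?B y\<bar> < e"
    using d(4)[of "y + a *\<^sub>R axis i 1 + b *\<^sub>R axis j 1"] near[of a b i j] ab by (simp add: dist_real_def)
  ultimately show False by (simp add: e_def abs_if split: if_splits)
qed

section \<open>Functions in a coordinate patch\<close>

lemma matrix_inv_mult:
  fixes B :: "'b::semiring_1^'n::finite^'n"
  assumes "invertible B"
  shows "B ** matrix_inv B = mat 1" "matrix_inv B ** B = mat 1"
  using someI_ex[OF assms[unfolded invertible_def]] unfolding matrix_inv_def by auto

lemma posdef_invertible:
  fixes B :: "real^'n::finite^'n"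
  assumes "\<And>v. v \<noteq> 0 \<Longrightarrow> v \<bullet> (B *v v) > 0"
  shows "invertible B"
proof -
  have "v = 0" if "B *v v = 0" for v
    using assms[of v] that by (cases "v = 0") auto
  then have "\<exists>L. L ** B = mat 1"
    using matrix_left_invertible_ker[of B] by blast
  then show ?thesis
    unfolding invertible_def using matrix_left_right_inverse by blast
qed

text \<open>The determinant does not vanish on the segment from the identity matrix to \<open>B\<close>.\<close>

lemma posdef_det_pos:
  fixes B :: "real^'n::finite^'n"
  assumes B: "\<And>v. v \<noteq> 0 \<Longrightarrow> v \<bullet> (B *v v) > 0"
  shows "det B > 0"
proof (rule ccontr)
  assume neg: "\<not> det B > 0"
  define M where "M t = (1 - t) *\<^sub>R mat 1 + t *\<^sub>R B" for t
  have nz: "det (M t) \<noteq> 0" if t: "0 \<le> t" "t \<le> 1" for t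
  proof -
    have "v \<bullet> (M t *v v) > 0" if "v \<noteq> 0" for v
    proof -
      have "v \<bullet> (M t *v v) = (1 - t) * (v \<bullet> v) + t * (v \<bullet> (B *v v))"
        by (simp add: M_def matrix_vector_mult_add_rdistrib scaleR_matrix_vector_assoc[symmetric] inner_add_right)
      moreover have "v \<bullet> v > 0" "v \<bullet> (B *v v) > 0" using that B by auto
      ultimately show ?thesis using t
        by (cases "t = 0") (auto intro!: add_nonneg_pos mult_nonneg_nonneg)
    qed
    then show ?thesis using posdef_invertible invertible_det_nz by blast
  qed
  have "continuous_on {0..1} (\<lambda>t. det (M t))"
    unfolding det_def M_def by (intro continuous_intros)
  moreover have "det (M 0) = 1" "det (M 1) = det B" by (simp_all add: M_def)
  ultimately obtain t where "0 \<le> t" "t \<le> 1" "det (M t) = 0"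
    using IVT2'[of "\<lambda>t. det (M t)" 1 0 0] neg by auto
  then show False using nz by blast
qed

lemma Ck_on_det:
  fixes B :: "real^'m::finite \<Rightarrow> real^'n::finite^'n"
  assumes "\<And>i j. Ck_on k S (\<lambda>y. B y $ i $ j)" "open S"
  shows "Ck_on k S (\<lambda>y. det (B y))"
  unfolding det_def
  by (rule Ck_on_sum[OF Ck_on_mult[OF Ck_on_const Ck_on_prod \<open>open S\<close>] \<open>open S\<close>]) (use assms in auto)

text \<open>Cramer's rule: each entry of the inverse is a quotient of determinants, hence as regular
  as the entries of \<open>B\<close>.\<close>

lemma Ck_on_matrix_inv:
  fixes B :: "real^'m::finite \<Rightarrow> real^'n::finite^'n"
  assumes B: "\<And>i j. Ck_on k S (\<lambda>y. B y $ i $ j)" and "open S" and inv: "\<And>y. y \<in> S \<Longrightarrow> invertible (B y)"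
  shows "Ck_on k S (\<lambda>y. matrix_inv (B y) $ i $ j)"
proof (rule Ck_on_cong[OF _ \<open>open S\<close>])
  \<comment> \<open>\<open>B y\<close> with column \<open>i\<close> replaced by the
    \<open>j\<close>-th unit vector.\<close>
  let ?N = "\<lambda>y. (\<chi> r q. if q = i then axis j 1 $ r else B y $ r $ q) :: real^'n^'n"
  have dB: "det (B y) \<noteq> 0" if "y \<in> S" for y
    using inv[OF that] invertible_det_nz by blast
  show "Ck_on k S (\<lambda>y. det (?N y) * inverse (det (B y)))"
  proof (intro Ck_on_mult Ck_on_inverse Ck_on_det)
    show "Ck_on k S (\<lambda>y. ?N y $ r $ q)" for r q
      using B by (cases "q = i") (auto simp: Ck_on_const)
  qed (use B dB \<open>open S\<close> in auto)
  show "det (?N y) * inverse (det (B y)) = matrix_inv (B y) $ i $ j" if "y \<in> S" for y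
  proof -
    have "B y *v (matrix_inv (B y) *v axis j 1) = axis j 1"
      using matrix_inv_mult(1)[OF inv[OF that]] by (simp add: matrix_vector_mul_assoc)
    then have "matrix_inv (B y) *v axis j 1
        = (\<chi> l. det (\<chi> r q. if q = l then axis j 1 $ r else B y $ r $ q) / det (B y))"
      using cramer[OF dB[OF that]] by blast
    then have "(matrix_inv (B y) *v axis j 1) $ i = det (?N y) / det (B y)"
      by simp
    then show ?thesis
      by (simp add: matrix_vector_mult_basis column_def divide_inverse)
  qed
qed

section \<open>Regularity and partial derivatives in a single chart\<close>

definition chart_Ck :: "('a, 'n::finite) chart \<Rightarrow> 'a set \<Rightarrow> nat \<Rightarrow> ('a \<Rightarrow> real) \<Rightarrow> bool" where
  "chart_Ck c W k u \<longleftrightarrow> Ck_on k (snd c ` W) (u \<circ> chart_inv c)"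

text \<open>\<open>W\<close> may be smaller than the chart domain: it will be the domain without the
  pole, an overlap of two charts, or the part outside a compact set.\<close>

locale coord_patch =
  fixes c :: "('a::topological_space, 'n::finite) chart" and W :: "'a set"
  assumes chart: "is_chart c" and open_W: "open W" and W_sub: "W \<subseteq> fst c"
begin

abbreviation C :: "nat \<Rightarrow> ('a \<Rightarrow> real) \<Rightarrow> bool" where
  "C k u \<equiv> chart_Ck c W k u"

lemma chart_inv_left: "x \<in> fst c \<Longrightarrow> chart_inv c (snd c x) = x"
  using chart unfolding is_chart_def homeomorphism_def by blast

lemma chart_inj: "inj_on (snd c) (fst c)"
  by (metis chart_inv_left inj_on_inverseI)

lemma open_image: "open V \<Longrightarrow> V \<subseteq> fst c \<Longrightarrow> open (snd c ` V)"
  using chart unfolding is_chart_def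
  by (metis homeomorphism_imp_open_map open_openin_trans openin_open_eq open_subset)

lemma open_U: "open (snd c ` W)"
  using open_image open_W W_sub by blast

lemma chart_inv_W: "x \<in> W \<Longrightarrow> chart_inv c (snd c x) = x"
  using chart_inv_left W_sub by blast

lemma C_cong: "C k u \<Longrightarrow> (\<And>x. x \<in> W \<Longrightarrow> u x = v x) \<Longrightarrow> C k v"
  unfolding chart_Ck_def by (erule Ck_on_cong[OF _ open_U]) (auto simp: chart_inv_W)

lemma C_mono: "C l u \<Longrightarrow> k \<le> l \<Longrightarrow> C k u"
  unfolding chart_Ck_def by (rule Ck_on_mono)

lemma C_const: "C k (\<lambda>_. a)"
  unfolding chart_Ck_def by (simp add: o_def Ck_on_const)

lemma C_add: "C k u \<Longrightarrow> C k v \<Longrightarrow> C k (\<lambda>x. u x + v x)"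
  unfolding chart_Ck_def using Ck_on_add[OF _ _ open_U] by (simp add: o_def)

lemma C_diff: "C k u \<Longrightarrow> C k v \<Longrightarrow> C k (\<lambda>x. u x - v x)"
  unfolding chart_Ck_def using Ck_on_diff[OF _ _ open_U] by (simp add: o_def)

lemma C_mult: "C k u \<Longrightarrow> C k v \<Longrightarrow> C k (\<lambda>x. u x * v x)"
  unfolding chart_Ck_def using Ck_on_mult[OF _ _ open_U] by (simp add: o_def)

lemma C_cmult: "C k u \<Longrightarrow> C k (\<lambda>x. a * u x)"
  by (rule C_mult[OF C_const])

lemma C_sum: "(\<And>i. i \<in> I \<Longrightarrow> C k (u i)) \<Longrightarrow> C k (\<lambda>x. \<Sum>i\<in>I. u i x)"
  unfolding chart_Ck_def
  using Ck_on_sum[OF _ open_U, of I k "\<lambda>i. u i \<circ> chart_inv c"] by (simp add: o_def)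

lemma C_powr:
  assumes "C k u" "\<And>x. x \<in> W \<Longrightarrow> u x > 0"
  shows "C k (\<lambda>x. u x powr a)"
  using Ck_on_powr[OF _ open_U, of k "u \<circ> chart_inv c" a] assms
  unfolding chart_Ck_def by (force simp: o_def chart_inv_W)

lemma C_exp: "C k u \<Longrightarrow> C k (\<lambda>x. exp (u x))"
  unfolding chart_Ck_def using Ck_on_exp[OF _ open_U, of k "u \<circ> chart_inv c"] by (simp add: o_def)

lemma C_power2: "C k u \<Longrightarrow> C k (\<lambda>x. (u x)\<^sup>2)"
  using C_mult[of k u u] by (simp add: power2_eq_square)

lemma C_minus: "C k u \<Longrightarrow> C k (\<lambda>x. - u x)"
  using C_cmult[of k u "-1"] by simp

lemmas C_intros = C_const C_add C_diff C_mult C_sum C_power2 C_minus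

lemma C_pd: "C (Suc k) u \<Longrightarrow> C k (pd c i u)"
  unfolding chart_Ck_def
  by (rule Ck_on_cong[where h = "partial_deriv i (u \<circ> chart_inv c)", OF _ open_U])
    (auto simp: pd_def chart_inv_W)

lemma C_continuous: "C k u \<Longrightarrow> continuous_on W u"
proof -
  assume "C k u"
  then have "continuous_on (snd c ` W) (u \<circ> chart_inv c)"
    unfolding chart_Ck_def by (rule Ck_on_continuous)
  moreover have "continuous_on W (snd c)"
    using chart W_sub unfolding is_chart_def homeomorphism_def by (metis continuous_on_subset)
  ultimately have "continuous_on W ((u \<circ> chart_inv c) \<circ> snd c)"
    by (metis continuous_on_compose)
  then show ?thesis by (rule continuous_on_eq) (simp add: chart_inv_W)
qed

lemma C_differentiable: "C 1 u \<Longrightarrow> x \<in> W \<Longrightarrow> (u \<circ> chart_inv c) differentiable (at (snd c x))"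
  unfolding chart_Ck_def using Ck_on_differentiable[OF _ open_U, of 0] by simp

lemma pd_cong: "(\<And>z. z \<in> W \<Longrightarrow> u z = v z) \<Longrightarrow> x \<in> W \<Longrightarrow> pd c i u x = pd c i v x"
  unfolding pd_def by (rule partial_deriv_cong[OF open_U]) (auto simp: chart_inv_W)

lemma pd_const [simp]: "pd c i (\<lambda>_. a) x = 0"
  by (simp add: pd_def o_def)

lemma pd_add: "C 1 u \<Longrightarrow> C 1 v \<Longrightarrow> x \<in> W \<Longrightarrow> pd c i (\<lambda>z. u z + v z) x = pd c i u x + pd c i v x"
  unfolding pd_def using partial_deriv_add[OF C_differentiable C_differentiable] by (simp add: o_def)

lemma pd_mult:
  "C 1 u \<Longrightarrow> C 1 v \<Longrightarrow> x \<in> W \<Longrightarrow> pd c i (\<lambda>z. u z * v z) x = pd c i u x * v x + u x * pd c i v x"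
  unfolding pd_def using partial_deriv_mult[OF C_differentiable C_differentiable]
  by (simp add: o_def chart_inv_W)

lemma pd_cmult: "C 1 u \<Longrightarrow> x \<in> W \<Longrightarrow> pd c i (\<lambda>z. a * u z) x = a * pd c i u x"
  using pd_mult[OF C_const] by simp

lemma pd_minus: "C 1 u \<Longrightarrow> x \<in> W \<Longrightarrow> pd c i (\<lambda>z. - u z) x = - pd c i u x"
  using pd_cmult[of u x i "-1"] by simp

lemma pd_diff: "C 1 u \<Longrightarrow> C 1 v \<Longrightarrow> x \<in> W \<Longrightarrow> pd c i (\<lambda>z. u z - v z) x = pd c i u x - pd c i v x"
  using pd_add[of u "\<lambda>z. - v z"] by (simp add: C_minus pd_minus)

lemma pd_sum:
  "finite I \<Longrightarrow> (\<And>j. j \<in> I \<Longrightarrow> C 1 (u j)) \<Longrightarrow> x \<in> W \<Longrightarrow>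
    pd c i (\<lambda>z. \<Sum>j\<in>I. u j z) x = (\<Sum>j\<in>I. pd c i (u j) x)"
proof (induction I rule: finite_induct)
  case (insert j I)
  have "C 1 (\<lambda>z. \<Sum>j\<in>I. u j z)" using insert.prems by (intro C_sum) auto
  then show ?case using insert by (simp add: pd_add)
qed simp

lemma pd_real:
  "C 1 u \<Longrightarrow> x \<in> W \<Longrightarrow> (F has_real_derivative F') (at (u x)) \<Longrightarrow>
    pd c i (\<lambda>z. F (u z)) x = F' * pd c i u x"
  unfolding pd_def using partial_deriv_compose_real(1)[OF C_differentiable, of u x F F' i]
  by (simp add: o_def chart_inv_W)

lemma pd_commute: "C 2 u \<Longrightarrow> x \<in> W \<Longrightarrow> pd c i (pd c j u) x = pd c j (pd c i u) x"
proof -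
  assume u: "C 2 u" and x: "x \<in> W"
  have "partial_deriv l (pd c q u \<circ> chart_inv c) (snd c x)
      = partial_deriv l (partial_deriv q (u \<circ> chart_inv c)) (snd c x)" for l q
    by (rule partial_deriv_cong[OF open_U]) (use x in \<open>auto simp: pd_def chart_inv_W\<close>)
  then show ?thesis
    using partial_deriv_commute[OF u[unfolded chart_Ck_def] open_U] x by (simp add: pd_def[of c i] pd_def[of c j])
qed

end

section \<open>Tensor calculus in a coordinate patch\<close>

text \<open>The pairing of du with grad v. The form is lopsided, but a derivative of it falls only
  on \<open>pd c i u\<close> and on the gradient of \<open>v\<close>; symmetry and agreement with
  the metric are in \<open>chart_inner_eq\<close>.\<close>

definition chart_inner ::
  "('a, 'n::finite) metric \<Rightarrow> ('a, 'n) chart \<Rightarrow> ('a \<Rightarrow> real) \<Rightarrow> ('a \<Rightarrow> real) \<Rightarrow> 'a \<Rightarrow> real" where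
  "chart_inner g c u v x = (\<Sum>i\<in>UNIV. pd c i u x * grad g c v x $ i)"

text \<open>The expression of \<open>divergence\<close> with one chart kept while the point moves,
  so that it can be differentiated again.\<close>

definition chart_div ::
  "('a, 'n::finite) metric \<Rightarrow> ('a, 'n) chart \<Rightarrow> ('a \<Rightarrow> real^'n) \<Rightarrow> 'a \<Rightarrow> real" where
  "chart_div g c Z x =
     (\<Sum>i\<in>UNIV. pd c i (\<lambda>z. Z z $ i) x + (\<Sum>j\<in>UNIV. christoffel g c i i j x * Z x $ j))"

definition chart_laplacian ::
  "('a, 'n::finite) metric \<Rightarrow> ('a, 'n) chart \<Rightarrow> ('a \<Rightarrow> real) \<Rightarrow> 'a \<Rightarrow> real" where
  "chart_laplacian g c u = chart_div g c (grad g c u)"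

text \<open>The components \<open>\<nabla>\<^sub>k (\<nabla>u)\<^sup>j\<close>.\<close>

definition cov_grad ::
  "('a, 'n::finite) metric \<Rightarrow> ('a, 'n) chart \<Rightarrow> ('a \<Rightarrow> real) \<Rightarrow> 'n \<Rightarrow> 'n \<Rightarrow> 'a \<Rightarrow> real" where
  "cov_grad g c u j k x =
     pd c k (\<lambda>z. grad g c u z $ j) x + (\<Sum>l\<in>UNIV. christoffel g c j k l x * grad g c u x $ l)"

lemma divergence_eq_chart_div: "divergence A g Z x = chart_div g (chart_at A x) (Z (chart_at A x)) x"
  by (simp add: divergence_def chart_div_def Let_def)

lemma laplacian_eq_chart: "laplacian A g u x = chart_laplacian g (chart_at A x) u x"
  by (simp add: laplacian_def divergence_eq_chart_div chart_laplacian_def)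

lemma sum_swap3:
  fixes F :: "'i::finite \<Rightarrow> 'i \<Rightarrow> 'i \<Rightarrow> real"
  shows "(\<Sum>j\<in>UNIV. \<Sum>k\<in>UNIV. \<Sum>l\<in>UNIV. F j k l) = (\<Sum>k\<in>UNIV. \<Sum>l\<in>UNIV. \<Sum>j\<in>UNIV. F j k l)"
    and "(\<Sum>j\<in>UNIV. \<Sum>k\<in>UNIV. \<Sum>l\<in>UNIV. F j k l) = (\<Sum>l\<in>UNIV. \<Sum>j\<in>UNIV. \<Sum>k\<in>UNIV. F j k l)"
proof -
  have "(\<Sum>j\<in>UNIV. \<Sum>k\<in>UNIV. \<Sum>l\<in>UNIV. F j k l) = (\<Sum>k\<in>UNIV. \<Sum>j\<in>UNIV. \<Sum>l\<in>UNIV. F j k l)" by (rule sum.swap)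
  also have "\<dots> = (\<Sum>k\<in>UNIV. \<Sum>l\<in>UNIV. \<Sum>j\<in>UNIV. F j k l)"
    by (rule sum.cong[OF refl], rule sum.swap)
  finally show "(\<Sum>j\<in>UNIV. \<Sum>k\<in>UNIV. \<Sum>l\<in>UNIV. F j k l) = (\<Sum>k\<in>UNIV. \<Sum>l\<in>UNIV. \<Sum>j\<in>UNIV. F j k l)" .
  have "(\<Sum>j\<in>UNIV. \<Sum>k\<in>UNIV. \<Sum>l\<in>UNIV. F j k l) = (\<Sum>j\<in>UNIV. \<Sum>l\<in>UNIV. \<Sum>k\<in>UNIV. F j k l)"
    by (rule sum.cong[OF refl], rule sum.swap)
  also have "\<dots> = (\<Sum>l\<in>UNIV. \<Sum>j\<in>UNIV. \<Sum>k\<in>UNIV. F j k l)" by (rule sum.swap)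
  finally show "(\<Sum>j\<in>UNIV. \<Sum>k\<in>UNIV. \<Sum>l\<in>UNIV. F j k l) = (\<Sum>l\<in>UNIV. \<Sum>j\<in>UNIV. \<Sum>k\<in>UNIV. F j k l)" .
qed

locale metric_patch = coord_patch c W
  for c :: "('a::topological_space, 'n::finite) chart" and W +
  fixes g :: "('a, 'n) metric"
  assumes metric_sym: "x \<in> W \<Longrightarrow> g c x $ i $ j = g c x $ j $ i"
    and metric_pos: "x \<in> W \<Longrightarrow> v \<noteq> 0 \<Longrightarrow> v \<bullet> (g c x *v v) > 0"
    and C_metric: "\<And>k. C k (\<lambda>z. g c z $ i $ j)"
begin

abbreviation christ ("\<Gamma>") where "\<Gamma> \<equiv> christoffel g c"
abbreviation X where "X u x i \<equiv> grad g c u x $ i"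

lemma metric_invertible: "x \<in> W \<Longrightarrow> invertible (g c x)"
  using posdef_invertible metric_pos by blast

lemma sum_metric_ginv:
  assumes "x \<in> W"
  shows "(\<Sum>l\<in>UNIV. g c x $ i $ l * ginv g c x $ l $ j) = (if i = j then 1 else 0)"
    and "(\<Sum>l\<in>UNIV. ginv g c x $ i $ l * g c x $ l $ j) = (if i = j then 1 else 0)"
proof -
  have "(g c x ** ginv g c x) $ i $ j = mat 1 $ i $ j" "(ginv g c x ** g c x) $ i $ j = mat 1 $ i $ j"
    unfolding ginv_def by (simp_all add: matrix_inv_mult[OF metric_invertible[OF assms]])
  then show "(\<Sum>l\<in>UNIV. g c x $ i $ l * ginv g c x $ l $ j) = (if i = j then 1 else 0)"
    and "(\<Sum>l\<in>UNIV. ginv g c x $ i $ l * g c x $ l $ j) = (if i = j then 1 else 0)"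
    by (simp_all add: matrix_matrix_mult_def mat_def)
qed

lemma lower_raise:
  assumes "x \<in> W"
  shows "(\<Sum>j\<in>UNIV. g c x $ i $ j * (\<Sum>l\<in>UNIV. ginv g c x $ j $ l * b l)) = b i"
proof -
  have "(\<Sum>j\<in>UNIV. g c x $ i $ j * (\<Sum>l\<in>UNIV. ginv g c x $ j $ l * b l))
      = (\<Sum>l\<in>UNIV. (\<Sum>j\<in>UNIV. g c x $ i $ j * ginv g c x $ j $ l) * b l)"
    by (simp add: sum_distrib_left sum_distrib_right mult.assoc) (rule sum.swap)
  also have "\<dots> = b i" by (simp add: sum_metric_ginv[OF assms] if_distrib[of "\<lambda>t. t * _"] cong: if_cong)
  finally show ?thesis .
qed

lemma raise_lower:
  assumes "x \<in> W"
  shows "(\<Sum>j\<in>UNIV. ginv g c x $ i $ j * (\<Sum>l\<in>UNIV. g c x $ j $ l * b l)) = b i"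
proof -
  have "(\<Sum>j\<in>UNIV. ginv g c x $ i $ j * (\<Sum>l\<in>UNIV. g c x $ j $ l * b l))
      = (\<Sum>l\<in>UNIV. (\<Sum>j\<in>UNIV. ginv g c x $ i $ j * g c x $ j $ l) * b l)"
    by (simp add: sum_distrib_left sum_distrib_right mult.assoc) (rule sum.swap)
  also have "\<dots> = b i" by (simp add: sum_metric_ginv[OF assms] if_distrib[of "\<lambda>t. t * _"] cong: if_cong)
  finally show ?thesis .
qed

lemma ginv_sym:
  assumes x: "x \<in> W"
  shows "ginv g c x $ i $ j = ginv g c x $ j $ i"
proof -
  have "ginv g c x $ i $ j = (\<Sum>k\<in>UNIV. ginv g c x $ i $ k * (if k = j then 1 else 0))"
    by (simp add: if_distrib[of "\<lambda>t. _ * t"] cong: if_cong)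
  also have "\<dots> = (\<Sum>k\<in>UNIV. ginv g c x $ i $ k * (\<Sum>l\<in>UNIV. g c x $ k $ l * ginv g c x $ j $ l))"
  proof (rule sum.cong[OF refl])
    fix k
    have "(\<Sum>l\<in>UNIV. g c x $ k $ l * ginv g c x $ j $ l) = (\<Sum>l\<in>UNIV. ginv g c x $ j $ l * g c x $ l $ k)"
      using metric_sym[OF x] by (simp add: mult.commute)
    then show "ginv g c x $ i $ k * (if k = j then 1 else 0)
        = ginv g c x $ i $ k * (\<Sum>l\<in>UNIV. g c x $ k $ l * ginv g c x $ j $ l)"
      using sum_metric_ginv(2)[OF x, of j k] by auto
  qed
  also have "\<dots> = ginv g c x $ j $ i" by (rule raise_lower[OF x])
  finally show ?thesis .
qed

lemma C_ginv: "C k (\<lambda>z. ginv g c z $ i $ j)"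
  unfolding chart_Ck_def o_def ginv_def
proof (rule Ck_on_matrix_inv[OF _ open_U])
  show "Ck_on k (snd c ` W) (\<lambda>y. g c (chart_inv c y) $ i $ j)" for i j
    using C_metric[of k i j] unfolding chart_Ck_def o_def .
  show "invertible (g c (chart_inv c y))" if "y \<in> snd c ` W" for y
    using that metric_invertible by (auto simp: chart_inv_W)
qed

lemma C_christoffel: "C k (\<Gamma> a i j)"
  unfolding christoffel_def[abs_def] by (intro C_intros C_ginv C_pd C_metric)

lemma C_grad: "C (Suc k) u \<Longrightarrow> C k (\<lambda>z. X u z i)"
  unfolding grad_def by (auto intro!: C_sum C_mult C_ginv C_pd)

lemma christoffel_sym:
  assumes "x \<in> W" shows "\<Gamma> k i j x = \<Gamma> k j i x"
proof -
  have "pd c l (\<lambda>z. g c z $ i $ j) x = pd c l (\<lambda>z. g c z $ j $ i) x" for l i j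
    using assms by (intro pd_cong metric_sym)
  then show ?thesis unfolding christoffel_def
    by (intro arg_cong[of _ _ "\<lambda>t. 1/2 * t"] sum.cong refl) (simp add: algebra_simps)
qed

text \<open>Lowering the index cancels the inverse metric and leaves the Christoffel symbols of the
  first kind.\<close>

lemma lower_christoffel:
  assumes "x \<in> W"
  shows "(\<Sum>k\<in>UNIV. g c x $ a $ k * \<Gamma> k i j x) = 1/2 * (pd c i (\<lambda>z. g c z $ j $ a) x
    + pd c j (\<lambda>z. g c z $ i $ a) x - pd c a (\<lambda>z. g c z $ i $ j) x)"
proof -
  have "(\<Sum>k\<in>UNIV. g c x $ a $ k * \<Gamma> k i j x) = 1/2 * (\<Sum>k\<in>UNIV. g c x $ a $ k *
    (\<Sum>l\<in>UNIV. ginv g c x $ k $ l * (pd c i (\<lambda>z. g c z $ j $ l) x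
    + pd c j (\<lambda>z. g c z $ i $ l) x - pd c l (\<lambda>z. g c z $ i $ j) x)))"
    unfolding christoffel_def by (simp add: sum_distrib_left mult_ac)
  then show ?thesis by (simp only: lower_raise[OF assms])
qed

lemma lower_grad: "x \<in> W \<Longrightarrow> (\<Sum>j\<in>UNIV. g c x $ i $ j * X u x j) = pd c i u x"
  unfolding grad_def by (simp add: lower_raise)

lemma hess_sym:
  assumes "C 2 u" "x \<in> W"
  shows "hess g c u x $ i $ j = hess g c u x $ j $ i"
  using pd_commute[OF assms, of i j] christoffel_sym[OF assms(2), of _ i j] by (simp add: hess_def)

text \<open>Metric compatibility: lowering an index commutes with covariant differentiation.
  Differentiating g_ij X^j = d_i u brings in derivatives of the metric, which combine with the
  first-kind symbols from \<open>cov_grad\<close> into the correction term of the Hessian.\<close>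

lemma lower_cov_grad:
  assumes u: "C 2 u" and x: "x \<in> W"
  shows "(\<Sum>j\<in>UNIV. g c x $ i $ j * cov_grad g c u j k x) = hess g c u x $ k $ i"
proof -
  let ?dg = "\<lambda>k i j. pd c k (\<lambda>z. g c z $ i $ j) x"
  let ?X = "\<lambda>l. X u x l"
  have u2: "C (Suc 1) u" using u by (simp add: numeral_2_eq_2)
  have dsym: "?dg l i j = ?dg l j i" for l i j using x by (intro pd_cong metric_sym)
  have "pd c k (pd c i u) x = pd c k (\<lambda>z. \<Sum>j\<in>UNIV. g c z $ i $ j * X u z j) x"
    using x lower_grad by (intro pd_cong) auto
  also have "\<dots> = (\<Sum>j\<in>UNIV. ?dg k i j * ?X j + g c x $ i $ j * pd c k (\<lambda>z. X u z j) x)"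
    using x u2 by (simp add: pd_sum pd_mult C_mult C_metric C_grad del: One_nat_def)
  finally have 1: "(\<Sum>j\<in>UNIV. g c x $ i $ j * pd c k (\<lambda>z. X u z j) x)
      = pd c k (pd c i u) x - (\<Sum>j\<in>UNIV. ?dg k i j * ?X j)"
    by (simp add: sum.distrib)
  have "(\<Sum>j\<in>UNIV. g c x $ i $ j * (\<Sum>l\<in>UNIV. \<Gamma> j k l x * ?X l))
      = (\<Sum>l\<in>UNIV. (\<Sum>j\<in>UNIV. g c x $ i $ j * \<Gamma> j k l x) * ?X l)"
    by (simp add: sum_distrib_left sum_distrib_right mult.assoc) (rule sum.swap)
  then have 2: "(\<Sum>j\<in>UNIV. g c x $ i $ j * cov_grad g c u j k x) = pd c k (pd c i u) x
      - (\<Sum>l\<in>UNIV. ?dg k i l * ?X l) + (\<Sum>l\<in>UNIV. 1/2 * (?dg k l i + ?dg l k i - ?dg i k l) * ?X l)"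
    unfolding cov_grad_def distrib_left sum.distrib 1 lower_christoffel[OF x] by simp
  have "(\<Sum>p\<in>UNIV. \<Gamma> p k i x * pd c p u x) = (\<Sum>p\<in>UNIV. \<Gamma> p k i x * (\<Sum>l\<in>UNIV. g c x $ p $ l * ?X l))"
    by (simp add: lower_grad[OF x])
  also have "\<dots> = (\<Sum>l\<in>UNIV. (\<Sum>p\<in>UNIV. g c x $ p $ l * \<Gamma> p k i x) * ?X l)"
    by (simp add: sum_distrib_left sum_distrib_right mult_ac) (rule sum.swap)
  also have "\<dots> = (\<Sum>l\<in>UNIV. (\<Sum>p\<in>UNIV. g c x $ l $ p * \<Gamma> p k i x) * ?X l)"
    by (simp add: metric_sym[OF x])
  also have "\<dots> = (\<Sum>l\<in>UNIV. 1/2 * (?dg k i l + ?dg i k l - ?dg l k i) * ?X l)"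
    unfolding lower_christoffel[OF x] ..
  finally have "hess g c u x $ k $ i = pd c k (pd c i u) x
      - (\<Sum>l\<in>UNIV. 1/2 * (?dg k i l + ?dg i k l - ?dg l k i) * ?X l)"
    by (simp add: hess_def)
  then show ?thesis unfolding 2
    by (simp add: sum_subtractf[symmetric] sum.distrib[symmetric] diff_add_eq dsym[of k _ i])
      (simp add: sum_subtractf sum.distrib sum_divide_distrib[symmetric] algebra_simps add_divide_distrib diff_divide_distrib)
qed

lemma cov_grad_eq_raise:
  assumes "C 2 u" "x \<in> W"
  shows "cov_grad g c u j k x = (\<Sum>i\<in>UNIV. ginv g c x $ j $ i * hess g c u x $ k $ i)"
  using raise_lower[OF assms(2), of j "\<lambda>l. cov_grad g c u l k x"] by (simp add: lower_cov_grad[OF assms])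

lemma chart_laplacian_eq_trace: "chart_laplacian g c u x = (\<Sum>j\<in>UNIV. cov_grad g c u j j x)"
  by (simp add: chart_laplacian_def chart_div_def cov_grad_def)

lemma chart_laplacian_eq_hess:
  assumes "C 2 u" "x \<in> W"
  shows "chart_laplacian g c u x = (\<Sum>i\<in>UNIV. \<Sum>j\<in>UNIV. ginv g c x $ i $ j * hess g c u x $ i $ j)"
  by (simp add: chart_laplacian_eq_trace cov_grad_eq_raise[OF assms])

text \<open>Raising one index turns the Hessian into the endomorphism \<open>cov_grad\<close>; by
  symmetry of the Hessian the trace of its square is |Hess u|^2. The Bochner computation produces
  the norm in this form.\<close>

lemma tensor_norm2_hess:
  assumes "C 2 u" "x \<in> W"
  shows "tensor_norm2 g c x (hess g c u x) = (\<Sum>j\<in>UNIV. \<Sum>k\<in>UNIV. cov_grad g c u j k x * cov_grad g c u k j x)"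
proof -
  let ?H = "hess g c u x" and ?I = "ginv g c x"
  have "(\<Sum>j\<in>UNIV. \<Sum>k\<in>UNIV. cov_grad g c u j k x * cov_grad g c u k j x)
     = (\<Sum>j\<in>UNIV. \<Sum>k\<in>UNIV. \<Sum>i\<in>UNIV. \<Sum>b\<in>UNIV. ?I $ j $ i * ?I $ k $ b * ?H $ k $ i * ?H $ j $ b)"
    unfolding cov_grad_eq_raise[OF assms]
    by (simp add: sum_product mult_ac)
  also have "\<dots> = (\<Sum>i\<in>UNIV. \<Sum>k\<in>UNIV. \<Sum>j\<in>UNIV. \<Sum>b\<in>UNIV. ?I $ j $ i * ?I $ k $ b * ?H $ k $ i * ?H $ j $ b)"
    by (subst sum_swap3(2)) (rule sum.cong[OF refl], rule sum.swap)
  also have "\<dots> = tensor_norm2 g c x ?H"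
    unfolding tensor_norm2_def using hess_sym[OF assms] ginv_sym[OF assms(2)]
    by (intro sum.cong refl) metis
  finally show ?thesis ..
qed

lemma chart_inner_eq:
  assumes "x \<in> W"
  shows "grad g c u x \<bullet> (g c x *v grad g c v x) = chart_inner g c u v x"
    and "chart_inner g c u v x = chart_inner g c v u x"
    and "chart_inner g c u v x = (\<Sum>i\<in>UNIV. \<Sum>j\<in>UNIV. ginv g c x $ i $ j * pd c i u x * pd c j v x)"
proof -
  have 1: "grad g c u x \<bullet> (g c x *v grad g c v x) = chart_inner g c v u x" for u v
    using lower_grad[OF assms, of _ v]
    by (simp add: inner_vec_def matrix_vector_mult_def chart_inner_def mult.commute)
  show 3: "chart_inner g c u v x = (\<Sum>i\<in>UNIV. \<Sum>j\<in>UNIV. ginv g c x $ i $ j * pd c i u x * pd c j v x)" for u v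
    by (simp add: chart_inner_def grad_def sum_distrib_left mult_ac)
  show 2: "chart_inner g c u v x = chart_inner g c v u x"
    unfolding 3
  proof (subst sum.swap, intro sum.cong refl)
    show "ginv g c x $ j $ i * pd c j u x * pd c i v x = ginv g c x $ i $ j * pd c i v x * pd c j u x" for i j
      using ginv_sym[OF assms, of i j] by simp
  qed
  show "grad g c u x \<bullet> (g c x *v grad g c v x) = chart_inner g c u v x" using 1 2 by simp
qed

lemma C_chart_inner: "C (Suc k) u \<Longrightarrow> C (Suc k) v \<Longrightarrow> C k (chart_inner g c u v)"
  unfolding chart_inner_def[abs_def] by (intro C_sum C_mult C_pd C_grad)

lemma C_chart_laplacian: "C (Suc (Suc k)) u \<Longrightarrow> C k (chart_laplacian g c u)"
  unfolding chart_laplacian_def chart_div_def[abs_def]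
  by (intro C_sum C_add C_mult C_pd C_grad C_christoffel) (auto intro: C_mono)

text \<open>Replacing the partial derivative of grad v by \<open>cov_grad\<close> costs a
  Christoffel term, and that term is the one that completes the second derivatives of
  \<open>u\<close> to \<open>hess\<close>.\<close>

lemma pd_chart_inner:
  assumes u: "C 2 u" and v: "C 2 v" and x: "x \<in> W"
  shows "pd c k (chart_inner g c u v) x
    = (\<Sum>j\<in>UNIV. hess g c u x $ k $ j * X v x j) + (\<Sum>j\<in>UNIV. hess g c v x $ k $ j * X u x j)"
proof -
  have C: "C (Suc 1) u" "C (Suc 1) v" using u v by (simp_all add: numeral_2_eq_2)
  have "pd c k (chart_inner g c u v) x
      = (\<Sum>j\<in>UNIV. pd c k (pd c j u) x * X v x j + pd c j u x * pd c k (\<lambda>z. X v z j) x)"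
    using x C unfolding chart_inner_def[abs_def]
    by (simp add: pd_sum pd_mult C_mult C_pd C_grad del: One_nat_def)
  also have "\<dots> = (\<Sum>j\<in>UNIV. pd c k (pd c j u) x * X v x j)
      + (\<Sum>j\<in>UNIV. pd c j u x * cov_grad g c v j k x)
      - (\<Sum>j\<in>UNIV. pd c j u x * (\<Sum>l\<in>UNIV. \<Gamma> j k l x * X v x l))"
    by (simp add: cov_grad_def sum.distrib sum_subtractf algebra_simps)
  also have "(\<Sum>j\<in>UNIV. pd c j u x * (\<Sum>l\<in>UNIV. \<Gamma> j k l x * X v x l))
      = (\<Sum>l\<in>UNIV. (\<Sum>j\<in>UNIV. \<Gamma> j k l x * pd c j u x) * X v x l)"
    by (simp add: sum_distrib_left sum_distrib_right mult_ac) (rule sum.swap)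
  also have "(\<Sum>j\<in>UNIV. pd c j u x * cov_grad g c v j k x)
      = (\<Sum>j\<in>UNIV. (\<Sum>l\<in>UNIV. g c x $ l $ j * X u x l) * cov_grad g c v j k x)"
    using metric_sym[OF x] by (simp add: lower_grad[OF x, symmetric])
  also have "\<dots> = (\<Sum>l\<in>UNIV. (\<Sum>j\<in>UNIV. g c x $ l $ j * cov_grad g c v j k x) * X u x l)"
    by (simp add: sum_distrib_left sum_distrib_right mult_ac) (rule sum.swap)
  also have "\<dots> = (\<Sum>l\<in>UNIV. hess g c v x $ k $ l * X u x l)"
    by (simp add: lower_cov_grad[OF v x])
  finally show ?thesis
    by (simp add: hess_def sum_subtractf algebra_simps)
qed

text \<open>The gradient of |grad u|^2 is twice the covariant derivative of grad u along itself;
  symmetry of the Hessian moves the contraction to the direction index of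
  \<open>cov_grad\<close>.\<close>

lemma grad_chart_inner_self:
  assumes u: "C 2 u" and x: "x \<in> W"
  shows "X (chart_inner g c u u) x j = 2 * (\<Sum>k\<in>UNIV. cov_grad g c u j k x * X u x k)"
proof -
  have "X (chart_inner g c u u) x j
      = 2 * (\<Sum>i\<in>UNIV. \<Sum>k\<in>UNIV. ginv g c x $ j $ i * (hess g c u x $ i $ k * X u x k))"
    by (simp add: grad_def[of g c "chart_inner g c u u"] pd_chart_inner[OF u u x] sum_distrib_left algebra_simps)
  also have "\<dots> = 2 * (\<Sum>k\<in>UNIV. \<Sum>i\<in>UNIV. ginv g c x $ j $ i * (hess g c u x $ k $ i * X u x k))"
    by (subst sum.swap) (simp only: hess_sym[OF u x, of k for k])
  finally show ?thesis
    by (simp add: cov_grad_eq_raise[OF u x] sum_distrib_right mult.assoc)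
qed

end

text \<open>The index computation behind div (nabla_X X) = tr ((nabla X)^2) + X (div X) + Ric (X, X)
  at one point, for a symmetric connection. All letters are plain numbers: \<open>x\<close> for X,
  \<open>d k j\<close> for the partial derivative d_k X^j, \<open>dd\<close> for second derivatives,
  \<open>Gm\<close> and \<open>dG\<close> for the Christoffel symbols and their derivatives,
  \<open>M j k\<close> for nabla_k X^j.\<close>

lemma commute_derivatives_ricci:
  fixes Gm :: "'n::finite \<Rightarrow> 'n \<Rightarrow> 'n \<Rightarrow> real" and x :: "'n \<Rightarrow> real"
  assumes M: "\<And>j k. M j k = d k j + (\<Sum>l\<in>UNIV. Gm j k l * x l)"
    and dM: "\<And>i j k. dM i j k = dd i k j + (\<Sum>l\<in>UNIV. dG i j k l * x l + Gm j k l * d i l)"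
    and sym: "\<And>i j k. dd i k j = dd k i j" "\<And>j k l. Gm j k l = Gm j l k"
    and ric: "\<And>k l. R k l = (\<Sum>i\<in>UNIV. dG i i k l - dG k i i l
      + (\<Sum>q\<in>UNIV. Gm i i q * Gm q k l - Gm i k q * Gm q i l))"
  shows "(\<Sum>j\<in>UNIV. (\<Sum>k\<in>UNIV. dM j j k * x k + M j k * d j k) + (\<Sum>l\<in>UNIV. Gm j j l * (\<Sum>k\<in>UNIV. M l k * x k)))
    = (\<Sum>j\<in>UNIV. \<Sum>k\<in>UNIV. M j k * M k j) + (\<Sum>k\<in>UNIV. x k * (\<Sum>j\<in>UNIV. dM k j j))
      + (\<Sum>k\<in>UNIV. \<Sum>l\<in>UNIV. R k l * x k * x l)"
proof -
  \<comment> \<open>\<open>E\<close> collects the second derivatives of X and drops out by their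
    symmetry. What is left is Ric (X, X) = (\<open>D1\<close> - \<open>D2\<close>) +
    (\<open>P\<close> - \<open>Q\<close>) + (\<open>U\<close> - \<open>V\<close>): the derivatives
    of the symbols, then the negative and the positive quadratic terms of the curvature.\<close>
  define P where "P = (\<Sum>j\<in>UNIV. \<Sum>k\<in>UNIV. \<Sum>l\<in>UNIV. Gm j k l * d j l * x k)"
  define Q where "Q = (\<Sum>j\<in>UNIV. \<Sum>k\<in>UNIV. \<Sum>l\<in>UNIV. M j k * Gm k j l * x l)"
  define D1 where "D1 = (\<Sum>j\<in>UNIV. \<Sum>k\<in>UNIV. \<Sum>l\<in>UNIV. dG j j k l * x k * x l)"
  define D2 where "D2 = (\<Sum>j\<in>UNIV. \<Sum>k\<in>UNIV. \<Sum>l\<in>UNIV. dG k j j l * x k * x l)"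
  define E where "E = (\<Sum>j\<in>UNIV. \<Sum>k\<in>UNIV. dd j k j * x k)"
  define V where "V = (\<Sum>j\<in>UNIV. \<Sum>k\<in>UNIV. \<Sum>l\<in>UNIV. Gm j j l * d k l * x k)"
  define U where "U = (\<Sum>j\<in>UNIV. \<Sum>l\<in>UNIV. \<Sum>k\<in>UNIV. Gm j j l * M l k * x k)"
  have a: "(\<Sum>j\<in>UNIV. \<Sum>k\<in>UNIV. dM j j k * x k) = E + D1 + P"
    unfolding dM E_def D1_def P_def
    by (simp add: sum.distrib distrib_right distrib_left sum_distrib_left sum_distrib_right mult_ac)
  have b: "(\<Sum>j\<in>UNIV. \<Sum>k\<in>UNIV. M j k * d j k) = (\<Sum>j\<in>UNIV. \<Sum>k\<in>UNIV. M j k * M k j) - Q"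
  proof -
    have d: "d j k = M k j - (\<Sum>l\<in>UNIV. Gm k j l * x l)" for j k by (simp add: M)
    show ?thesis
      unfolding Q_def d by (simp add: sum_subtractf right_diff_distrib sum_distrib_left mult_ac)
  qed
  have c: "(\<Sum>k\<in>UNIV. x k * (\<Sum>j\<in>UNIV. dM k j j)) = E + D2 + V"
  proof -
    have "(\<Sum>k\<in>UNIV. x k * (\<Sum>j\<in>UNIV. dM k j j)) = (\<Sum>j\<in>UNIV. \<Sum>k\<in>UNIV. x k * dM k j j)"
      unfolding sum_distrib_left by (rule sum.swap)
    also have "\<dots> = E + D2 + V"
      unfolding dM E_def D2_def V_def sym(1)[of _ j j for j]
      by (simp add: sum.distrib distrib_right distrib_left sum_distrib_left sum_distrib_right mult_ac sym(1))
    finally show ?thesis .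
  qed
  have e: "(\<Sum>j\<in>UNIV. \<Sum>l\<in>UNIV. Gm j j l * (\<Sum>k\<in>UNIV. M l k * x k)) = U"
    unfolding U_def by (simp add: sum_distrib_left mult_ac)
  \<comment> \<open>Relabelled so that \<open>M l j\<close> stands where \<open>P\<close> has
    \<open>d j l\<close>; the two differ by a Christoffel term only.\<close>
  have Q': "Q = (\<Sum>j\<in>UNIV. \<Sum>k\<in>UNIV. \<Sum>l\<in>UNIV. M l j * Gm j k l * x k)"
  proof -
    have "Q = (\<Sum>l\<in>UNIV. \<Sum>j\<in>UNIV. \<Sum>k\<in>UNIV. M l j * Gm j k l * x k)"
      unfolding Q_def by (simp add: sym(2)[of _ k l for k l] cong: sum.cong)
    also have "\<dots> = (\<Sum>j\<in>UNIV. \<Sum>k\<in>UNIV. \<Sum>l\<in>UNIV. M l j * Gm j k l * x k)"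
      by (rule sum_swap3(1))
    finally show ?thesis .
  qed
  have PQ: "P - Q = - (\<Sum>k\<in>UNIV. \<Sum>l\<in>UNIV. \<Sum>i\<in>UNIV. \<Sum>q\<in>UNIV. Gm i k q * Gm q i l * x k * x l)"
  proof -
    have "P - Q = - (\<Sum>i\<in>UNIV. \<Sum>k\<in>UNIV. \<Sum>q\<in>UNIV. \<Sum>l\<in>UNIV. Gm i k q * Gm q i l * x k * x l)"
      unfolding P_def Q'
      by (simp add: M sum.distrib sum_subtractf[symmetric] sum_negf[symmetric] distrib_left distrib_right
          sum_distrib_left sum_distrib_right mult_ac)
    also have "(\<Sum>i\<in>UNIV. \<Sum>k\<in>UNIV. \<Sum>q\<in>UNIV. \<Sum>l\<in>UNIV. Gm i k q * Gm q i l * x k * x l)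
      = (\<Sum>k\<in>UNIV. \<Sum>i\<in>UNIV. \<Sum>l\<in>UNIV. \<Sum>q\<in>UNIV. Gm i k q * Gm q i l * x k * x l)"
      by (rule trans[OF sum.swap], rule sum.cong[OF refl], rule sum.cong[OF refl], rule sum.swap)
    also have "\<dots> = (\<Sum>k\<in>UNIV. \<Sum>l\<in>UNIV. \<Sum>i\<in>UNIV. \<Sum>q\<in>UNIV. Gm i k q * Gm q i l * x k * x l)"
      by (rule sum.cong[OF refl], rule sum.swap)
    finally show ?thesis .
  qed
  have UV: "U - V = (\<Sum>k\<in>UNIV. \<Sum>l\<in>UNIV. \<Sum>i\<in>UNIV. \<Sum>q\<in>UNIV. Gm i i q * Gm q k l * x k * x l)"
  proof -
    have "U = (\<Sum>j\<in>UNIV. \<Sum>k\<in>UNIV. \<Sum>l\<in>UNIV. Gm j j l * M l k * x k)"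
      unfolding U_def by (rule sum.cong[OF refl], rule sum.swap)
    then have "U - V = (\<Sum>i\<in>UNIV. \<Sum>k\<in>UNIV. \<Sum>q\<in>UNIV. \<Sum>l\<in>UNIV. Gm i i q * Gm q k l * x k * x l)"
      unfolding V_def
      by (simp add: M sum.distrib sum_subtractf[symmetric] sum_negf[symmetric] distrib_left distrib_right
          sum_distrib_left sum_distrib_right mult_ac)
    also have "\<dots> = (\<Sum>k\<in>UNIV. \<Sum>i\<in>UNIV. \<Sum>l\<in>UNIV. \<Sum>q\<in>UNIV. Gm i i q * Gm q k l * x k * x l)"
      by (rule trans[OF sum.swap], rule sum.cong[OF refl], rule sum.cong[OF refl], rule sum.swap)
    also have "\<dots> = (\<Sum>k\<in>UNIV. \<Sum>l\<in>UNIV. \<Sum>i\<in>UNIV. \<Sum>q\<in>UNIV. Gm i i q * Gm q k l * x k * x l)"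
      by (rule sum.cong[OF refl], rule sum.swap)
    finally show ?thesis .
  qed
  have "(\<Sum>k\<in>UNIV. \<Sum>l\<in>UNIV. R k l * x k * x l)
      = (\<Sum>k\<in>UNIV. \<Sum>l\<in>UNIV. \<Sum>i\<in>UNIV. dG i i k l * x k * x l)
      - (\<Sum>k\<in>UNIV. \<Sum>l\<in>UNIV. \<Sum>i\<in>UNIV. dG k i i l * x k * x l) + (U - V) + (P - Q)"
    unfolding ric PQ UV
    by (simp add: sum.distrib sum_subtractf distrib_right left_diff_distrib sum_distrib_right)
  also have "(\<Sum>k\<in>UNIV. \<Sum>l\<in>UNIV. \<Sum>i\<in>UNIV. dG i i k l * x k * x l) = D1"
    unfolding D1_def by (rule sum_swap3(1)[symmetric])
  also have "(\<Sum>k\<in>UNIV. \<Sum>l\<in>UNIV. \<Sum>i\<in>UNIV. dG k i i l * x k * x l) = D2"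
    unfolding D2_def by (rule sum_swap3(1)[symmetric])
  finally show ?thesis by (simp add: sum.distrib a[unfolded sum.distrib] b c e)
qed

context metric_patch
begin

text \<open>For X = grad u, half the gradient of |grad u|^2 is nabla_X X, so this is the divergence
  identity of \<open>commute_derivatives_ricci\<close> for X. With \<open>u\<close> of class 3 the
  field is of class 2 and its second derivatives commute.\<close>

lemma bochner:
  assumes u: "C 3 u" and x: "x \<in> W"
  shows "chart_laplacian g c (chart_inner g c u u) x
    = 2 * (tensor_norm2 g c x (hess g c u x) + chart_inner g c (chart_laplacian g c u) u x
        + grad g c u x \<bullet> (ricci g c x *v grad g c u x))"
proof -
  let ?M = "\<lambda>j k x. cov_grad g c u j k x"
  let ?x = "X u x"
  have u3: "C (Suc 2) u" and u2: "C 2 u"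
    using u C_mono[OF u, of 2] by (simp_all add: numeral_eq_Suc)
  have CX: "C 2 (\<lambda>z. X u z j)" "C 1 (\<lambda>z. X u z j)" for j
    using C_grad[OF u3] C_mono[OF C_grad[OF u3]] by auto
  have CdX: "C 1 (pd c k (\<lambda>z. X u z j))" for j k
    by (rule C_pd) (use CX in \<open>simp add: numeral_2_eq_2\<close>)
  have CG: "C 1 (\<Gamma> i j k)" for i j k by (rule C_christoffel)
  have CM: "C 1 (\<lambda>z. ?M j k z)" for j k
    unfolding cov_grad_def by (intro C_intros CdX CG CX)
  have dM: "pd c i (\<lambda>z. ?M j k z) x = pd c i (pd c k (\<lambda>z. X u z j)) x
      + (\<Sum>l\<in>UNIV. pd c i (\<Gamma> j k l) x * ?x l + \<Gamma> j k l x * pd c i (\<lambda>z. X u z l) x)" for i j k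
    unfolding cov_grad_def by (simp add: pd_add pd_sum pd_mult C_sum C_mult CdX CG CX x del: One_nat_def)
  have dY: "pd c j (\<lambda>z. 2 * (\<Sum>k\<in>UNIV. ?M j k z * X u z k)) x = 2 * (\<Sum>k\<in>UNIV. pd c j (\<lambda>z. ?M j k z) x * ?x k
      + ?M j k x * pd c j (\<lambda>z. X u z k) x)" for j
    by (subst pd_cmult) (simp_all add: pd_sum pd_mult C_sum C_mult CM CX x del: One_nat_def)
  have "X (chart_inner g c u u) z j = 2 * (\<Sum>k\<in>UNIV. ?M j k z * X u z k)" if "z \<in> W" for z j
    by (rule grad_chart_inner_self[OF u2 that])
  then have "chart_laplacian g c (chart_inner g c u u) x
      = (\<Sum>j\<in>UNIV. pd c j (\<lambda>z. 2 * (\<Sum>k\<in>UNIV. ?M j k z * X u z k)) x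
        + (\<Sum>l\<in>UNIV. \<Gamma> j j l x * (2 * (\<Sum>k\<in>UNIV. ?M l k x * ?x k))))"
    unfolding chart_laplacian_def chart_div_def
    by (intro sum.cong refl arg_cong2[of _ _ _ _ "(+)"] pd_cong) (use x in auto)
  also have "\<dots> = 2 * (\<Sum>j\<in>UNIV. (\<Sum>k\<in>UNIV. pd c j (\<lambda>z. ?M j k z) x * ?x k
      + ?M j k x * pd c j (\<lambda>z. X u z k) x) + (\<Sum>l\<in>UNIV. \<Gamma> j j l x * (\<Sum>k\<in>UNIV. ?M l k x * ?x k)))"
    unfolding dY by (simp add: sum_distrib_left distrib_left mult_ac)
  also have "\<dots> = 2 * ((\<Sum>j\<in>UNIV. \<Sum>k\<in>UNIV. ?M j k x * ?M k j x)
      + (\<Sum>k\<in>UNIV. ?x k * (\<Sum>j\<in>UNIV. pd c k (\<lambda>z. ?M j j z) x))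
      + (\<Sum>k\<in>UNIV. \<Sum>l\<in>UNIV. ricci g c x $ k $ l * ?x k * ?x l))"
    using dM pd_commute[OF CX(1) x] christoffel_sym[OF x]
    by (subst commute_derivatives_ricci[where M = "\<lambda>j k. ?M j k x"
          and dM = "\<lambda>i j k. pd c i (\<lambda>z. ?M j k z) x" and d = "\<lambda>k j. pd c k (\<lambda>z. X u z j) x"
          and Gm = "\<lambda>j k l. \<Gamma> j k l x" and dG = "\<lambda>i j k l. pd c i (\<Gamma> j k l) x"
          and dd = "\<lambda>i k j. pd c i (pd c k (\<lambda>z. X u z j)) x" and x = ?x and R = "\<lambda>k l. ricci g c x $ k $ l"])
      (auto simp: cov_grad_def[of g c u _ _ x] ricci_def riemann_def)
  also have "(\<Sum>k\<in>UNIV. ?x k * (\<Sum>j\<in>UNIV. pd c k (\<lambda>z. ?M j j z) x)) = chart_inner g c (chart_laplacian g c u) u x"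
    unfolding chart_inner_def chart_laplacian_eq_trace[abs_def]
    by (simp add: pd_sum CM x mult.commute del: One_nat_def)
  also have "(\<Sum>k\<in>UNIV. \<Sum>l\<in>UNIV. ricci g c x $ k $ l * ?x k * ?x l) = grad g c u x \<bullet> (ricci g c x *v grad g c u x)"
    by (simp add: inner_vec_def matrix_vector_mult_def sum_distrib_left mult_ac)
  finally show ?thesis by (simp add: tensor_norm2_hess[OF u2 x])
qed

end

section \<open>Independence of the chart\<close>

lemma sum_swap4:
  fixes F :: "'i::finite \<Rightarrow> 'i \<Rightarrow> 'i \<Rightarrow> 'i \<Rightarrow> real"
  shows "(\<Sum>a\<in>UNIV. \<Sum>b\<in>UNIV. \<Sum>k\<in>UNIV. \<Sum>j\<in>UNIV. F a b k j) = (\<Sum>k\<in>UNIV. \<Sum>j\<in>UNIV. \<Sum>a\<in>UNIV. \<Sum>b\<in>UNIV. F a b k j)"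
proof -
  have "(\<Sum>a\<in>UNIV. \<Sum>b\<in>UNIV. \<Sum>k\<in>UNIV. \<Sum>j\<in>UNIV. F a b k j) = (\<Sum>a\<in>UNIV. \<Sum>k\<in>UNIV. \<Sum>j\<in>UNIV. \<Sum>b\<in>UNIV. F a b k j)"
    by (rule sum.cong[OF refl], rule sum_swap3(1))
  also have "\<dots> = (\<Sum>k\<in>UNIV. \<Sum>j\<in>UNIV. \<Sum>a\<in>UNIV. \<Sum>b\<in>UNIV. F a b k j)"
    by (rule sum_swap3(1))
  finally show ?thesis .
qed

context metric_patch
begin

lemma chart_inner_cong:
  "(\<And>z. z \<in> W \<Longrightarrow> v z = v' z) \<Longrightarrow> x \<in> W \<Longrightarrow> chart_inner g c u v x = chart_inner g c u v' x"
  using pd_cong[of v v' x] by (simp add: chart_inner_def grad_def)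

lemma chart_inner_chart_inner:
  assumes "C 2 u" "C 2 v" "x \<in> W"
  shows "chart_inner g c w (chart_inner g c u v) x
    = (\<Sum>k\<in>UNIV. \<Sum>j\<in>UNIV. hess g c u x $ k $ j * X w x k * X v x j)
      + (\<Sum>k\<in>UNIV. \<Sum>j\<in>UNIV. hess g c v x $ k $ j * X w x k * X u x j)"
proof -
  have "chart_inner g c w (chart_inner g c u v) x = chart_inner g c (chart_inner g c u v) w x"
    by (rule chart_inner_eq(2)[OF assms(3)])
  then show ?thesis
    by (simp add: chart_inner_def[of g c "chart_inner g c u v"] pd_chart_inner[OF assms] distrib_left
        sum.distrib sum_distrib_left mult_ac)
qed

text \<open>Koszul's formula: the Hessian is determined by the inner products of gradients.\<close>

lemma hess_koszul:
  assumes u: "C 2 u" and a: "C 2 a" and b: "C 2 b" and x: "x \<in> W"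
  shows "2 * (\<Sum>k\<in>UNIV. \<Sum>j\<in>UNIV. hess g c u x $ k $ j * X a x k * X b x j)
    = chart_inner g c a (chart_inner g c b u) x + chart_inner g c b (chart_inner g c a u) x
      - chart_inner g c u (chart_inner g c a b) x"
proof -
  have s: "(\<Sum>k\<in>UNIV. \<Sum>j\<in>UNIV. hess g c w x $ k $ j * X v x k * X v' x j)
      = (\<Sum>k\<in>UNIV. \<Sum>j\<in>UNIV. hess g c w x $ k $ j * X v' x k * X v x j)" if "C 2 w" for w v v'
    by (subst sum.swap) (simp add: hess_sym[OF that x, of k for k] mult_ac)
  show ?thesis
    unfolding chart_inner_chart_inner[OF b u x] chart_inner_chart_inner[OF a u x] chart_inner_chart_inner[OF a b x]
    using s[OF u, of b a] s[OF a, of b u] s[OF b, of a u] by simp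
qed

end

locale patch_overlap = cp: metric_patch c W g + dp: metric_patch d W g
  for c d :: "('a::topological_space, 'n::finite) chart" and W g +
  assumes C_transition: "cp.C k (\<lambda>z. snd d z $ a)"
    and metric_transition: "x \<in> W \<Longrightarrow> g c x $ i $ j =
      (\<Sum>a\<in>UNIV. \<Sum>b\<in>UNIV. pd c i (\<lambda>z. snd d z $ a) x * pd c j (\<lambda>z. snd d z $ b) x * g d x $ a $ b)"
begin

abbreviation J where "J x \<equiv> (\<chi> i a. pd c i (\<lambda>z. snd d z $ a) x) :: real^'n^'n"

lemma C_transfer: "dp.C k u \<Longrightarrow> cp.C k u"
proof -
  assume u: "dp.C k u"
  have "Ck_on k (snd c ` W) (\<lambda>y. (u \<circ> chart_inv d) (snd d (chart_inv c y)))"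
  proof (rule Ck_on_compose[where T = "snd d ` W", OF _ _ cp.open_U dp.open_U])
    show "Ck_on k (snd c ` W) (\<lambda>y. snd d (chart_inv c y) $ a)" for a
      using C_transition[of k a] by (simp add: chart_Ck_def o_def)
    show "Ck_on k (snd d ` W) (u \<circ> chart_inv d)" using u by (simp add: chart_Ck_def)
  qed (auto simp: cp.chart_inv_W)
  then show "cp.C k u"
    unfolding chart_Ck_def
    by (rule Ck_on_cong[OF _ cp.open_U]) (auto simp: cp.chart_inv_W dp.chart_inv_W)
qed

lemma pd_transition:
  assumes u: "dp.C 1 u" and x: "x \<in> W"
  shows "pd c i u x = (\<Sum>a\<in>UNIV. J x $ i $ a * pd d a u x)"
proof -
  have "pd c i u x = partial_deriv i (\<lambda>y. (u \<circ> chart_inv d) (snd d (chart_inv c y))) (snd c x)"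
    unfolding pd_def
    by (rule partial_deriv_cong[OF cp.open_U]) (use x in \<open>auto simp: cp.chart_inv_W dp.chart_inv_W\<close>)
  also have "\<dots> = (\<Sum>a\<in>UNIV. partial_deriv i (\<lambda>y. snd d (chart_inv c y) $ a) (snd c x)
      * partial_deriv a (u \<circ> chart_inv d) (snd d (chart_inv c (snd c x))))"
  proof (rule partial_deriv_compose(1))
    show "(\<lambda>y. snd d (chart_inv c y) $ a) differentiable at (snd c x)" for a
      using cp.C_differentiable[OF C_transition x] by (simp add: o_def)
    show "(u \<circ> chart_inv d) differentiable at (snd d (chart_inv c (snd c x)))"
      using dp.C_differentiable[OF u x] by (simp add: cp.chart_inv_W x)
  qed
  finally show ?thesis by (simp add: pd_def cp.chart_inv_W x o_def)
qed

lemma metric_transition_matrix: "x \<in> W \<Longrightarrow> g c x = J x ** g d x ** transpose (J x)"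
  by (simp add: vec_eq_iff metric_transition matrix_matrix_mult_def transpose_def sum_distrib_right
      sum_distrib_left mult_ac) (intro allI, rule sum.swap)

text \<open>Determinants in the metric law show that \<open>J x\<close> is invertible; what remains
  is to invert J g J^T.\<close>

lemma ginv_transition:
  assumes x: "x \<in> W"
  shows "transpose (J x) ** ginv g c x ** J x = ginv g d x"
proof -
  let ?Q = "transpose (J x) ** ginv g c x ** J x"
  note ic = matrix_inv_mult[OF cp.metric_invertible[OF x]] and id = matrix_inv_mult[OF dp.metric_invertible[OF x]]
  have "det (g c x) \<noteq> 0" using cp.metric_invertible[OF x] invertible_det_nz by blast
  then have "invertible (J x)"
    unfolding metric_transition_matrix[OF x] det_mul invertible_det_nz by auto
  note iJ = matrix_inv_mult[OF this]
  have "J x ** (g d x ** ?Q) = (J x ** g d x ** transpose (J x)) ** ginv g c x ** J x"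
    by (simp add: matrix_mul_assoc)
  also have "\<dots> = J x"
    unfolding metric_transition_matrix[OF x, symmetric] ginv_def by (simp add: ic)
  finally have "matrix_inv (J x) ** (J x ** (g d x ** ?Q)) = matrix_inv (J x) ** J x" by simp
  then have "g d x ** ?Q = mat 1"
    unfolding matrix_mul_assoc[of "matrix_inv (J x)"] iJ by simp
  then have "ginv g d x ** (g d x ** ?Q) = ginv g d x" by simp
  then show ?thesis
    unfolding ginv_def matrix_mul_assoc[of "matrix_inv (g d x)"] id by simp
qed

lemma chart_inner_transition:
  assumes u: "dp.C 1 u" and v: "dp.C 1 v" and x: "x \<in> W"
  shows "chart_inner g c u v x = chart_inner g d u v x"
proof -
  have eq: "chart_inner g e u v x = (\<chi> i. pd e i u x) \<bullet> (ginv g e x *v (\<chi> i. pd e i v x))" for e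
    by (simp add: chart_inner_def grad_def inner_vec_def matrix_vector_mult_def)
  have J: "(\<chi> i. pd c i w x) = J x *v (\<chi> i. pd d i w x)" if "dp.C 1 w" for w
    using pd_transition[OF that x] by (simp add: vec_eq_iff matrix_vector_mult_def)
  have adj: "(M *v a) \<bullet> w = a \<bullet> (transpose M *v w)" for M :: "real^'n^'n" and a w
    using dot_lmul_matrix[of w M a] by (simp add: transpose_matrix_vector inner_commute)
  show ?thesis
    unfolding eq J[OF u] J[OF v] adj ginv_transition[OF x, symmetric]
    by (simp only: matrix_vector_mul_assoc matrix_mul_assoc)
qed

text \<open>With y^a the coordinates of \<open>d\<close>, Koszul's formula makes the numbers Hess u
  (grad y^a, grad y^b) agree in both charts. Contracted with the metric of \<open>d\<close> they
  give the trace of the Hessian, because <grad y^a, grad y^b> is the inverse metric of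
  \<open>d\<close>. This replaces the second-order transformation law of the Christoffel
  symbols.\<close>

lemma chart_laplacian_transition:
  assumes u: "dp.C 2 u" and x: "x \<in> W"
  shows "chart_laplacian g c u x = chart_laplacian g d u x"
proof -
  define y where "y a z = snd d z $ a" for a z
  define K where "K e a b = (\<Sum>k\<in>UNIV. \<Sum>j\<in>UNIV.
      hess g e u x $ k $ j * grad g e (y a) x $ k * grad g e (y b) x $ j)" for e a b
  have yd: "dp.C k (y a)" for a k
    unfolding chart_Ck_def
    by (rule Ck_on_cong[OF Ck_on_component[of _ _ a] dp.open_U]) (auto simp: y_def dp.chart_inv_W)
  have u1: "dp.C 1 u" using dp.C_mono[OF u] by simp
  have inner: "chart_inner g c w (chart_inner g c v v') x = chart_inner g d w (chart_inner g d v v') x"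
    if "dp.C 2 w" "dp.C 2 v" "dp.C 2 v'" for w v v'
  proof -
    have C1: "dp.C 1 w" "dp.C 1 v" "dp.C 1 v'" using that dp.C_mono by (auto intro: dp.C_mono)
    have "chart_inner g c w (chart_inner g c v v') x = chart_inner g c w (chart_inner g d v v') x"
      using chart_inner_transition[OF C1(2,3)] x by (intro cp.chart_inner_cong) auto
    also have "\<dots> = chart_inner g d w (chart_inner g d v v') x"
      using that by (intro chart_inner_transition C1 dp.C_chart_inner x) (auto simp: numeral_2_eq_2)
    finally show ?thesis .
  qed
  have "2 * K c a b = 2 * K d a b" for a b
    unfolding K_def dp.hess_koszul[OF u yd yd x] cp.hess_koszul[OF C_transfer[OF u] C_transfer[OF yd] C_transfer[OF yd] x]
    by (simp add: inner u yd)
  then have K: "K c a b = K d a b" for a b by simp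
  \<comment> \<open>The columns of \<open>N\<close> are the gradients of the y^a in chart
    \<open>e\<close>; premise \<open>I\<close> says that the sum of g_ab grad y^a (x) grad y^b is
    the inverse metric in \<open>e\<close>.\<close>
  have trace: "(\<Sum>a\<in>UNIV. \<Sum>b\<in>UNIV. g d x $ a $ b * K e a b) = (\<Sum>k\<in>UNIV. \<Sum>j\<in>UNIV. ginv g e x $ k $ j * hess g e u x $ k $ j)"
    if N: "\<And>a k. grad g e (y a) x $ k = N $ k $ a" and I: "N ** g d x ** transpose N = ginv g e x" for e N
  proof -
    have I': "ginv g e x $ k $ j = (\<Sum>a\<in>UNIV. \<Sum>b\<in>UNIV. g d x $ a $ b * N $ k $ a * N $ j $ b)" for k j
      unfolding I[symmetric]
      by (simp add: matrix_matrix_mult_def transpose_def sum_distrib_right sum_distrib_left mult_ac) (rule sum.swap)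
    have "(\<Sum>a\<in>UNIV. \<Sum>b\<in>UNIV. g d x $ a $ b * K e a b) = (\<Sum>a\<in>UNIV. \<Sum>b\<in>UNIV. \<Sum>k\<in>UNIV. \<Sum>j\<in>UNIV.
        g d x $ a $ b * (hess g e u x $ k $ j * N $ k $ a * N $ j $ b))"
      by (simp only: K_def N sum_distrib_left)
    also have "\<dots> = (\<Sum>k\<in>UNIV. \<Sum>j\<in>UNIV. \<Sum>a\<in>UNIV. \<Sum>b\<in>UNIV.
        g d x $ a $ b * (hess g e u x $ k $ j * N $ k $ a * N $ j $ b))"
      by (rule sum_swap4)
    also have "\<dots> = (\<Sum>k\<in>UNIV. \<Sum>j\<in>UNIV. (\<Sum>a\<in>UNIV. \<Sum>b\<in>UNIV.
        g d x $ a $ b * N $ k $ a * N $ j $ b) * hess g e u x $ k $ j)"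
      by (simp only: sum_distrib_left sum_distrib_right mult_ac)
    finally show ?thesis by (simp only: I')
  qed
  have "(\<Sum>a\<in>UNIV. \<Sum>b\<in>UNIV. g d x $ a $ b * K d a b) = chart_laplacian g d u x"
    unfolding dp.chart_laplacian_eq_hess[OF u x]
  proof (rule trace)
    have "pd d j (y a) x = (if j = a then 1 else 0)" for j a
    proof -
      have "pd d j (y a) x = partial_deriv j (\<lambda>v. v $ a) (snd d x)"
        unfolding pd_def by (rule partial_deriv_cong[OF dp.open_U]) (use x in \<open>auto simp: y_def dp.chart_inv_W\<close>)
      then show ?thesis by (simp add: partial_deriv_component axis_def)
    qed
    then show "grad g d (y a) x $ k = ginv g d x $ k $ a" for a k
      by (simp add: grad_def if_distrib[of "\<lambda>t. _ * t"] cong: if_cong)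
    have "transpose (ginv g d x) = ginv g d x"
      by (simp add: vec_eq_iff transpose_def dp.ginv_sym[OF x])
    then show "ginv g d x ** g d x ** transpose (ginv g d x) = ginv g d x"
      using matrix_inv_mult[OF dp.metric_invertible[OF x]] by (simp add: ginv_def)
  qed
  moreover have "(\<Sum>a\<in>UNIV. \<Sum>b\<in>UNIV. g d x $ a $ b * K c a b) = chart_laplacian g c u x"
    unfolding cp.chart_laplacian_eq_hess[OF C_transfer[OF u] x]
  proof (rule trace)
    show "grad g c (y a) x $ k = (ginv g c x ** J x) $ k $ a" for a k
      by (simp add: grad_def matrix_matrix_mult_def y_def[abs_def])
    have "transpose (ginv g c x) = ginv g c x"
      by (simp add: vec_eq_iff transpose_def cp.ginv_sym[OF x])
    then have "(ginv g c x ** J x) ** g d x ** transpose (ginv g c x ** J x)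
        = ginv g c x ** (J x ** g d x ** transpose (J x)) ** ginv g c x"
      by (simp add: matrix_transpose_mul matrix_mul_assoc)
    also have "\<dots> = ginv g c x"
      unfolding metric_transition_matrix[OF x, symmetric]
      using matrix_inv_mult[OF cp.metric_invertible[OF x]] by (simp add: ginv_def)
    finally show "(ginv g c x ** J x) ** g d x ** transpose (ginv g c x ** J x) = ginv g c x" .
  qed
  ultimately show ?thesis using K by simp
qed

end

section \<open>The divergence form of the weighted Laplacian\<close>

context coord_patch
begin

lemma C_prod: "(\<And>i. i \<in> I \<Longrightarrow> C k (u i)) \<Longrightarrow> C k (\<lambda>x. \<Prod>i\<in>I. u i x)"
  unfolding chart_Ck_def
  using Ck_on_prod[OF _ open_U, of I k "\<lambda>i. u i \<circ> chart_inv c"] by (simp add: o_def)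

lemma C_det: "(\<And>i j. C k (\<lambda>z. B z $ i $ j)) \<Longrightarrow> C k (\<lambda>z. det (B z :: real^'m::finite^'m))"
  unfolding chart_Ck_def
  using Ck_on_det[OF _ open_U, of k "\<lambda>y. B (chart_inv c y)"] by (simp add: o_def)

lemma pd_prod:
  "finite I \<Longrightarrow> (\<And>j. j \<in> I \<Longrightarrow> C 1 (u j)) \<Longrightarrow> x \<in> W \<Longrightarrow>
    pd c i (\<lambda>z. \<Prod>j\<in>I. u j z) x = (\<Sum>l\<in>I. pd c i (u l) x * (\<Prod>j\<in>I - {l}. u j x))"
proof (induction I rule: finite_induct)
  case (insert l I)
  have C: "C 1 (\<lambda>z. \<Prod>j\<in>I. u j z)" "C 1 (u l)" using insert.prems by (auto intro: C_prod)
  have "(\<Sum>j\<in>I. pd c i (u j) x * (\<Prod>q\<in>insert l I - {j}. u q x))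
      = (\<Sum>j\<in>I. u l x * (pd c i (u j) x * (\<Prod>q\<in>I - {j}. u q x)))"
  proof (rule sum.cong[OF refl])
    fix j assume "j \<in> I"
    then have "insert l I - {j} = insert l (I - {j})" "l \<notin> I - {j}" using insert.hyps by auto
    then show "pd c i (u j) x * (\<Prod>q\<in>insert l I - {j}. u q x) = u l x * (pd c i (u j) x * (\<Prod>q\<in>I - {j}. u q x))"
      using insert.hyps by simp
  qed
  moreover have "insert l I - {l} = I" using insert.hyps by auto
  ultimately show ?case
    using insert C by (simp add: pd_mult sum_distrib_left)
qed simp

text \<open>Jacobi's formula. Differentiating the \<open>l\<close>-th row replaces it by the \<open>l\<close>-th row of \<open>\<partial>B B\<^sup>-\<^sup>1 B\<close>.\<close>

lemma pd_det:
  fixes B :: "'a \<Rightarrow> real^'m::finite^'m"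
  assumes C1: "\<And>i j. C 1 (\<lambda>z. B z $ i $ j)" and x: "x \<in> W" and inv: "invertible (B x)"
  shows "pd c i (\<lambda>z. det (B z)) x
    = det (B x) * (\<Sum>l\<in>UNIV. \<Sum>q\<in>UNIV. matrix_inv (B x) $ q $ l * pd c i (\<lambda>z. B z $ l $ q) x)"
proof -
  let ?D = "\<chi> l q. pd c i (\<lambda>z. B z $ l $ q) x"
  let ?N = "?D ** matrix_inv (B x)"
  let ?P = "{p. p permutes (UNIV :: 'm set)}"
  let ?r = "\<lambda>l. (\<chi> r. if r = l then ?D $ l else B x $ r)"
  have C: "C 1 (\<lambda>z. \<Prod>l\<in>UNIV. B z $ l $ p l)" for p
    by (rule C_prod[OF C1])
  have d: "pd c i (\<lambda>z. \<Prod>l\<in>UNIV. B z $ l $ p l) x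
      = (\<Sum>l\<in>UNIV. ?D $ l $ p l * (\<Prod>j\<in>UNIV - {l}. B x $ j $ p j))" for p
    using pd_prod[of UNIV "\<lambda>l z. B z $ l $ p l", OF _ C1 x] by simp
  have "pd c i (\<lambda>z. det (B z)) x = (\<Sum>p\<in>?P. pd c i (\<lambda>z. of_int (sign p) * (\<Prod>l\<in>UNIV. B z $ l $ p l)) x)"
    unfolding det_def by (rule pd_sum[OF _ C_cmult[OF C] x]) (rule finite_permutations[OF finite])
  also have "\<dots> = (\<Sum>p\<in>?P. of_int (sign p) *
      (\<Sum>l\<in>UNIV. ?D $ l $ p l * (\<Prod>j\<in>UNIV - {l}. B x $ j $ p j)))"
    by (simp only: pd_cmult[OF C x] d)
  also have "\<dots> = (\<Sum>l\<in>UNIV. \<Sum>p\<in>?P. of_int (sign p) * (\<Prod>j\<in>UNIV. ?r l $ j $ p j))"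
  proof -
    have row: "?D $ l $ p l * (\<Prod>j\<in>UNIV - {l}. B x $ j $ p j) = (\<Prod>j\<in>UNIV. ?r l $ j $ p j)" for l p
    proof -
      have "(\<Prod>j\<in>UNIV - {l}. B x $ j $ p j) = (\<Prod>j\<in>UNIV - {l}. ?r l $ j $ p j)"
        by (rule prod.cong) auto
      then show ?thesis using prod.remove[of UNIV l "\<lambda>j. ?r l $ j $ p j"] by simp
    qed
    show ?thesis unfolding row sum_distrib_left by (rule sum.swap)
  qed
  also have "\<dots> = (\<Sum>l\<in>UNIV. det (?r l))" unfolding det_def ..
  also have "\<dots> = (\<Sum>l\<in>UNIV. ?N $ l $ l * det (B x))"
  proof (rule sum.cong[OF refl])
    fix l
    have "?N ** B x = ?D"
      using matrix_inv_mult(2)[OF inv] by (simp add: matrix_mul_assoc[symmetric])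
    moreover have "(?N ** B x) $ l = (\<Sum>q\<in>UNIV. ?N $ l $ q *s row q (B x))"
      by (simp add: vec_eq_iff matrix_matrix_mult_def[of _ "B x"] row_def)
    ultimately have "?D $ l = (\<Sum>q\<in>UNIV. ?N $ l $ q *s row q (B x))" by metis
    then have "?r l = (\<chi> r. if r = l then \<Sum>q\<in>UNIV. ?N $ l $ q *s row q (B x) else row r (B x))"
      unfolding vec_eq_iff row_def by auto
    then show "det (?r l) = ?N $ l $ l * det (B x)" by (simp only: cramer_lemma_transpose)
  qed
  finally show ?thesis
    by (simp add: matrix_matrix_mult_def sum_distrib_left sum_distrib_right mult_ac)
qed

end

definition vol_density :: "('a, 'n::finite) metric \<Rightarrow> ('a, 'n) chart \<Rightarrow> 'a \<Rightarrow> real" where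
  "vol_density g c z = sqrt (det (g c z))"

definition chart_wlaplacian ::
  "('a, 'n::finite) metric \<Rightarrow> ('a, 'n) chart \<Rightarrow> ('a \<Rightarrow> real) \<Rightarrow> ('a \<Rightarrow> real) \<Rightarrow> 'a \<Rightarrow> real" where
  "chart_wlaplacian g c f u x = chart_laplacian g c u x - chart_inner g c f u x"

context metric_patch
begin

lemma det_metric_pos: "x \<in> W \<Longrightarrow> det (g c x) > 0"
  using posdef_det_pos metric_pos by blast

lemma vol_density_pos: "x \<in> W \<Longrightarrow> vol_density g c x > 0"
  using det_metric_pos by (simp add: vol_density_def)

lemma C_vol_density: "C k (vol_density g c)"
proof (rule C_cong)
  show "C k (\<lambda>z. det (g c z) powr (1/2))"
    by (intro C_powr C_det C_metric det_metric_pos)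
  show "det (g c x) powr (1/2) = vol_density g c x" if "x \<in> W" for x
    using det_metric_pos[OF that] by (simp add: vol_density_def powr_half_sqrt)
qed

text \<open>In the contraction with the symmetric inverse metric the first and the third derivative
  term cancel.\<close>

lemma sum_christoffel:
  assumes x: "x \<in> W"
  shows "(\<Sum>j\<in>UNIV. \<Gamma> j j i x) = 1/2 * (\<Sum>j\<in>UNIV. \<Sum>l\<in>UNIV. ginv g c x $ j $ l * pd c i (\<lambda>z. g c z $ j $ l) x)"
proof -
  let ?dg = "\<lambda>k i j. pd c k (\<lambda>z. g c z $ i $ j) x"
  have dsym: "?dg l i j = ?dg l j i" for l i j using x by (intro pd_cong metric_sym)
  have "(\<Sum>j\<in>UNIV. \<Sum>l\<in>UNIV. ginv g c x $ j $ l * ?dg j i l) = (\<Sum>j\<in>UNIV. \<Sum>l\<in>UNIV. ginv g c x $ j $ l * ?dg l j i)"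
  proof (subst sum.swap, intro sum.cong refl)
    show "ginv g c x $ l $ j * ?dg l i j = ginv g c x $ j $ l * ?dg l j i" for j l
      using ginv_sym[OF x, of l j] dsym[of l i j] by simp
  qed
  then show ?thesis
    unfolding christoffel_def sum_distrib_left[symmetric]
    by (simp add: distrib_left right_diff_distrib sum.distrib sum_subtractf)
qed

text \<open>Jacobi's formula for det g meets the contracted Christoffel symbols. This is why the
  divergence becomes a plain coordinate divergence after multiplication by the density.\<close>

lemma pd_vol_density:
  assumes x: "x \<in> W"
  shows "pd c i (vol_density g c) x = vol_density g c x * (\<Sum>j\<in>UNIV. \<Gamma> j j i x)"
proof -
  let ?d = "det (g c x)"
  have "pd c i (vol_density g c) x = inverse (sqrt ?d) / 2 * pd c i (\<lambda>z. det (g c z)) x"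
    unfolding vol_density_def
    by (rule pd_real[OF C_det[OF C_metric] x]) (rule DERIV_real_sqrt[OF det_metric_pos[OF x]])
  also have "pd c i (\<lambda>z. det (g c z)) x = ?d * (2 * (\<Sum>j\<in>UNIV. \<Gamma> j j i x))"
    unfolding sum_christoffel[OF x] pd_det[OF C_metric x metric_invertible[OF x]]
  proof -
    have "matrix_inv (g c x) $ q $ l = ginv g c x $ l $ q" for q l
      using ginv_sym[OF x, of q l] by (simp add: ginv_def)
    then show "?d * (\<Sum>l\<in>UNIV. \<Sum>q\<in>UNIV. matrix_inv (g c x) $ q $ l * pd c i (\<lambda>z. g c z $ l $ q) x)
        = ?d * (2 * (1/2 * (\<Sum>j\<in>UNIV. \<Sum>l\<in>UNIV. ginv g c x $ j $ l * pd c i (\<lambda>z. g c z $ j $ l) x)))"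
      by simp
  qed
  also have "inverse (sqrt ?d) / 2 * (?d * (2 * (\<Sum>j\<in>UNIV. \<Gamma> j j i x)))
      = vol_density g c x * (\<Sum>j\<in>UNIV. \<Gamma> j j i x)"
    using det_metric_pos[OF x] by (simp add: vol_density_def field_simps)
  finally show ?thesis .
qed

lemma chart_div_scale:
  assumes "C 1 h" "\<And>i. C 1 (\<lambda>z. Z z $ i)" "x \<in> W"
  shows "chart_div g c (\<lambda>z. h z *\<^sub>R Z z) x = h x * chart_div g c Z x + (\<Sum>i\<in>UNIV. pd c i h x * Z x $ i)"
  using assms by (simp add: chart_div_def pd_mult sum.distrib sum_distrib_left distrib_left mult_ac del: One_nat_def)

lemma chart_div_diff:
  assumes "\<And>i. C 1 (\<lambda>z. Y z $ i)" "\<And>i. C 1 (\<lambda>z. Z z $ i)" "x \<in> W"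
  shows "chart_div g c (\<lambda>z. Y z - Z z) x = chart_div g c Y x - chart_div g c Z x"
  using assms by (simp add: chart_div_def pd_diff sum.distrib sum_subtractf right_diff_distrib del: One_nat_def)

lemma chart_div_add:
  assumes "\<And>i. C 1 (\<lambda>z. Y z $ i)" "\<And>i. C 1 (\<lambda>z. Z z $ i)" "x \<in> W"
  shows "chart_div g c (\<lambda>z. Y z + Z z) x = chart_div g c Y x + chart_div g c Z x"
  using assms by (simp add: chart_div_def pd_add sum.distrib distrib_left del: One_nat_def)

lemma chart_div_cong:
  "(\<And>z. z \<in> W \<Longrightarrow> Y z = Z z) \<Longrightarrow> x \<in> W \<Longrightarrow> chart_div g c Y x = chart_div g c Z x"
  using pd_cong[of "\<lambda>z. Y z $ i" "\<lambda>z. Z z $ i" x i for i] by (simp add: chart_div_def)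

lemma vol_density_chart_div:
  assumes "\<And>i. C 1 (\<lambda>z. Z z $ i)" "x \<in> W"
  shows "vol_density g c x * chart_div g c Z x = (\<Sum>i\<in>UNIV. pd c i (\<lambda>z. vol_density g c z * Z z $ i) x)"
proof -
  have "(\<Sum>i\<in>UNIV. \<Sum>j\<in>UNIV. \<Gamma> i i j x * Z x $ j) = (\<Sum>i\<in>UNIV. (\<Sum>j\<in>UNIV. \<Gamma> j j i x) * Z x $ i)"
    unfolding sum_distrib_right by (rule sum.swap)
  then show ?thesis
    using assms by (simp add: pd_mult C_vol_density pd_vol_density chart_div_def sum.distrib distrib_left
        sum_distrib_left mult_ac del: One_nat_def)
qed

text \<open>Both sides come from the divergence of exp (-f) (u grad v - v grad u). The factor exp
  (-f) supplies the drift of the weighted Laplacian, and the products <grad u, grad v> cancel by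
  symmetry.\<close>

lemma green_identity:
  assumes f: "C 2 f" and u: "C 2 u" and v: "C 2 v" and x: "x \<in> W"
  shows "vol_density g c x * exp (- f x) * (u x * chart_wlaplacian g c f v x - v x * chart_wlaplacian g c f u x)
    = (\<Sum>i\<in>UNIV. pd c i (\<lambda>z. vol_density g c z * exp (- f z) * (u z * X v z i - v z * X u z i)) x)"
proof -
  define Z where "Z z = u z *\<^sub>R grad g c v z - v z *\<^sub>R grad g c u z" for z
  have C1: "C 1 f" "C 1 u" "C 1 v" using f u v by (auto intro: C_mono)
  have CX: "C 1 (\<lambda>z. X u z i)" "C 1 (\<lambda>z. X v z i)" for i
    using u v by (auto intro!: C_grad simp: numeral_2_eq_2)
  have CZ: "C 1 (\<lambda>z. Z z $ i)" for i
    unfolding Z_def by (simp del: One_nat_def) (intro C_intros C1 CX)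
  have Ce: "C 1 (\<lambda>z. exp (- f z))" by (intro C_exp C_minus C1)
  have pe: "pd c i (\<lambda>z. exp (- f z)) x = exp (- f x) * - pd c i f x" for i
    using pd_real[OF C_minus[OF C1(1)] x, of exp "exp (- f x)" i] pd_minus[OF C1(1) x] by (simp add: DERIV_exp)
  have "(\<Sum>i\<in>UNIV. pd c i (\<lambda>z. vol_density g c z * exp (- f z) * (u z * X v z i - v z * X u z i)) x)
      = vol_density g c x * chart_div g c (\<lambda>z. exp (- f z) *\<^sub>R Z z) x"
    using CZ Ce x by (subst vol_density_chart_div) (auto intro!: C_mult simp: Z_def mult.assoc simp del: One_nat_def)
  also have "chart_div g c (\<lambda>z. exp (- f z) *\<^sub>R Z z) x
      = exp (- f x) * (chart_div g c Z x - (\<Sum>i\<in>UNIV. pd c i f x * Z x $ i))"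
    by (simp add: chart_div_scale[OF Ce CZ x] pe sum_negf sum_distrib_left right_diff_distrib mult.assoc)
  also have "chart_div g c Z x = u x * chart_laplacian g c v x - v x * chart_laplacian g c u x"
  proof -
    have "chart_div g c Z x = (u x * chart_laplacian g c v x + chart_inner g c u v x)
        - (v x * chart_laplacian g c u x + chart_inner g c v u x)"
      unfolding Z_def chart_laplacian_def chart_inner_def
      using C1 CX x by (subst chart_div_diff) (auto simp: chart_div_scale C_mult simp del: One_nat_def)
    then show ?thesis using chart_inner_eq(2)[OF x, of u v] by simp
  qed
  also have "(\<Sum>i\<in>UNIV. pd c i f x * Z x $ i) = u x * chart_inner g c f v x - v x * chart_inner g c f u x"
    by (simp add: Z_def chart_inner_def right_diff_distrib sum_subtractf sum_distrib_left mult_ac)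
  finally show ?thesis by (simp add: chart_wlaplacian_def algebra_simps)
qed

end

section \<open>Test functions and integration\<close>

text \<open>The functions q (1/t) exp (-1/t), continued by zero. They form a family that is closed
  under differentiation and contains all derivatives of exp (-1/t), as
  \<open>Ck_on_compose_real\<close> requires.\<close>

definition flat_exp :: "real poly \<Rightarrow> real \<Rightarrow> real" where
  "flat_exp q t = (if t > 0 then poly q (inverse t) * exp (- inverse t) else 0)"

lemma poly_times_exp_minus_tendsto_0:
  "((\<lambda>s. poly q s * exp (- s)) \<longlongrightarrow> (0::real)) at_top"
proof -
  have "((\<lambda>s. \<Sum>i\<le>degree q. coeff q i * (s ^ i / exp s)) \<longlongrightarrow> (\<Sum>i\<le>degree q. coeff q i * 0)) at_top"
    by (intro tendsto_sum tendsto_mult tendsto_const tendsto_power_div_exp_0)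
  then show ?thesis
    by (simp add: poly_altdef sum_distrib_right exp_minus divide_inverse mult.assoc)
qed

text \<open>With s = 1/t the chain rule contributes the factor -s^2, and q (s) exp (-s) has the
  derivative (q' - q) (s) exp (-s) in s; \<open>[:0, 0, 1:]\<close> is the monomial s^2.\<close>

lemma DERIV_flat_exp:
  "(flat_exp q has_real_derivative flat_exp ([:0, 0, 1:] * (q - pderiv q)) t) (at t)"
proof (cases t "0 :: real" rule: linorder_cases)
  case less
  have "((\<lambda>_. 0) has_real_derivative flat_exp ([:0, 0, 1:] * (q - pderiv q)) t) (at t)"
    using less by (simp add: flat_exp_def)
  then show ?thesis
    by (rule has_field_derivative_transform_within_open[where S = "{..<0}"])
      (use less in \<open>auto simp: flat_exp_def\<close>)
next
  case greater
  have "((\<lambda>t. poly q (inverse t) * exp (- inverse t)) has_real_derivative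
      flat_exp ([:0, 0, 1:] * (q - pderiv q)) t) (at t)"
    using greater
    by (auto intro!: derivative_eq_intros DERIV_chain2[OF poly_DERIV] simp: flat_exp_def algebra_simps power2_eq_square)
  then show ?thesis
    by (rule has_field_derivative_transform_within_open[where S = "{0<..}"])
      (use greater in \<open>auto simp: flat_exp_def\<close>)
next
  case equal
  let ?d = "\<lambda>h. (flat_exp q (0 + h) - flat_exp q 0) / h"
  have "(?d \<longlongrightarrow> 0) (at_left 0)"
    by (rule tendsto_eventually) (auto simp: eventually_at_left_field flat_exp_def intro!: exI[of _ "-1"])
  moreover have "(?d \<longlongrightarrow> 0) (at_right 0)"
  proof (rule Lim_transform_eventually)
    \<comment> \<open>Dividing by h is multiplying by s = 1/h, which \<open>pCons 0\<close> absorbs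
      into the polynomial; the exponential beats it as s tends to infinity.\<close>
    show "((\<lambda>h. poly (pCons 0 q) (inverse h) * exp (- inverse h)) \<longlongrightarrow> 0) (at_right 0)"
      by (rule filterlim_compose[OF poly_times_exp_minus_tendsto_0 filterlim_inverse_at_top_right])
    show "\<forall>\<^sub>F h in at_right 0. poly (pCons 0 q) (inverse h) * exp (- inverse h) = ?d h"
      using eventually_at_right_less[of "0 :: real"]
      by eventually_elim (simp add: flat_exp_def divide_inverse)
  qed
  ultimately have "(?d \<longlongrightarrow> 0) (at 0)" by (rule filterlim_split_at)
  then show ?thesis using equal by (simp add: DERIV_def flat_exp_def)
qed

lemma bump_function:
  fixes y0 :: "real^'n::finite"
  assumes "r > 0"
  obtains b where "\<And>k. Ck_on k UNIV b" "\<And>y. b y \<ge> 0" "b y0 > 0"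
    "\<And>y. y \<notin> cball y0 r \<Longrightarrow> b y = 0"
proof -
  \<comment> \<open>\<open>q j\<close> is the polynomial of the j-th derivative of exp
    (-1/t).\<close>
  define q where "q = rec_nat (1 :: real poly) (\<lambda>_ q. [:0, 0, 1:] * (q - pderiv q))"
  \<comment> \<open>A polynomial in the coordinates that is positive exactly inside the ball of
    radius \<open>r\<close>.\<close>
  define h where "h y = r\<^sup>2 - (\<Sum>i\<in>UNIV. (y $ i - y0 $ i) * (y $ i - y0 $ i))" for y :: "real^'n"
  have h: "h y = r\<^sup>2 - (dist y y0)\<^sup>2" for y
    by (simp add: h_def dist_norm power2_norm_eq_inner inner_vec_def)
  have ck: "Ck_on k UNIV (\<lambda>y. flat_exp (q 0) (h y))" for k
  proof (rule Ck_on_compose_real[where T = UNIV and F = "\<lambda>j. flat_exp (q j)"])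
    show "(flat_exp (q j) has_real_derivative flat_exp (q (Suc j)) t) (at t)" for j t
      using DERIV_flat_exp[of "q j" t] by (simp add: q_def)
    show "Ck_on k UNIV h"
      unfolding h_def[abs_def]
      by (intro Ck_on_diff Ck_on_sum Ck_on_mult Ck_on_const Ck_on_component open_UNIV)
  qed auto
  have nn: "flat_exp (q 0) t \<ge> 0" and p: "t > 0 \<Longrightarrow> flat_exp (q 0) t > 0"
    and z: "t \<le> 0 \<Longrightarrow> flat_exp (q 0) t = 0" for t
    by (auto simp: flat_exp_def q_def)
  have neg: "h y \<le> 0" if "y \<notin> cball y0 r" for y
    using that assms by (simp add: h dist_commute power_mono)
  have pos: "h y0 > 0" using assms by (simp add: h)
  show ?thesis
    by (rule that[OF ck nn p[OF pos] z[OF neg]])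
qed

section \<open>Integrals of compactly supported functions and of the volume measure\<close>

lemma compact_support_integrable:
  fixes F :: "real^'n::finite \<Rightarrow> real"
  assumes "continuous_on UNIV F" "compact K" "\<And>y. y \<notin> K \<Longrightarrow> F y = 0"
  shows "integrable lborel F"
proof -
  have "integrable lborel (\<lambda>y. indicator K y *\<^sub>R F y)"
    using assms by (intro borel_integrable_compact) (auto intro: continuous_on_subset)
  also have "(\<lambda>y. indicator K y *\<^sub>R F y) = F"
    using assms(3) by (auto simp: fun_eq_iff indicator_def)
  finally show ?thesis .
qed

lemma partial_deriv_zero:
  assumes "closed K" "\<And>z. z \<notin> K \<Longrightarrow> F z = 0" "y \<notin> K"
  shows "partial_deriv i F y = 0"
  using partial_deriv_cong[of "- K" y F "\<lambda>_. 0" i] assms by (simp add: open_Compl)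

text \<open>By translation invariance the integrals of the difference quotients of \<open>F\<close> vanish.\<close>

lemma integral_partial_deriv_zero:
  fixes F :: "real^'n::finite \<Rightarrow> real"
  assumes F: "Ck_on 1 UNIV F" and K: "compact K" and supp: "\<And>y. y \<notin> K \<Longrightarrow> F y = 0"
  shows "integral\<^sup>L lborel (partial_deriv i F) = 0"
proof -
  let ?e = "axis i (1::real) :: real^'n"
  have contF: "continuous_on UNIV F" using F Ck_on_continuous by blast
  have contD: "continuous_on UNIV (partial_deriv i F)" using F by simp
  have "bounded (partial_deriv i F ` K)"
    using compact_continuous_image[OF continuous_on_subset[OF contD] K] compact_imp_bounded by auto
  then obtain B where B0: "B > 0" and B: "\<And>y. y \<in> K \<Longrightarrow> \<bar>partial_deriv i F y\<bar> \<le> B"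
    unfolding bounded_pos by (auto simp: image_iff)
  have B: "\<bar>partial_deriv i F y\<bar> \<le> B" for y
    using B B0 partial_deriv_zero[OF compact_imp_closed[OF K] supp, where y = y and i = i] by (cases "y \<in> K") auto
  obtain R where R: "K \<subseteq> cball 0 R" using compact_imp_bounded[OF K] unfolding bounded_iff by (auto simp: subset_iff)
  have dir: "((\<lambda>a. F (y + a *\<^sub>R ?e)) has_real_derivative partial_deriv i F (y + a *\<^sub>R ?e)) (at a)" for y a
  proof -
    have "F differentiable at (y + a *\<^sub>R ?e)"
      using Ck_on_differentiable[of 0 UNIV F] F by simp
    then have D: "(F has_derivative frechet_derivative F (at (y + a *\<^sub>R ?e))) (at (y + a *\<^sub>R ?e))"
      by (simp add: frechet_derivative_works)
    have "((\<lambda>a. y + a *\<^sub>R ?e) has_derivative (\<lambda>a. a *\<^sub>R ?e)) (at a)"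
      by (auto intro!: derivative_eq_intros)
    from has_derivative_compose[OF this D] show ?thesis
      unfolding has_field_derivative_def partial_deriv_def
      using linear_cmul[OF has_derivative_linear[OF D]] by (simp add: mult.commute[of _ "frechet_derivative F _ _"])
  qed
  \<comment> \<open>Steps of size at most 1: all difference quotients vanish outside radius
    \<open>R + 1\<close>, and the mean value theorem bounds them by \<open>B\<close>. This gives the
    dominating function.\<close>
  define t where "t j = inverse (real (Suc j))" for j
  have t: "0 < t j" "t j \<le> 1" for j by (auto simp: t_def divide_simps)
  define Q where "Q j y = (F (t j *\<^sub>R ?e + y) - F y) / t j" for j y
  have intF: "integrable lborel F" by (rule compact_support_integrable[OF contF K supp])
  have shift: "integrable lborel (\<lambda>y. F (a + y))" "integral\<^sup>L lborel (\<lambda>y. F (a + y)) = integral\<^sup>L lborel F" for a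
  proof -
    have F': "F \<in> borel_measurable (distr lborel borel ((+) a))"
      using contF borel_measurable_continuous_onI by simp
    have "integrable (distr lborel borel ((+) a)) F" unfolding lborel_distr_plus by (rule intF)
    then show "integrable lborel (\<lambda>y. F (a + y))"
      by (subst (asm) integrable_distr_eq) (use F' in auto)
    have "integral\<^sup>L lborel F = integral\<^sup>L (distr lborel borel ((+) a)) F" unfolding lborel_distr_plus ..
    also have "\<dots> = integral\<^sup>L lborel (\<lambda>y. F (a + y))"
      by (rule integral_distr) (use F' in auto)
    finally show "integral\<^sup>L lborel (\<lambda>y. F (a + y)) = integral\<^sup>L lborel F" ..
  qed
  have "integral\<^sup>L lborel (Q j) = 0" for j
    unfolding Q_def using shift intF by simp
  moreover have "(\<lambda>j. integral\<^sup>L lborel (Q j)) \<longlonglongrightarrow> integral\<^sup>L lborel (partial_deriv i F)"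
  proof (rule integral_dominated_convergence[where w = "\<lambda>y. indicator (cball 0 (R + 1)) y * B"])
    show "partial_deriv i F \<in> borel_measurable lborel"
      using contD borel_measurable_continuous_onI by simp
    show "Q j \<in> borel_measurable lborel" for j
      unfolding Q_def using shift(1) intF by measurable
    show "integrable lborel (\<lambda>y. indicator (cball 0 (R + 1)) y * B)"
      using borel_integrable_compact[of "cball 0 (R + 1)" "\<lambda>_. B"] by simp
    show "AE y in lborel. (\<lambda>j. Q j y) \<longlonglongrightarrow> partial_deriv i F y"
    proof (rule AE_I2)
      fix y
      have "((\<lambda>a. (F (y + (0 + a) *\<^sub>R ?e) - F (y + 0 *\<^sub>R ?e)) / a) \<longlongrightarrow> partial_deriv i F (y + 0 *\<^sub>R ?e)) (at 0)"
        using dir[of y 0] by (simp add: DERIV_def)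
      moreover have "filterlim t (at 0) sequentially"
        unfolding filterlim_at
      proof
        show "\<forall>\<^sub>F j in sequentially. t j \<in> UNIV \<and> t j \<noteq> 0"
          using t(1) by (auto simp: less_imp_neq[symmetric])
        show "t \<longlonglongrightarrow> 0" unfolding t_def[abs_def] by (rule LIMSEQ_inverse_real_of_nat)
      qed
      ultimately have "(\<lambda>j. (F (y + (0 + t j) *\<^sub>R ?e) - F (y + 0 *\<^sub>R ?e)) / t j) \<longlonglongrightarrow> partial_deriv i F (y + 0 *\<^sub>R ?e)"
        by (rule filterlim_compose)
      then show "(\<lambda>j. Q j y) \<longlonglongrightarrow> partial_deriv i F y"
        by (simp add: Q_def add.commute)
    qed
    show "AE y in lborel. norm (Q j y) \<le> indicator (cball 0 (R + 1)) y * B" for j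
    proof (rule AE_I2)
      fix y
      show "norm (Q j y) \<le> indicator (cball 0 (R + 1)) y * B"
      proof (cases "y \<in> cball 0 (R + 1)")
        case True
        obtain z where "F (y + t j *\<^sub>R ?e) - F (y + 0 *\<^sub>R ?e) = (t j - 0) * partial_deriv i F (y + z *\<^sub>R ?e)"
          using MVT2[OF t(1)[of j], of "\<lambda>a. F (y + a *\<^sub>R ?e)" "\<lambda>a. partial_deriv i F (y + a *\<^sub>R ?e)"] dir
          by blast
        then have "Q j y = partial_deriv i F (y + z *\<^sub>R ?e)"
          using t(1)[of j] by (simp add: Q_def add.commute)
        then show ?thesis using B True by simp
      next
        case False
        have "norm y \<le> norm (t j *\<^sub>R ?e + y) + norm (t j *\<^sub>R ?e)"
          using norm_triangle_ineq4[of "t j *\<^sub>R ?e + y" "t j *\<^sub>R ?e"] by simp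
        then have "t j *\<^sub>R ?e + y \<notin> cball 0 R" "y \<notin> cball 0 R" using False t[of j] by auto
        then have "F (t j *\<^sub>R ?e + y) = 0" "F y = 0" using R supp by blast+
        then show ?thesis using False by (simp add: Q_def)
      qed
    qed
  qed
  ultimately show ?thesis by (simp add: LIMSEQ_const_iff)
qed

text \<open>The set where \<open>h\<close> is nonzero is null because of the integral and open by
  continuity, hence empty.\<close>

lemma integral_zero_imp_zero:
  fixes h :: "real^'n::finite \<Rightarrow> real"
  assumes h: "continuous_on UNIV h" "compact K" "\<And>y. y \<notin> K \<Longrightarrow> h y = 0" and nn: "\<And>y. h y \<ge> 0"
    and 0: "integral\<^sup>L lborel h = 0"
  shows "h y = 0"
proof (rule ccontr)
  assume "h y \<noteq> 0"
  have int: "integrable lborel h" by (rule compact_support_integrable[OF h])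
  have "AE y in lborel. h y = 0"
    using integral_nonneg_eq_0_iff_AE[OF int] nn 0 by simp
  then have "{y. h y \<noteq> 0} \<in> null_sets lborel"
    using int by (subst (asm) AE_iff_null) auto
  then have "negligible {y. h y \<noteq> 0}"
    using null_sets_completionI negligible_iff_null_sets by blast
  moreover have "open {y. h y \<noteq> 0}"
    using open_Collect_neq[OF h(1) continuous_on_const[of UNIV 0]] .
  ultimately show False using open_not_negligible \<open>h y \<noteq> 0\<close> by blast
qed

text \<open>\<open>riemannian_volume\<close> gives the measures of Borel sets inside a chart. These
  determine the push-forward of the restricted measure under the chart, and a function vanishing
  outside the chart is integrated against that push-forward.\<close>

lemma integral_riemannian_volume:
  fixes A :: "('a::{t2_space, second_countable_topology}, 'n::finite) chart set"
  assumes vol: "riemannian_volume A g dV" and c: "c \<in> A" "is_chart c"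
    and h: "h \<in> borel_measurable borel" and dens: "continuous_on (snd c ` fst c) (\<lambda>y. det (g c (chart_inv c y)))"
    and pos: "\<And>x. x \<in> fst c \<Longrightarrow> det (g c x) \<ge> 0"
    and H: "\<And>x. x \<in> fst c \<Longrightarrow> H x = h (snd c x)" "\<And>x. x \<notin> fst c \<Longrightarrow> H x = 0"
  shows "integral\<^sup>L dV H = integral\<^sup>L lborel (\<lambda>y. indicator (snd c ` fst c) y * sqrt (det (g c (chart_inv c y))) * h y)"
proof -
  let ?U = "snd c ` fst c"
  have oc: "open (fst c)" "open ?U" and contc: "continuous_on (fst c) (snd c)"
    and inv: "\<And>x. x \<in> fst c \<Longrightarrow> chart_inv c (snd c x) = x"
    using c(2) unfolding is_chart_def homeomorphism_def by blast+
  have sets: "sets dV = sets borel" using vol by (simp add: riemannian_volume_def)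
  \<comment> \<open>A total Borel map that extends the chart; the value 0 outside the domain is
    invisible to the measure restricted to \<open>fst c\<close>.\<close>
  define \<theta> where "\<theta> x = (if x \<in> fst c then snd c x else 0)" for x
  define w where "w y = indicator ?U y * sqrt (det (g c (chart_inv c y)))" for y
  have w: "w \<in> borel_measurable lborel"
  proof -
    have "(\<lambda>y. if y \<in> ?U then sqrt (det (g c (chart_inv c y))) else 0) \<in> borel_measurable borel"
      using oc dens by (intro borel_measurable_continuous_on_if) (auto intro!: continuous_intros)
    moreover have "(\<lambda>y. if y \<in> ?U then sqrt (det (g c (chart_inv c y))) else 0) = w"
      by (auto simp: fun_eq_iff w_def)
    ultimately show ?thesis by simp
  qed
  have wnn: "w y \<ge> 0" for y using pos by (auto simp: w_def indicator_def inv)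
  have \<theta>: "\<theta> \<in> measurable borel borel"
    unfolding \<theta>_def[abs_def] using oc contc by (intro borel_measurable_continuous_on_if) auto
  have \<theta>': "\<theta> \<in> measurable (density dV (indicator (fst c))) borel"
    using \<theta> sets by (simp add: measurable_def sets_eq_imp_space_eq)
  have eq: "distr (density dV (indicator (fst c))) borel \<theta> = density lborel (\<lambda>y. ennreal (w y))"
  proof (rule measure_eqI)
    fix S assume "S \<in> sets (distr (density dV (indicator (fst c))) borel \<theta>)"
    then have S: "S \<in> sets borel" by simp
    let ?B = "\<theta> -` S \<inter> fst c"
    have B: "\<theta> -` S \<in> sets borel" using measurable_sets[OF \<theta> S] by simp
    then have B': "?B \<in> sets borel" using oc by auto
    have "emeasure (distr (density dV (indicator (fst c))) borel \<theta>) S = emeasure (density dV (indicator (fst c))) (\<theta> -` S)"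
      using emeasure_distr[OF \<theta>' S] sets_eq_imp_space_eq[OF sets] by simp
    also have "\<dots> = (\<integral>\<^sup>+x. indicator (fst c) x * indicator (\<theta> -` S) x \<partial>dV)"
      using B oc sets by (intro emeasure_density borel_measurable_indicator) auto
    also have "\<dots> = (\<integral>\<^sup>+x. indicator ?B x \<partial>dV)"
      by (intro nn_integral_cong) (auto simp: indicator_def)
    also have "\<dots> = emeasure dV ?B" using B' sets by simp
    also have "\<dots> = (\<integral>\<^sup>+ y\<in>snd c ` ?B. ennreal (sqrt (det (g c (chart_inv c y)))) \<partial>lborel)"
      using vol c(1) B' by (simp add: riemannian_volume_def)
    also have "\<dots> = (\<integral>\<^sup>+ y\<in>S. ennreal (w y) \<partial>lborel)"
    proof -
      have "snd c ` ?B = S \<inter> ?U" by (auto simp: \<theta>_def)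
      then show ?thesis by (intro nn_integral_cong) (auto simp: w_def indicator_def)
    qed
    also have "\<dots> = emeasure (density lborel (\<lambda>y. ennreal (w y))) S"
      using S w by (subst emeasure_density) auto
    finally show "emeasure (distr (density dV (indicator (fst c))) borel \<theta>) S = emeasure (density lborel (\<lambda>y. ennreal (w y))) S" .
  qed simp
  have "integral\<^sup>L lborel (\<lambda>y. w y * h y) = integral\<^sup>L (density lborel (\<lambda>y. ennreal (w y))) h"
    using integral_density[of h lborel w] h w wnn by simp
  also have "\<dots> = integral\<^sup>L (density dV (indicator (fst c))) (\<lambda>x. h (\<theta> x))"
    unfolding eq[symmetric] by (rule integral_distr[OF \<theta>' h])
  also have "\<dots> = integral\<^sup>L (density dV (\<lambda>x. ennreal (indicator (fst c) x))) (\<lambda>x. h (\<theta> x))"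
    by (simp add: ennreal_indicator)
  also have "\<dots> = integral\<^sup>L dV (\<lambda>x. indicator (fst c) x *\<^sub>R h (\<theta> x))"
  proof (rule integral_density)
    show "(\<lambda>x. h (\<theta> x)) \<in> borel_measurable dV"
      using measurable_compose[OF \<theta> h] sets by (simp cong: measurable_cong_sets)
    show "(\<lambda>x. indicator (fst c) x :: real) \<in> borel_measurable dV"
      using oc sets by (intro borel_measurable_indicator) auto
  qed auto
  also have "\<dots> = integral\<^sup>L dV H"
    by (rule Bochner_Integration.integral_cong) (auto simp: H \<theta>_def indicator_def)
  finally show ?thesis by (simp add: w_def)
qed

section \<open>The Green function solves the equation pointwise\<close>

context coord_patch
begin

text \<open>Two open sets cover the coordinate space: the image of \<open>W\<close>, where the
  function is as regular as \<open>u\<close>, and the complement of the compact image of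
  \<open>K\<close>, where it is zero.\<close>

lemma C_extension:
  assumes u: "C k u" and K: "compact K" "K \<subseteq> W" and supp: "\<And>x. x \<in> W \<Longrightarrow> x \<notin> K \<Longrightarrow> u x = 0"
  shows "Ck_on k UNIV (\<lambda>y. if y \<in> snd c ` W then u (chart_inv c y) else 0)" (is "Ck_on k UNIV ?F")
    and "compact (snd c ` K)"
    and "\<And>y. y \<notin> snd c ` K \<Longrightarrow> (if y \<in> snd c ` W then u (chart_inv c y) else 0) = 0"
proof -
  have "continuous_on K (snd c)"
    using chart W_sub K(2) unfolding is_chart_def homeomorphism_def by (meson continuous_on_subset order_trans)
  then show cK: "compact (snd c ` K)" using K(1) by (rule compact_continuous_image)
  show F0: "?F y = 0" if "y \<notin> snd c ` K" for y
  proof (cases "y \<in> snd c ` W")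
    case True
    then obtain x where "x \<in> W" "y = snd c x" by auto
    then show ?thesis using that supp[of x] by (auto simp: chart_inv_W)
  qed simp
  show "Ck_on k UNIV ?F"
  proof (rule Ck_on_local)
    fix y
    show "\<exists>T. open T \<and> y \<in> T \<and> Ck_on k T ?F"
    proof (cases "y \<in> snd c ` W")
      case True
      have "Ck_on k (snd c ` W) ?F"
        using u unfolding chart_Ck_def by (rule Ck_on_cong[OF _ open_U]) auto
      then show ?thesis using open_U True by blast
    next
      case False
      then have "y \<in> - snd c ` K" using K(2) by auto
      moreover have "open (- snd c ` K)" using compact_imp_closed[OF cK] by (simp add: open_Compl)
      moreover have "Ck_on k (- snd c ` K) ?F"
        by (rule Ck_on_cong[OF Ck_on_const[of _ _ 0] \<open>open (- snd c ` K)\<close>]) (rule F0[symmetric], simp)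
      ultimately show ?thesis by blast
    qed
  qed
qed

lemma pd_eq_partial_deriv:
  assumes "x \<in> W" "\<And>z. z \<in> W \<Longrightarrow> F (snd c z) = u z"
  shows "pd c i u x = partial_deriv i F (snd c x)"
  unfolding pd_def by (rule partial_deriv_cong[OF open_U]) (use assms in \<open>auto simp: chart_inv_W\<close>)

end

context metric_patch
begin

lemma C_chart_wlaplacian: "C (Suc k) f \<Longrightarrow> C (Suc (Suc k)) u \<Longrightarrow> C k (chart_wlaplacian g c f u)"
  unfolding chart_wlaplacian_def[abs_def]
  by (intro C_diff C_chart_laplacian C_chart_inner) (auto intro: C_mono)

lemma grad_cong: "(\<And>z. z \<in> W \<Longrightarrow> u z = v z) \<Longrightarrow> x \<in> W \<Longrightarrow> grad g c u x = grad g c v x"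
  using pd_cong[of u v x] by (simp add: grad_def)

lemma chart_laplacian_cong:
  "(\<And>z. z \<in> W \<Longrightarrow> u z = v z) \<Longrightarrow> x \<in> W \<Longrightarrow> chart_laplacian g c u x = chart_laplacian g c v x"
  unfolding chart_laplacian_def by (intro chart_div_cong grad_cong)

lemma chart_wlaplacian_cong:
  "(\<And>z. z \<in> W \<Longrightarrow> u z = v z) \<Longrightarrow> x \<in> W \<Longrightarrow> chart_wlaplacian g c f u x = chart_wlaplacian g c f v x"
  using chart_laplacian_cong[of u v x] chart_inner_cong[of u v x f] by (simp add: chart_wlaplacian_def)

lemma grad_zero: "(\<And>z. z \<in> W \<Longrightarrow> u z = 0) \<Longrightarrow> x \<in> W \<Longrightarrow> grad g c u x = 0"
  using grad_cong[of u "\<lambda>_. 0" x] by (simp add: grad_def vec_eq_iff)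

lemma chart_wlaplacian_zero: "(\<And>z. z \<in> W \<Longrightarrow> u z = 0) \<Longrightarrow> x \<in> W \<Longrightarrow> chart_wlaplacian g c f u x = 0"
  using chart_wlaplacian_cong[of u "\<lambda>_. 0" x f]
  by (simp add: chart_wlaplacian_def chart_laplacian_def chart_inner_def chart_div_def grad_def)

end

section \<open>Invariant operators and test functions on the whole manifold\<close>

locale riemannian_manifold =
  fixes A :: "('a::{t2_space, second_countable_topology}, 'n::finite) chart set" and g :: "('a, 'n) metric"
  assumes atlas: "smooth_atlas A" and metric: "riemannian_metric A g"
begin

lemma is_chart: "c \<in> A \<Longrightarrow> is_chart c"
  using atlas by (simp add: smooth_atlas_def)

lemma open_chart: "c \<in> A \<Longrightarrow> open (fst c)"
  using is_chart by (auto simp: is_chart_def)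

lemma chart_at: "chart_at A x \<in> A" "x \<in> fst (chart_at A x)"
proof -
  have "\<exists>c. c \<in> A \<and> x \<in> fst c" using atlas by (force simp: smooth_atlas_def)
  then have "chart_at A x \<in> A \<and> x \<in> fst (chart_at A x)"
    unfolding chart_at_def by (rule someI_ex)
  then show "chart_at A x \<in> A" "x \<in> fst (chart_at A x)" by auto
qed

lemma Ck_fun_iff: "Ck_fun A k V u \<longleftrightarrow> (\<forall>c\<in>A. chart_Ck c (fst c \<inter> V) k u)"
  by (simp add: Ck_fun_def chart_Ck_def)

lemma Ck_fun_chart: "Ck_fun A k V u \<Longrightarrow> c \<in> A \<Longrightarrow> W \<subseteq> fst c \<inter> V \<Longrightarrow> chart_Ck c W k u"
  unfolding Ck_fun_def chart_Ck_def by (blast intro: Ck_on_subset)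

lemma Ck_fun_mono: "Ck_fun A l V u \<Longrightarrow> k \<le> l \<Longrightarrow> Ck_fun A k V u"
  unfolding Ck_fun_def by (blast intro: Ck_on_mono)

lemma patch:
  assumes "c \<in> A" "open W" "W \<subseteq> fst c"
  shows "metric_patch c W g"
proof unfold_locales
  have m: "transpose (g c x) = g c x" "v \<noteq> 0 \<Longrightarrow> v \<bullet> (g c x *v v) > 0" if "x \<in> W" for x v
    using metric assms that unfolding riemannian_metric_def by blast+
  show "g c x $ i $ j = g c x $ j $ i" if "x \<in> W" for x i j
    using arg_cong[OF m(1)[OF that], of "\<lambda>B. B $ j $ i"] by (simp add: transpose_def)
  show "v \<bullet> (g c x *v v) > 0" if "x \<in> W" "v \<noteq> 0" for x v
    using m(2) that by blast
  show "chart_Ck c W k (\<lambda>z. g c z $ i $ j)" for i j k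
    using metric assms unfolding riemannian_metric_def chart_Ck_def Cinf_on_def o_def
    by (meson Ck_on_subset image_mono)
qed (use assms is_chart in auto)

lemma overlap:
  assumes "c \<in> A" "d \<in> A" "open W" "W \<subseteq> fst c \<inter> fst d"
  shows "patch_overlap c d W g"
proof -
  interpret cp: metric_patch c W g using assms by (intro patch) auto
  interpret dp: metric_patch d W g using assms by (intro patch) auto
  show ?thesis
  proof unfold_locales
    show "chart_Ck c W k (\<lambda>z. snd d z $ a)" for k a
      using atlas assms unfolding smooth_atlas_def chart_Ck_def Cinf_on_def o_def
      by (meson Ck_on_subset image_mono)
    show "g c x $ i $ j = (\<Sum>a\<in>UNIV. \<Sum>b\<in>UNIV. pd c i (\<lambda>z. snd d z $ a) x * pd c j (\<lambda>z. snd d z $ b) x * g d x $ a $ b)"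
      if "x \<in> W" for x i j
      using metric assms that unfolding riemannian_metric_def by blast
  qed
qed

text \<open>Both expressions live on the overlap of \<open>c\<close> with the chart picked at
  \<open>x\<close>. As \<open>c\<close> stays fixed while \<open>x\<close> varies, this gives access
  to the derivatives of the invariant scalar.\<close>

lemma grad_inner_chart:
  assumes u: "Ck_fun A 1 V u" and v: "Ck_fun A 1 V v" and V: "open V" "x \<in> V" and c: "c \<in> A" "x \<in> fst c"
  shows "grad_inner A g u v x = chart_inner g c u v x"
proof -
  let ?d = "chart_at A x" and ?W = "fst c \<inter> fst (chart_at A x) \<inter> V"
  have W: "open ?W" using V(1) open_chart[OF c(1)] open_chart[OF chart_at(1)] by (intro open_Int)
  interpret patch_overlap c ?d ?W g by (rule overlap) (use c chart_at W in auto)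
  have x: "x \<in> ?W" using V c chart_at by auto
  have "chart_Ck ?d ?W 1 u" "chart_Ck ?d ?W 1 v" using u v chart_at by (auto intro!: Ck_fun_chart simp del: One_nat_def)
  then have "chart_inner g c u v x = chart_inner g ?d u v x" using x by (intro chart_inner_transition)
  then show ?thesis using dp.chart_inner_eq(1)[OF x] by (simp add: grad_inner_def Let_def)
qed

lemma laplacian_chart:
  assumes u: "Ck_fun A 2 V u" and V: "open V" "x \<in> V" and c: "c \<in> A" "x \<in> fst c"
  shows "laplacian A g u x = chart_laplacian g c u x"
proof -
  let ?d = "chart_at A x" and ?W = "fst c \<inter> fst (chart_at A x) \<inter> V"
  have W: "open ?W" using V(1) open_chart[OF c(1)] open_chart[OF chart_at(1)] by (intro open_Int)
  interpret patch_overlap c ?d ?W g by (rule overlap) (use c chart_at W in auto)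
  have "chart_Ck ?d ?W 2 u" using u chart_at by (auto intro!: Ck_fun_chart)
  then show ?thesis
    using chart_laplacian_transition[of u x] V c chart_at by (simp add: laplacian_eq_chart)
qed

lemma weighted_laplacian_chart:
  assumes "Ck_fun A 2 V u" "Ck_fun A 1 V f" "open V" "x \<in> V" "c \<in> A" "x \<in> fst c"
  shows "weighted_laplacian A g f u x = chart_wlaplacian g c f u x"
proof -
  have "Ck_fun A 1 V u" using assms(1) by (rule Ck_fun_mono) simp
  then show ?thesis
    using assms laplacian_chart[of V u x c] grad_inner_chart[of V f u x c]
    by (simp add: weighted_laplacian_def chart_wlaplacian_def)
qed

text \<open>A bump function on the chart image is carried back by the chart and continued by zero.
  In another chart it is smooth on the overlap by the transition map, and elsewhere because the
  compact set \<open>K\<close> is closed in a Hausdorff space.\<close>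

lemma test_function:
  assumes c: "c \<in> A" and V: "open V" "V \<subseteq> fst c" "x0 \<in> V"
  obtains \<phi> K where "smooth_fun A UNIV \<phi>" "compact K" "K \<subseteq> V" "\<And>x. x \<notin> K \<Longrightarrow> \<phi> x = 0"
    "\<And>x. \<phi> x \<ge> 0" "\<phi> x0 > 0"
proof -
  interpret metric_patch c V g using c V by (intro patch)
  obtain r where r: "r > 0" "cball (snd c x0) r \<subseteq> snd c ` V"
    using open_U V(3) open_contains_cball by blast
  obtain b where b: "\<And>k. Ck_on k UNIV b" "\<And>y. b y \<ge> 0" "b (snd c x0) > 0"
    "\<And>y. y \<notin> cball (snd c x0) r \<Longrightarrow> b y = 0"
    using bump_function[OF r(1)] by metis
  define K where "K = chart_inv c ` cball (snd c x0) r"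
  define \<phi> where "\<phi> x = (if x \<in> fst c then b (snd c x) else 0)" for x
  have "continuous_on (cball (snd c x0) r) (chart_inv c)"
    using chart r(2) V(2) unfolding is_chart_def homeomorphism_def
    by (meson continuous_on_subset image_mono order_trans)
  then have K: "compact K" unfolding K_def by (intro compact_continuous_image) auto
  have KV: "K \<subseteq> V"
  proof
    fix x assume "x \<in> K"
    then obtain y where "y \<in> cball (snd c x0) r" "x = chart_inv c y" by (auto simp: K_def)
    then show "x \<in> V" using r(2) chart_inv_W by auto
  qed
  have \<phi>0: "\<phi> x = 0" if "x \<notin> K" for x
  proof (cases "x \<in> fst c")
    case True
    then have "snd c x \<notin> cball (snd c x0) r"
      using that chart_inv_left unfolding K_def by (metis imageI)
    then show ?thesis using b(4) by (simp add: \<phi>_def)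
  qed (simp add: \<phi>_def)
  have "smooth_fun A UNIV \<phi>"
    unfolding smooth_fun_def Ck_fun_def
  proof (intro allI ballI)
    fix k d assume d: "d \<in> A"
    interpret dd: metric_patch d "fst d" g using d by (intro patch open_chart) auto
    show "Ck_on k (snd d ` (fst d \<inter> UNIV)) (\<phi> \<circ> chart_inv d)"
    proof (rule Ck_on_local)
      fix y assume "y \<in> snd d ` (fst d \<inter> UNIV)"
      then obtain z where z: "z \<in> fst d" "y = snd d z" by auto
      show "\<exists>T. open T \<and> y \<in> T \<and> Ck_on k T (\<phi> \<circ> chart_inv d)"
      proof (cases "z \<in> fst c")
        case True
        let ?W = "fst d \<inter> fst c"
        have W: "open ?W" using open_chart[OF c] open_chart[OF d] by (rule open_Int[rotated])
        interpret o: patch_overlap d c ?W g by (rule overlap) (use c d W in auto)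
        have "Ck_on k (snd c ` ?W) (\<phi> \<circ> chart_inv c)"
          by (rule Ck_on_cong[OF Ck_on_subset[OF b(1)] o.dp.open_U]) (auto simp: \<phi>_def o.dp.chart_inv_W)
        then have "Ck_on k (snd d ` ?W) (\<phi> \<circ> chart_inv d)"
          using o.C_transfer[of k \<phi>] by (simp add: chart_Ck_def)
        then show ?thesis using o.cp.open_U z True by blast
      next
        case False
        let ?T = "snd d ` (fst d - K)"
        have "open ?T" using open_chart[OF d] compact_imp_closed[OF K] by (intro dd.open_image) auto
        moreover have "y \<in> ?T" using z False KV V by auto
        moreover have "Ck_on k ?T (\<phi> \<circ> chart_inv d)"
          by (rule Ck_on_cong[OF Ck_on_const[of _ _ 0] \<open>open ?T\<close>]) (auto simp: \<phi>0 dd.chart_inv_W)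
        ultimately show ?thesis by blast
      qed
    qed
  qed
  moreover have "\<phi> x0 > 0" using b(3) V by (auto simp: \<phi>_def)
  moreover have "\<phi> x \<ge> 0" for x using b(2) by (simp add: \<phi>_def)
  ultimately show ?thesis using that K KV \<phi>0 by blast
qed

text \<open>If the equation failed at \<open>x0\<close>, a bump function supported where the defect
  \<open>E = \<Delta>\<^sub>f G - \<mu> G\<close> has constant sign would contradict Green's identity.\<close>

lemma green_function_pde:
  assumes vol: "riemannian_volume A g dV" and f: "smooth_fun A UNIV f"
    and G: "green_function A g dV f m k \<kappa> p G" and c: "c \<in> A" and x0: "x0 \<in> fst c" "x0 \<noteq> p"
  shows "chart_wlaplacian g c f G x0 = m * (m - 2) * k / 4 * G x0"
proof (rule ccontr)
  assume ne: "chart_wlaplacian g c f G x0 \<noteq> m * (m - 2) * k / 4 * G x0"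
  define \<mu> where "\<mu> = m * (m - 2) * k / 4"
  define E where "E z = chart_wlaplacian g c f G z - \<mu> * G z" for z
  define W where "W = fst c - {p}"
  have W: "open W" "W \<subseteq> fst c" "x0 \<in> W" using open_chart[OF c] x0 by (auto simp: W_def)
  interpret metric_patch c W g using c W by (intro patch)
  have CG: "C j G" for j
    using G c by (intro Ck_fun_chart[of j "- {p}"]) (auto simp: green_function_def smooth_fun_def W_def)
  have Cf: "C j f" for j
    using f c W by (intro Ck_fun_chart[of j UNIV]) (auto simp: smooth_fun_def)
  have CE: "C j E" for j
    unfolding E_def by (intro C_diff C_cmult C_chart_wlaplacian CG Cf)
  \<comment> \<open>The factor \<open>E x0\<close> treats both signs of the defect at once.\<close>
  define V where "V = W \<inter> (\<lambda>z. E z * E x0) -` {0<..}"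
  have V: "open V" "V \<subseteq> fst c" "x0 \<in> V"
  proof -
    have "continuous_on W (\<lambda>z. E z * E x0)"
      using C_continuous[OF CE[of 0]] by (intro continuous_intros)
    then show "open V" unfolding V_def using W(1) by (rule continuous_open_preimage) auto
    show "x0 \<in> V" using ne W(3) by (auto simp: V_def E_def \<mu>_def zero_less_mult_iff linorder_neq_iff)
  qed (use W in \<open>auto simp: V_def\<close>)
  obtain \<phi> K where \<phi>: "smooth_fun A UNIV \<phi>" and K: "compact K" "K \<subseteq> V" and \<phi>0: "\<And>x. x \<notin> K \<Longrightarrow> \<phi> x = 0"
    and \<phi>nn: "\<And>x. \<phi> x \<ge> 0" and \<phi>pos: "\<phi> x0 > 0"
    using test_function[OF c V] by metis
  have KW: "K \<subseteq> W" using K by (auto simp: V_def)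
  have C\<phi>: "C j \<phi>" for j
    using \<phi> c W by (intro Ck_fun_chart[of j UNIV]) (auto simp: smooth_fun_def)
  define H where "H x = G x * (- weighted_laplacian A g f \<phi> x + \<mu> * \<phi> x) * exp (- f x)" for x
  have wl: "weighted_laplacian A g f \<phi> x = chart_wlaplacian g d f \<phi> x" if "d \<in> A" "x \<in> fst d" for d x
    by (rule weighted_laplacian_chart[of UNIV]) (use that \<phi> f in \<open>auto simp: smooth_fun_def\<close>)
  have HW: "H z = G z * (- chart_wlaplacian g c f \<phi> z + \<mu> * \<phi> z) * exp (- f z)" if "z \<in> W" for z
    unfolding H_def using wl[of c z] that W(2) c by auto
  have clK: "closed K" using K(1) by (rule compact_imp_closed)
  \<comment> \<open>Off \<open>K\<close> the test function vanishes in a neighbourhood; removing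
    \<open>K\<close> from the chart picked at \<open>x\<close> gives an open patch on which it is
    zero.\<close>
  have H0: "H x = 0" if "x \<notin> K" for x
  proof -
    let ?d = "chart_at A x"
    interpret d: metric_patch ?d "fst ?d - K" g
      using open_chart[OF chart_at(1)] clK by (intro patch chart_at open_Diff) auto
    have "chart_wlaplacian g ?d f \<phi> x = 0"
      by (rule d.chart_wlaplacian_zero) (use that chart_at \<phi>0 in auto)
    then show ?thesis using wl[OF chart_at] \<phi>0[OF that] by (simp add: H_def)
  qed
  have "has_bochner_integral dV H (\<kappa> * \<phi> p)"
    using G \<phi> unfolding green_function_def H_def \<mu>_def by blast
  \<comment> \<open>The pole lies outside the support, so the right-hand side
    \<open>\<kappa> * \<phi> p\<close> of the distributional equation is zero.\<close>
  moreover have "p \<notin> K" using KW by (auto simp: W_def)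
  ultimately have intH: "integral\<^sup>L dV H = 0"
    using \<phi>0 by (simp add: has_bochner_integral_iff)
  \<comment> \<open>\<open>Z\<close> is the field of Green's identity and \<open>e\<close> the
    defect tested against \<open>\<phi>\<close>, both including the density; \<open>F\<close> and
    \<open>h\<close> are their extensions by zero to the whole coordinate space.\<close>
  define Z where "Z i z = vol_density g c z * exp (- f z) * (\<phi> z * X G z i - G z * X \<phi> z i)" for i z
  define F where "F i y = (if y \<in> snd c ` W then Z i (chart_inv c y) else 0)" for i y
  define e where "e z = vol_density g c z * exp (- f z) * \<phi> z * E z" for z
  define h where "h y = (if y \<in> snd c ` W then e (chart_inv c y) else 0)" for y
  define H' where "H' y = (if y \<in> snd c ` W then H (chart_inv c y) else 0)" for y
  have CZ: "C j (Z i)" for i j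
    unfolding Z_def by (intro C_mult C_diff C_vol_density C_exp C_minus Cf C\<phi> C_grad CG)
  have Ce: "C j e" for j
    unfolding e_def by (intro C_mult C_vol_density C_exp C_minus Cf C\<phi> CE)
  have CH: "C j H" for j
  proof (rule C_cong)
    show "C j (\<lambda>z. G z * (- chart_wlaplacian g c f \<phi> z + \<mu> * \<phi> z) * exp (- f z))"
      by (intro C_mult C_add C_minus C_cmult C_exp C_chart_wlaplacian CG Cf C\<phi>)
  qed (simp add: HW)
  have Z0: "Z i z = 0" if "z \<in> W" "z \<notin> K" for i z
  proof -
    interpret d: metric_patch c "W - K" g using c W clK by (intro patch) auto
    have "grad g c \<phi> z = 0" by (rule d.grad_zero) (use that \<phi>0 in auto)
    then show ?thesis using \<phi>0[OF that(2)] by (simp add: Z_def)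
  qed
  have e0: "e z = 0" if "z \<in> W" "z \<notin> K" for z
    using \<phi>0[OF that(2)] by (simp add: e_def)
  have CF: "Ck_on 1 UNIV (F i)" for i
    unfolding F_def[abs_def] by (rule C_extension(1)[OF CZ K(1) KW Z0])
  have Ch: "continuous_on UNIV h"
    unfolding h_def[abs_def] by (rule Ck_on_continuous[of 0], rule C_extension(1)[OF Ce K(1) KW e0])
  have CH': "continuous_on UNIV H'"
    unfolding H'_def[abs_def] by (rule Ck_on_continuous[of 0], rule C_extension(1)[OF CH K(1) KW H0])
  have cK: "compact (snd c ` K)"
    by (rule C_extension(2)[OF Ce[of 0] K(1) KW e0])
  have F0: "F i y = 0" and h0: "h y = 0" if "y \<notin> snd c ` K" for i y
    unfolding F_def h_def
    by (rule C_extension(3)[OF CZ[of 0] K(1) KW Z0 that], assumption+)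
      (rule C_extension(3)[OF Ce[of 0] K(1) KW e0 that], assumption+)
  have dF0: "partial_deriv i (F i) y = 0" if "y \<notin> snd c ` K" for i y
    by (rule partial_deriv_zero[OF compact_imp_closed[OF cK] F0 that])
  have intF: "integrable lborel (partial_deriv i (F i))" for i
    by (rule compact_support_integrable[OF _ cK dF0]) (use CF in simp)
  have inth: "integrable lborel h"
    by (rule compact_support_integrable[OF Ch cK h0])
  have "0 = integral\<^sup>L lborel (\<lambda>y. indicator (snd c ` fst c) y * sqrt (det (g c (chart_inv c y))) * H' y)"
  proof (subst integral_riemannian_volume[OF vol c is_chart[OF c], symmetric])
    interpret cc: metric_patch c "fst c" g using c by (intro patch open_chart) auto
    show "H' \<in> borel_measurable borel" using CH' by (rule borel_measurable_continuous_onI)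
    show "continuous_on (snd c ` fst c) (\<lambda>y. det (g c (chart_inv c y)))"
      using cc.C_det[OF cc.C_metric, of 0] by (simp add: chart_Ck_def o_def)
    show "det (g c x) \<ge> 0" if "x \<in> fst c" for x using cc.det_metric_pos[OF that] by simp
    show "H x = H' (snd c x)" if "x \<in> fst c" for x
    proof (cases "x \<in> W")
      case True
      then show ?thesis by (simp add: H'_def chart_inv_W)
    next
      case False
      then have "snd c x \<notin> snd c ` W" using cc.chart_inj that W(2) by (meson image_iff inj_on_image_mem_iff)
      then show ?thesis using False H0 KW by (auto simp: H'_def)
    qed
    show "H x = 0" if "x \<notin> fst c" for x using that H0 KW W by auto
    show "0 = integral\<^sup>L dV H" using intH by simp
  qed
  \<comment> \<open>Green's identity moves the operator from \<open>\<phi>\<close> to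
    \<open>G\<close>: the difference is a sum of partial derivatives with vanishing integrals, and
    only the defect tested against \<open>\<phi>\<close> is left.\<close>
  also have "\<dots> = integral\<^sup>L lborel (\<lambda>y. (\<Sum>i\<in>UNIV. partial_deriv i (F i) y) - h y)"
  proof (rule Bochner_Integration.integral_cong[OF refl])
    fix y
    show "indicator (snd c ` fst c) y * sqrt (det (g c (chart_inv c y))) * H' y
        = (\<Sum>i\<in>UNIV. partial_deriv i (F i) y) - h y"
    proof (cases "y \<in> snd c ` W")
      case True
      then obtain z where z: "z \<in> W" "y = snd c z" by auto
      have "(\<Sum>i\<in>UNIV. partial_deriv i (F i) y) = (\<Sum>i\<in>UNIV. pd c i (Z i) z)"
        unfolding z(2) by (intro sum.cong refl pd_eq_partial_deriv[symmetric] z) (simp add: F_def chart_inv_W)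
      also have "\<dots> = vol_density g c z * exp (- f z) * (\<phi> z * chart_wlaplacian g c f G z - G z * chart_wlaplacian g c f \<phi> z)"
        unfolding Z_def using green_identity[OF Cf C\<phi> CG z(1)] by simp
      finally have "(\<Sum>i\<in>UNIV. partial_deriv i (F i) y) - h y = vol_density g c z * H z"
        using z by (simp add: h_def chart_inv_W e_def E_def HW algebra_simps)
      then show ?thesis using z W by (auto simp: H'_def chart_inv_W vol_density_def indicator_def)
    next
      case False
      then have "y \<notin> snd c ` K" using KW by auto
      then have "partial_deriv i (F i) y = 0" for i by (rule dF0)
      then show ?thesis using False by (simp add: H'_def h_def)
    qed
  qed
  also have "\<dots> = - integral\<^sup>L lborel h"
    using intF inth integral_partial_deriv_zero[OF CF cK F0] by simp
  finally have int0: "integral\<^sup>L lborel (\<lambda>y. h y * E x0) = 0" by simp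
  have "h (snd c x0) * E x0 = 0"
  proof (rule integral_zero_imp_zero[OF _ cK _ _ int0])
    show "continuous_on UNIV (\<lambda>y. h y * E x0)"
      using Ch by (intro continuous_intros)
    show "h y * E x0 = 0" if "y \<notin> snd c ` K" for y using h0[OF that] by simp
    show "h y * E x0 \<ge> 0" for y
    proof (cases "y \<in> snd c ` K")
      case True
      then obtain z where z: "z \<in> K" "y = snd c z" by auto
      then have zW: "z \<in> W" and "E z * E x0 > 0" using K KW by (auto simp: V_def)
      moreover have "h y * E x0 = vol_density g c z * exp (- f z) * \<phi> z * (E z * E x0)"
        using z(2) zW by (simp add: h_def e_def chart_inv_W)
      moreover have "vol_density g c z * exp (- f z) * \<phi> z * (E z * E x0) \<ge> 0"
        using vol_density_pos[OF zW] \<phi>nn[of z] \<open>E z * E x0 > 0\<close>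
        by (intro mult_nonneg_nonneg[of "_ * _ * _"] mult_nonneg_nonneg[of "_ * _" "\<phi> z"]) simp_all
      ultimately show ?thesis by presburger
    qed (use h0 in simp)
  qed
  moreover have "h (snd c x0) * E x0 = vol_density g c x0 * exp (- f x0) * \<phi> x0 * (E x0 * E x0)"
    using W by (simp add: h_def e_def chart_inv_W)
  moreover have "E x0 \<noteq> 0" using ne by (simp add: E_def \<mu>_def)
  ultimately show False using vol_density_pos[OF W(3)] \<phi>pos by simp
qed

end

section \<open>The identity for \<open>4 |\<nabla>s|\<^sup>2 + k s\<^sup>2\<close>\<close>

context metric_patch
begin

lemma grad_mult:
  "C 1 u \<Longrightarrow> C 1 v \<Longrightarrow> x \<in> W \<Longrightarrow> grad g c (\<lambda>z. u z * v z) x = u x *\<^sub>R grad g c v x + v x *\<^sub>R grad g c u x"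
  by (simp add: vec_eq_iff grad_def pd_mult distrib_left sum.distrib sum_distrib_left mult_ac del: One_nat_def)

lemma grad_real:
  "C 1 u \<Longrightarrow> x \<in> W \<Longrightarrow> (F has_real_derivative D) (at (u x)) \<Longrightarrow> grad g c (\<lambda>z. F (u z)) x = D *\<^sub>R grad g c u x"
  by (simp add: vec_eq_iff grad_def pd_real sum_distrib_left mult_ac del: One_nat_def)

lemma chart_inner_mult:
  "C 1 u \<Longrightarrow> C 1 v \<Longrightarrow> x \<in> W \<Longrightarrow>
    chart_inner g c w (\<lambda>z. u z * v z) x = u x * chart_inner g c w v x + v x * chart_inner g c w u x"
  by (simp add: chart_inner_def grad_mult distrib_left sum.distrib sum_distrib_left mult_ac del: One_nat_def)

lemma chart_inner_real:
  "C 1 u \<Longrightarrow> x \<in> W \<Longrightarrow> (F has_real_derivative D) (at (u x)) \<Longrightarrow>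
    chart_inner g c w (\<lambda>z. F (u z)) x = D * chart_inner g c w u x"
  by (simp add: chart_inner_def grad_real sum_distrib_left mult_ac del: One_nat_def)

lemma chart_inner_add:
  "C 1 u \<Longrightarrow> C 1 v \<Longrightarrow> x \<in> W \<Longrightarrow>
    chart_inner g c w (\<lambda>z. u z + v z) x = chart_inner g c w u x + chart_inner g c w v x"
  by (simp add: chart_inner_def grad_def pd_add distrib_left sum.distrib del: One_nat_def)

lemma chart_inner_cmult:
  "C 1 u \<Longrightarrow> x \<in> W \<Longrightarrow> chart_inner g c w (\<lambda>z. a * u z) x = a * chart_inner g c w u x"
  using chart_inner_mult[OF C_const[of 1 a], of u x w] by (simp add: chart_inner_def[of g c w "\<lambda>_. a"] grad_def)

lemma chart_laplacian_real:
  assumes u: "C 2 u" and x: "x \<in> W"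
    and F: "\<And>z. z \<in> W \<Longrightarrow> (F has_real_derivative F' (u z)) (at (u z))" "(F' has_real_derivative F'') (at (u x))"
    and CF: "C 1 (\<lambda>z. F' (u z))"
  shows "chart_laplacian g c (\<lambda>z. F (u z)) x = F' (u x) * chart_laplacian g c u x + F'' * chart_inner g c u u x"
proof -
  have u1: "C 1 u" using u by (rule C_mono) simp
  have CX: "C 1 (\<lambda>z. X u z i)" for i using u by (auto intro!: C_grad simp: numeral_2_eq_2)
  have "chart_laplacian g c (\<lambda>z. F (u z)) x = chart_div g c (\<lambda>z. F' (u z) *\<^sub>R grad g c u z) x"
    unfolding chart_laplacian_def by (rule chart_div_cong[OF grad_real[OF u1] x]) (use F in auto)
  also have "\<dots> = F' (u x) * chart_laplacian g c u x + (\<Sum>i\<in>UNIV. F'' * pd c i u x * X u x i)"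
    unfolding chart_div_scale[OF CF CX x] chart_laplacian_def by (simp add: pd_real[OF u1 x F(2)])
  finally show ?thesis by (simp add: chart_inner_def sum_distrib_left mult.assoc)
qed

lemma chart_laplacian_mult:
  assumes u: "C 2 u" and v: "C 2 v" and x: "x \<in> W"
  shows "chart_laplacian g c (\<lambda>z. u z * v z) x
    = u x * chart_laplacian g c v x + v x * chart_laplacian g c u x + 2 * chart_inner g c u v x"
proof -
  have C1: "C 1 u" "C 1 v" using u v by (auto intro: C_mono)
  have CX: "C 1 (\<lambda>z. X u z i)" "C 1 (\<lambda>z. X v z i)" for i
    using u v by (auto intro!: C_grad simp: numeral_2_eq_2)
  have "chart_laplacian g c (\<lambda>z. u z * v z) x = chart_div g c (\<lambda>z. u z *\<^sub>R grad g c v z + v z *\<^sub>R grad g c u z) x"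
    unfolding chart_laplacian_def by (rule chart_div_cong[OF grad_mult[OF C1] x])
  also have "\<dots> = chart_div g c (\<lambda>z. u z *\<^sub>R grad g c v z) x + chart_div g c (\<lambda>z. v z *\<^sub>R grad g c u z) x"
    using C1 CX x by (intro chart_div_add) (auto intro!: C_mult simp del: One_nat_def)
  also have "\<dots> = u x * chart_laplacian g c v x + chart_inner g c u v x
      + (v x * chart_laplacian g c u x + chart_inner g c v u x)"
    using C1 CX x by (simp add: chart_div_scale chart_laplacian_def chart_inner_def del: One_nat_def)
  finally show ?thesis using chart_inner_eq(2)[OF x, of u v] by simp
qed

lemma chart_wlaplacian_mult:
  assumes u: "C 2 u" and v: "C 2 v" and x: "x \<in> W"
  shows "chart_wlaplacian g c f (\<lambda>z. u z * v z) x
    = u x * chart_wlaplacian g c f v x + v x * chart_wlaplacian g c f u x + 2 * chart_inner g c u v x"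
proof -
  have "C 1 u" "C 1 v" using u v by (auto intro: C_mono)
  then show ?thesis
    using assms by (simp add: chart_wlaplacian_def chart_laplacian_mult chart_inner_mult algebra_simps del: One_nat_def)
qed

lemma chart_wlaplacian_cmult:
  assumes u: "C 2 u" and x: "x \<in> W"
  shows "chart_wlaplacian g c f (\<lambda>z. a * u z) x = a * chart_wlaplacian g c f u x"
  using chart_wlaplacian_mult[OF C_const[of 2 a] u x, of f]
  by (simp add: chart_wlaplacian_def chart_laplacian_def chart_div_def grad_def chart_inner_def)

lemma chart_wlaplacian_diff:
  assumes u: "C 2 u" and v: "C 2 v" and x: "x \<in> W"
  shows "chart_wlaplacian g c f (\<lambda>z. u z - v z) x = chart_wlaplacian g c f u x - chart_wlaplacian g c f v x"
proof -
  have C1: "C 1 u" "C 1 v" using u v by (auto intro: C_mono)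
  have CX: "C 1 (\<lambda>z. X u z i)" "C 1 (\<lambda>z. X v z i)" for i
    using u v by (auto intro!: C_grad simp: numeral_2_eq_2)
  have gd: "grad g c (\<lambda>z. u z - v z) z = grad g c u z - grad g c v z" if "z \<in> W" for z
    using C1 that by (simp add: vec_eq_iff grad_def pd_diff right_diff_distrib sum_subtractf del: One_nat_def)
  have "chart_laplacian g c (\<lambda>z. u z - v z) x = chart_div g c (\<lambda>z. grad g c u z - grad g c v z) x"
    unfolding chart_laplacian_def by (rule chart_div_cong[OF gd x])
  also have "\<dots> = chart_laplacian g c u x - chart_laplacian g c v x"
    unfolding chart_laplacian_def by (rule chart_div_diff[OF CX x])
  finally have "chart_laplacian g c (\<lambda>z. u z - v z) x = chart_laplacian g c u x - chart_laplacian g c v x" .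
  then show ?thesis
    by (simp add: chart_wlaplacian_def chart_inner_def gd[OF x] right_diff_distrib sum_subtractf)
qed

text \<open>The derivative of <grad f, grad u> along grad u contains Hess u (grad u, grad f), which
  cancels against the drift applied to |grad u|^2. What remains is Hess f (grad u, grad u), and it
  joins the Ricci tensor.\<close>

lemma weighted_bochner:
  assumes f: "C 2 f" and u: "C 3 u" and x: "x \<in> W"
  shows "chart_wlaplacian g c f (chart_inner g c u u) x
    = 2 * (tensor_norm2 g c x (hess g c u x) + chart_inner g c u (chart_wlaplacian g c f u) x
        + grad g c u x \<bullet> ((ricci g c x + hess g c f x) *v grad g c u x))"
proof -
  let ?B = "\<lambda>h a b. \<Sum>i\<in>UNIV. \<Sum>j\<in>UNIV. hess g c h x $ i $ j * X a x i * X b x j"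
  have u2: "C 2 u" using u by (rule C_mono) simp
  have Cl: "C 1 (chart_laplacian g c u)" by (rule C_chart_laplacian) (use u in \<open>simp add: numeral_3_eq_3\<close>)
  have Ci: "C 1 (chart_inner g c f u)" by (rule C_chart_inner) (use f u2 in \<open>simp_all add: numeral_2_eq_2\<close>)
  have "chart_inner g c u (chart_wlaplacian g c f u) x
      = chart_inner g c u (chart_laplacian g c u) x + chart_inner g c u (\<lambda>z. (-1) * chart_inner g c f u z) x"
    unfolding chart_wlaplacian_def[abs_def]
    using chart_inner_add[OF Cl C_cmult[OF Ci, of "-1"] x, of u] by simp
  also have "\<dots> = chart_inner g c (chart_laplacian g c u) u x - chart_inner g c u (chart_inner g c f u) x"
    unfolding chart_inner_cmult[OF Ci x] using chart_inner_eq(2)[OF x, of u "chart_laplacian g c u"] by simp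
  also have "chart_inner g c u (chart_inner g c f u) x = ?B f u u + ?B u u f"
    by (rule chart_inner_chart_inner[OF f u2 x])
  finally have 1: "chart_inner g c u (chart_wlaplacian g c f u) x
      = chart_inner g c (chart_laplacian g c u) u x - ?B f u u - ?B u u f" by simp
  have 2: "chart_inner g c f (chart_inner g c u u) x = 2 * ?B u u f"
  proof -
    have "?B u f u = ?B u u f"
      by (subst sum.swap) (simp add: hess_sym[OF u2 x, of k for k] mult_ac)
    then show ?thesis using chart_inner_chart_inner[OF u2 u2 x, of f] by simp
  qed
  have 3: "grad g c u x \<bullet> (hess g c f x *v grad g c u x) = ?B f u u"
    by (simp add: inner_vec_def matrix_vector_mult_def sum_distrib_left mult_ac)
  show ?thesis
    unfolding chart_wlaplacian_def[of g c f "chart_inner g c u u"] bochner[OF u x] 1 2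
      matrix_vector_mult_add_rdistrib inner_add_right 3 by simp
qed

text \<open>The pairing of a tensor with the metric is its trace, and |g|^2 = n. When
  \<open>a\<close> is the trace over n, the correction is minus the squared trace over n.\<close>

lemma tensor_norm2_traceless:
  assumes x: "x \<in> W"
  shows "tensor_norm2 g c x (T - a *\<^sub>R g c x)
    = tensor_norm2 g c x T - 2 * a * (\<Sum>i\<in>UNIV. \<Sum>j\<in>UNIV. ginv g c x $ i $ j * T $ i $ j) + a\<^sup>2 * CARD('n)"
proof -
  let ?I = "ginv g c x" and ?g = "g c x"
  let ?B = "\<lambda>S T :: real^'n^'n. \<Sum>i\<in>UNIV. \<Sum>j\<in>UNIV. \<Sum>p\<in>UNIV. \<Sum>q\<in>UNIV. ?I $ i $ p * ?I $ j $ q * S $ i $ j * T $ p $ q"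
  have tr: "?B S ?g = (\<Sum>i\<in>UNIV. \<Sum>j\<in>UNIV. ?I $ i $ j * S $ i $ j)" for S
  proof (intro sum.cong refl)
    fix i j
    have "(\<Sum>p\<in>UNIV. \<Sum>q\<in>UNIV. ?I $ i $ p * ?I $ j $ q * S $ i $ j * ?g $ p $ q)
        = S $ i $ j * (\<Sum>p\<in>UNIV. ?I $ i $ p * (\<Sum>q\<in>UNIV. ?I $ j $ q * ?g $ q $ p))"
      by (simp add: sum_distrib_left mult_ac metric_sym[OF x, of _ q for q])
    also have "\<dots> = S $ i $ j * ?I $ i $ j"
      by (simp add: sum_metric_ginv(2)[OF x] if_distrib[of "\<lambda>t. _ * t"] cong: if_cong)
    finally show "(\<Sum>p\<in>UNIV. \<Sum>q\<in>UNIV. ?I $ i $ p * ?I $ j $ q * S $ i $ j * ?g $ p $ q) = ?I $ i $ j * S $ i $ j"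
      by simp
  qed
  have sym: "?B ?g T = ?B T ?g"
    by (subst sum_swap4) (simp add: ginv_sym[OF x, of _ q for q] mult_ac)
  have "(\<Sum>i\<in>UNIV. \<Sum>j\<in>UNIV. ?I $ i $ j * ?g $ i $ j) = (\<Sum>i\<in>UNIV. \<Sum>j\<in>UNIV. ?I $ i $ j * ?g $ j $ i)"
    by (intro sum.cong refl) (metis metric_sym[OF x])
  then have tg: "(\<Sum>i\<in>UNIV. \<Sum>j\<in>UNIV. ?I $ i $ j * ?g $ i $ j) = CARD('n)"
    by (simp add: sum_metric_ginv(2)[OF x])
  have "tensor_norm2 g c x (T - a *\<^sub>R ?g) = ?B T T - a * ?B T ?g - a * ?B ?g T + a * a * ?B ?g ?g"
    unfolding tensor_norm2_def sum_distrib_left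
    by (simp add: sum.distrib[symmetric] sum_subtractf[symmetric] algebra_simps)
  then show ?thesis unfolding sym tr tg by (simp add: tensor_norm2_def power2_eq_square)
qed

end

section \<open>Differential identities for s^2 as a power of the Green function\<close>

lemma DERIV_cmult_powr:
  "t > 0 \<Longrightarrow> ((\<lambda>t. a * t powr b) has_real_derivative a * (b * t powr (b - 1))) (at t)" for t a b :: real
  by (auto intro!: derivative_eq_intros)

context metric_patch
begin

context
  fixes f G s :: "'a \<Rightarrow> real" and m :: real
  assumes Cf: "\<And>j. C j f" and CG: "\<And>j. C j G" and G_pos: "\<And>z. z \<in> W \<Longrightarrow> G z > 0"
    and m: "m > 2" and s: "\<And>z. z \<in> W \<Longrightarrow> s z = 1/2 * G z powr (1 / (2 - m))"
begin

abbreviation (input) v where "v \<equiv> \<lambda>z. (s z)\<^sup>2"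

lemma s_pos: "z \<in> W \<Longrightarrow> s z > 0"
  using G_pos[of z] by (simp only: s) simp

lemma C_s: "C j s"
  by (rule C_cong[OF C_cmult[OF C_powr[OF CG G_pos]] s[symmetric]])

lemma v_eq: "z \<in> W \<Longrightarrow> v z = 1/4 * G z powr (2 / (2 - m))"
  using powr_add[of "G z" "1 / (2 - m)" "1 / (2 - m)"] by (simp add: s power2_eq_square)

text \<open>s^2 is a constant multiple of a power of \<open>G\<close>, so its logarithmic
  differential is 2 / (2 - m) times that of \<open>G\<close>.\<close>

lemma chart_inner_v:
  assumes z: "z \<in> W"
  shows "chart_inner g c w v z = 2 / (2 - m) * (v z / G z) * chart_inner g c w G z"
proof -
  let ?b = "2 / (2 - m)"
  have "chart_inner g c w v z = chart_inner g c w (\<lambda>z. 1/4 * G z powr ?b) z"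
    using v_eq z by (intro chart_inner_cong)
  also have "\<dots> = 1/4 * (?b * G z powr (?b - 1)) * chart_inner g c w G z"
    by (rule chart_inner_real[OF CG z DERIV_cmult_powr[OF G_pos[OF z]]])
  finally show ?thesis
    using G_pos[OF z] by (simp add: v_eq[OF z] powr_diff)
qed

text \<open>The factor 2 - m cancels the exponent in the logarithmic differential of s^2.\<close>

lemma drift_ln:
  assumes z: "z \<in> W"
  shows "(2 - m) / (s z)\<^sup>2 * chart_inner g c v u z = 2 * chart_inner g c (\<lambda>z. ln (G z)) u z"
proof -
  have "(2 - m) / (s z)\<^sup>2 * chart_inner g c u v z = 2 / G z * chart_inner g c u G z"
    using s_pos[OF z] m by (simp add: chart_inner_v[OF z])
  moreover have "chart_inner g c u (\<lambda>z. ln (G z)) z = 1 / G z * chart_inner g c u G z"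
    by (rule chart_inner_real[OF CG z]) (use G_pos[OF z] in \<open>auto intro!: derivative_eq_intros\<close>)
  ultimately show ?thesis using chart_inner_eq(2)[OF z, of u] by simp
qed

text \<open>The weight exp (-f) G^2 has the logarithmic differential -df + 2 d ln G, which is the
  whole drift of the operator.\<close>

lemma weighted_div_drift:
  assumes u: "C 2 u" and z: "z \<in> W"
  shows "exp (f z) * chart_div g c (\<lambda>y. exp (- f y) *\<^sub>R ((G y)\<^sup>2 *\<^sub>R grad g c u y)) z
    = (G z)\<^sup>2 * (chart_wlaplacian g c f u z + 2 * chart_inner g c (\<lambda>z. ln (G z)) u z)"
proof -
  have CX: "C 1 (\<lambda>z. X u z i)" for i using u by (auto intro!: C_grad simp: numeral_2_eq_2)
  have pe: "pd c i (\<lambda>z. exp (- f z)) z = exp (- f z) * - pd c i f z" for i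
    using pd_real[OF C_minus[OF Cf] z, of exp "exp (- f z)" i] pd_minus[OF Cf z] by (simp add: DERIV_exp)
  have pG: "pd c i (\<lambda>z. (G z)\<^sup>2) z = 2 * G z * pd c i G z" for i
    using pd_mult[OF CG CG z] by (simp add: power2_eq_square)
  have CGX: "C 1 (\<lambda>y. ((G y)\<^sup>2 *\<^sub>R grad g c u y) $ i)" for i
    using C_mult[OF C_power2[OF CG] CX] by simp
  have 1: "chart_div g c (\<lambda>y. (G y)\<^sup>2 *\<^sub>R grad g c u y) z
      = (G z)\<^sup>2 * chart_laplacian g c u z + 2 * G z * chart_inner g c G u z"
    unfolding chart_div_scale[OF C_power2[OF CG] CX z] pG
    by (simp add: chart_laplacian_def chart_inner_def sum_distrib_left mult.assoc)
  have "chart_div g c (\<lambda>y. exp (- f y) *\<^sub>R ((G y)\<^sup>2 *\<^sub>R grad g c u y)) z = exp (- f z) *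
      ((G z)\<^sup>2 * chart_laplacian g c u z + 2 * G z * chart_inner g c G u z - (G z)\<^sup>2 * chart_inner g c f u z)"
    unfolding chart_div_scale[OF C_exp[OF C_minus[OF Cf]] CGX z] 1 pe
    by (simp add: chart_inner_def sum_negf sum_distrib_left algebra_simps)
  moreover have "exp (f z) * (exp (- f z) * t) = t" for t
    by (simp add: mult.assoc[symmetric] exp_add[symmetric])
  moreover have "chart_inner g c (\<lambda>z. ln (G z)) u z = 1 / G z * chart_inner g c G u z"
    unfolding chart_inner_eq(2)[OF z, of _ u]
    by (rule chart_inner_real[OF CG z]) (use G_pos[OF z] in \<open>auto intro!: derivative_eq_intros\<close>)
  moreover have "(G z)\<^sup>2 * (2 * (1 / G z * t)) = 2 * G z * t" for t
    using G_pos[OF z] by (simp add: power2_eq_square)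
  ultimately show ?thesis
    by (simp only: chart_wlaplacian_def distrib_left right_diff_distrib)
qed

lemma chart_inner_v_self: "z \<in> W \<Longrightarrow> chart_inner g c v v z = 4 * v z * chart_inner g c s s z"
proof -
  assume z: "z \<in> W"
  have "chart_inner g c w v z = 2 * s z * chart_inner g c w s z" for w
    using chart_inner_mult[OF C_s C_s z, of w] by (simp add: power2_eq_square)
  then have "chart_inner g c v v z = 2 * s z * (2 * s z * chart_inner g c s s z)"
    using chart_inner_eq(2)[OF z, of v s] by simp
  then show ?thesis by (simp add: power2_eq_square)
qed

lemma C_w: "C j (\<lambda>z. 4 * chart_inner g c s s z + k * v z)"
  by (intro C_add C_cmult C_chart_inner C_power2 C_s)

context
  fixes k :: real
  assumes pde: "\<And>z. z \<in> W \<Longrightarrow> chart_wlaplacian g c f G z = m * (m - 2) * k / 4 * G z"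
begin

lemma chart_wlaplacian_v:
  assumes z: "z \<in> W"
  shows "chart_wlaplacian g c f v z = m / 2 * (4 * chart_inner g c s s z - k * v z)"
proof -
  define b where "b = 2 / (2 - m)"
  define p where "p = G z powr b"
  have b: "b * (2 - m) = 2" using m nonzero_eq_divide_eq[of "2 - m" b 2] by (simp add: b_def)
  let ?N = "chart_inner g c G G z"
  have Gz: "G z > 0" using G_pos z by blast
  have p: "p > 0" using Gz by (simp add: p_def)
  have eq: "v y = 1/4 * G y powr b" if "y \<in> W" for y using v_eq[OF that] by (simp add: b_def)
  have lap: "chart_laplacian g c (\<lambda>y. 1/4 * G y powr b) z = 1/4 * (b * G z powr (b - 1)) * chart_laplacian g c G z
      + 1/4 * (b * ((b - 1) * G z powr (b - 1 - 1))) * ?N"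
  proof (rule chart_laplacian_real[OF CG z])
    show "((\<lambda>t. 1/4 * t powr b) has_real_derivative 1/4 * (b * G y powr (b - 1))) (at (G y))" if "y \<in> W" for y
      by (rule DERIV_cmult_powr[OF G_pos[OF that]])
    show "((\<lambda>t. 1/4 * (b * t powr (b - 1))) has_real_derivative 1/4 * (b * ((b - 1) * G z powr (b - 1 - 1)))) (at (G z))"
      by (rule DERIV_cmult[OF DERIV_cmult_powr[OF Gz]])
    show "C 1 (\<lambda>z. 1/4 * (b * G z powr (b - 1)))"
      by (intro C_cmult C_powr CG G_pos)
  qed
  have inn: "chart_inner g c f (\<lambda>y. 1/4 * G y powr b) z = 1/4 * (b * G z powr (b - 1)) * chart_inner g c f G z"
    by (rule chart_inner_real[OF CG z DERIV_cmult_powr[OF Gz]])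
  have "chart_wlaplacian g c f (\<lambda>y. 1/4 * G y powr b) z
      = 1/4 * (b * G z powr (b - 1)) * chart_wlaplacian g c f G z + 1/4 * (b * ((b - 1) * G z powr (b - 1 - 1))) * ?N"
    unfolding chart_wlaplacian_def lap inn by (simp only: right_diff_distrib add_diff_eq diff_add_eq)
  also have "chart_wlaplacian g c f (\<lambda>y. 1/4 * G y powr b) z = chart_wlaplacian g c f v z"
    using eq z by (intro chart_wlaplacian_cong) auto
  finally have L: "chart_wlaplacian g c f v z
      = b / 4 * p * (m * (m - 2) * k / 4) + b * (b - 1) / 4 * (p / (G z * G z)) * ?N"
    using Gz by (simp add: pde[OF z] p_def powr_diff power2_eq_square mult_ac)
  have "4 * v z * chart_inner g c s s z = (b * (v z / G z)) * ((b * (v z / G z)) * ?N)"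
    unfolding chart_inner_v_self[OF z, symmetric] b_def
    by (simp only: chart_inner_v[OF z, of v] chart_inner_eq(2)[OF z, of v G] chart_inner_v[OF z, of G])
  then have N: "4 * chart_inner g c s s z = b * b * (p / 4) / (G z * G z) * ?N"
    using p Gz unfolding eq[OF z] p_def[symmetric] by (simp add: field_simps)
  \<comment> \<open>Coefficient of the zero-order term, which by v = p / 4 becomes -(m / 2) k
    v.\<close>
  have 1: "b * m * (m - 2) = - 2 * m"
  proof -
    have "b * m * (m - 2) = - m * (b * (2 - m))" by (simp add: algebra_simps)
    then show ?thesis using b by simp
  qed
  \<comment> \<open>The relation that turns the |grad G|^2 term into a multiple of |grad
    s|^2.\<close>
  have 2: "b * (b - 1) = m / 2 * (b * b)"
  proof -
    have "m * b = 2 * b - 2" using b by (simp add: algebra_simps)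
    then have "m * b * b = (2 * b - 2) * b" by simp
    then show ?thesis by (simp add: algebra_simps)
  qed
  have "b / 4 * p * (m * (m - 2) * k / 4) = (b * m * (m - 2)) * (p * k / 16)" by simp
  then have "b / 4 * p * (m * (m - 2) * k / 4) = - (m / 2 * (k * (p / 4)))" unfolding 1 by simp
  moreover have "b * (b - 1) / 4 * (p / (G z * G z)) * ?N = m / 2 * (4 * chart_inner g c s s z)"
    unfolding 2 N by simp
  ultimately show ?thesis
    unfolding L using eq[OF z] by (simp add: p_def right_diff_distrib)
qed

lemma conformal_identity:
  assumes x: "x \<in> W"
  shows "chart_wlaplacian g c f (\<lambda>z. 4 * chart_inner g c s s z + k * v z) x
      + (2 - m) / (s x)\<^sup>2 * chart_inner g c v (\<lambda>z. 4 * chart_inner g c s s z + k * v z) x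
    = 2 / (s x)\<^sup>2 * (tensor_norm2 g c x (hess g c v x) - (chart_wlaplacian g c f v x)\<^sup>2 / m
      + grad g c v x \<bullet> ((ricci g c x + hess g c f x) *v grad g c v x)
      - (m - 1) * k * chart_inner g c v v x)"
proof -
  define w where "w z = 4 * chart_inner g c s s z + k * v z" for z
  let ?L = "chart_wlaplacian g c f"
  have Cv: "C j v" for j by (intro C_power2 C_s)
  have Cw: "C j w" for j unfolding w_def[abs_def] by (rule C_w)
  have Q: "chart_inner g c v v z = v z * w z - k * (v z * v z)" if "z \<in> W" for z
    by (simp add: chart_inner_v_self[OF that] w_def algebra_simps)
  have P: "?L v z = m / 2 * w z + (- m * k) * v z" if "z \<in> W" for z
    unfolding chart_wlaplacian_v[OF that] by (simp add: w_def algebra_simps)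
  have "?L (chart_inner g c v v) x = ?L (\<lambda>z. v z * w z - k * (v z * v z)) x"
    using Q x by (intro chart_wlaplacian_cong)
  also have "\<dots> = ?L (\<lambda>z. v z * w z) x - k * ?L (\<lambda>z. v z * v z) x"
    using chart_wlaplacian_diff[OF C_mult[OF Cv Cw] C_cmult[OF C_mult[OF Cv Cv]] x]
      chart_wlaplacian_cmult[OF C_mult[OF Cv Cv] x] by simp
  also have "\<dots> = v x * ?L w x + w x * ?L v x + 2 * chart_inner g c v w x
      - k * (2 * v x * ?L v x + 2 * chart_inner g c v v x)"
    unfolding chart_wlaplacian_mult[OF Cv Cw x] chart_wlaplacian_mult[OF Cv Cv x] by simp
  finally have 1: "v x * ?L w x + w x * ?L v x + 2 * chart_inner g c v w x
      - k * (2 * v x * ?L v x + 2 * chart_inner g c v v x)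
    = 2 * (tensor_norm2 g c x (hess g c v x) + chart_inner g c v (?L v) x
        + grad g c v x \<bullet> ((ricci g c x + hess g c f x) *v grad g c v x))"
    unfolding weighted_bochner[OF Cf Cv x] by simp
  have "chart_inner g c v (?L v) x = chart_inner g c v (\<lambda>z. m / 2 * w z + (- m * k) * v z) x"
    using P x by (intro chart_inner_cong)
  also have "\<dots> = m / 2 * chart_inner g c v w x + (- m * k) * chart_inner g c v v x"
    unfolding chart_inner_add[OF C_cmult[OF Cw] C_cmult[OF Cv] x] chart_inner_cmult[OF Cw x] chart_inner_cmult[OF Cv x] ..
  finally have 2: "chart_inner g c v (?L v) x = m / 2 * chart_inner g c v w x + (- m * k) * chart_inner g c v v x" .
  \<comment> \<open>Eliminating \<open>w\<close> in favour of Delta_f v merges the products w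
    Delta_f v and 2 k v Delta_f v into a pure square, the origin of (Delta_f v)^2 / m.\<close>
  have 3: "w x = 2 / m * ?L v x + 2 * k * v x" using P[OF x] m by (simp add: field_simps)
  have "w x * ?L v x - 2 * k * v x * ?L v x = 2 * ((?L v x)\<^sup>2 / m)"
    unfolding 3 by (simp add: power2_eq_square algebra_simps)
  \<comment> \<open>After division by 2, |grad v|^2 carries m k from the gradient of Delta_f v, less
    k from Delta_f (v^2): hence (m - 1) k.\<close>
  with 1 2 have "v x * ?L w x + (2 - m) * chart_inner g c v w x
      = 2 * (tensor_norm2 g c x (hess g c v x) - (?L v x)\<^sup>2 / m
      + grad g c v x \<bullet> ((ricci g c x + hess g c f x) *v grad g c v x)
      - (m - 1) * k * chart_inner g c v v x)"
    by (simp add: algebra_simps)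
  moreover have "v x * ?L w x + (2 - m) * chart_inner g c v w x = v x * (?L w x + (2 - m) / v x * chart_inner g c v w x)"
    using s_pos[OF x] by (simp add: distrib_left)
  ultimately show ?thesis
    using s_pos[OF x] unfolding w_def[abs_def, symmetric] by (simp add: nonzero_eq_divide_eq mult.commute)
qed

end

end

end

text \<open>With a = Delta v and b = <grad f, grad v> the left side is -(Delta_f v)^2 / m. It is
  distributed over the trace part of the Hessian, \<open>D_term\<close>, and the contribution of df
  (x) df to \<open>ricci_fm\<close>.\<close>

lemma weighted_square_split:
  fixes a b m n :: real
  assumes "0 < n" "n < m"
  shows "- ((a - b)\<^sup>2 / m) = - (a\<^sup>2 / n) + n / (m * (m - n)) * ((m - n) / n * a + b)\<^sup>2 - b\<^sup>2 / (m - n)"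
proof -
  define d where "d = m - n"
  have pos: "d \<noteq> 0" "n \<noteq> 0" "m \<noteq> 0" and m: "m = n + d" using assms by (auto simp: d_def)
  have "n / (m * d) * (d / n * a + b)\<^sup>2 = d / (m * n) * a\<^sup>2 + 2 / m * (a * b) + n / (m * d) * b\<^sup>2"
    using pos by (simp add: power2_sum power_mult_distrib power_divide distrib_left) (simp add: power2_eq_square)
  \<comment> \<open>Partial fractions, from m = n + d.\<close>
  moreover have "d / (m * n) = 1 / n - 1 / m" "n / (m * d) = 1 / d - 1 / m"
    using pos by (simp_all add: m field_simps)
  ultimately have "n / (m * d) * (d / n * a + b)\<^sup>2 = (1 / n - 1 / m) * a\<^sup>2 + 2 / m * (a * b) + (1 / d - 1 / m) * b\<^sup>2"
    by simp
  then show ?thesis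
    unfolding d_def[symmetric] by (simp add: power2_diff left_diff_distrib diff_divide_distrib add_divide_distrib)
qed

theorem proposition2p6:
  fixes A :: "('a::{t2_space, second_countable_topology}, 'n::finite) chart set"
    and g :: "('a, 'n) metric"
    and dV :: "'a measure"
    and f G s :: "'a \<Rightarrow> real"
    and m k \<kappa> :: real
    and p :: 'a
  assumes "CARD('n) \<ge> 3"
    and "closed_connected_riemannian A g"
    and "riemannian_volume A g dV"
    and "smooth_fun A UNIV f"
    and "m > real CARD('n)" and "k > 0"
    and "ricci_fm_bounded_below A g f m ((m - 1) * k)"
    and "\<kappa> > 0"
    and "green_function A g dV f m k \<kappa> p G"
    and "\<forall>x. x \<noteq> p \<longrightarrow> s x = 1 / 2 * G x powr (1 / (2 - m))"
  shows "(\<forall>u. Ck_fun A 2 (- {p}) u \<longrightarrow> (\<forall>x. x \<noteq> p \<longrightarrow>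
            L_op A g f m s u x
              = weighted_laplacian A g f u x + 2 * grad_inner A g (\<lambda>y. ln (G y)) u x \<and>
            L_op A g f m s u x
              = 1 / (G x)\<^sup>2 * weighted_divergence A g f (\<lambda>c y. (G y)\<^sup>2 *\<^sub>R grad g c u y) x)) \<and>
         (\<forall>c\<in>A. \<forall>x\<in>fst c. x \<noteq> p \<longrightarrow>
            L_op A g f m s (\<lambda>y. 4 * grad_inner A g s s y + k * (s y)\<^sup>2) x
              = 2 / (s x)\<^sup>2 *
                (tensor_norm2 g c x (hess_traceless A g c (\<lambda>y. (s y)\<^sup>2) x)
                 + D_term A g f m s x
                 + grad g c (\<lambda>y. (s y)\<^sup>2) x \<bullet>
                     ((ricci_fm g f m c x - ((m - 1) * k) *\<^sub>R g c x) *v grad g c (\<lambda>y. (s y)\<^sup>2) x)))"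
proof -
  interpret M: riemannian_manifold A g
    using assms(2) by unfold_locales (auto simp: closed_connected_riemannian_def)
  have m2: "m > 2" using assms(1,5) by linarith
  have f: "Ck_fun A j UNIV f" for j using assms(4) by (simp add: smooth_fun_def)
  have f': "Ck_fun A j (- {p}) f" for j
    using M.Ck_fun_chart[OF f] unfolding M.Ck_fun_iff[of _ "- {p}"] by blast
  have G: "Ck_fun A j (- {p}) G" and G_pos: "x \<noteq> p \<Longrightarrow> G x > 0" for j x
    using assms(9) by (auto simp: green_function_def smooth_fun_def)
  have s: "s z = 1 / 2 * G z powr (1 / (2 - m))" if "z \<noteq> p" for z using assms(10) that by blast
  have patch: "metric_patch c (fst c - {p}) g" if "c \<in> A" for c
    using M.open_chart[OF that] by (intro M.patch that open_Diff) auto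
  have on_patch: "chart_Ck c (fst c - {p}) j u" if "Ck_fun A j (- {p}) u" "c \<in> A" for c j u
    using that by (rule M.Ck_fun_chart) auto
  have Ck_funI: "Ck_fun A j (- {p}) u" if "\<And>c. c \<in> A \<Longrightarrow> chart_Ck c (fst c - {p}) j u" for j u
    using that by (simp add: M.Ck_fun_iff Diff_eq)
  have Cs: "Ck_fun A j (- {p}) s" for j
  proof (rule Ck_funI)
    fix c assume c: "c \<in> A"
    interpret metric_patch c "fst c - {p}" g using c by (rule patch)
    show "C j s" by (rule C_s[OF on_patch[OF f' c] on_patch[OF G c] _ m2 s]) (auto simp: G_pos)
  qed
  have Cv: "Ck_fun A j (- {p}) (\<lambda>y. (s y)\<^sup>2)" for j
  proof (rule Ck_funI)
    fix c assume c: "c \<in> A"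
    interpret metric_patch c "fst c - {p}" g using c by (rule patch)
    show "C j (\<lambda>y. (s y)\<^sup>2)" by (rule C_power2[OF on_patch[OF Cs c]])
  qed
  have inner: "grad_inner A g u u' x = chart_inner g c u u' x"
    if "Ck_fun A 1 (- {p}) u" "Ck_fun A 1 (- {p}) u'" "c \<in> A" "x \<in> fst c" "x \<noteq> p" for u u' c x
    by (rule M.grad_inner_chart[OF that(1,2) _ _ that(3,4)]) (use that(5) in auto)
  let ?w = "\<lambda>y. 4 * grad_inner A g s s y + k * (s y)\<^sup>2"
  \<comment> \<open>The chart behind \<open>grad_inner\<close> changes with \<open>y\<close>. In the
    single chart \<open>c\<close> the function agrees with a smooth expression on the whole patch,
    and this is what lets \<open>L_op\<close> differentiate it.\<close>
  have w: "?w y = 4 * chart_inner g c s s y + k * (s y)\<^sup>2" if "c \<in> A" "y \<in> fst c - {p}" for c y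
    using inner[OF Cs Cs] that by simp
  have Cw: "Ck_fun A j (- {p}) ?w" for j
  proof (rule Ck_funI)
    fix c assume c: "c \<in> A"
    interpret metric_patch c "fst c - {p}" g using c by (rule patch)
    have "C j (\<lambda>y. 4 * chart_inner g c s s y + k * (s y)\<^sup>2)"
      by (intro C_add C_cmult C_chart_inner C_power2 on_patch[OF Cs c])
    then show "C j ?w" by (rule C_cong) (use w[OF c] in simp)
  qed
  show ?thesis
  proof (intro conjI allI impI ballI)
    fix u x assume u: "Ck_fun A 2 (- {p}) u" and x: "x \<noteq> p"
    let ?c = "chart_at A x"
    note c = M.chart_at[of x]
    interpret metric_patch ?c "fst ?c - {p}" g using c by (intro patch)
    have xW: "x \<in> fst ?c - {p}" using c x by simp
    \<comment> \<open>\<open>chart_at A x\<close> is the chart in which the operators are evaluated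
      at \<open>x\<close>, so here they unfold without a change of chart.\<close>
    have gi: "grad_inner A g a b x = chart_inner g ?c a b x" for a b
      using chart_inner_eq(1)[OF xW] by (simp add: grad_inner_def Let_def)
    have wl: "weighted_laplacian A g f u x = chart_wlaplacian g ?c f u x"
      by (simp add: weighted_laplacian_def chart_wlaplacian_def gi laplacian_eq_chart)
    show 1: "L_op A g f m s u x = weighted_laplacian A g f u x + 2 * grad_inner A g (\<lambda>y. ln (G y)) u x"
      unfolding L_op_def gi
      using drift_ln[OF on_patch[OF f' c(1)] on_patch[OF G c(1)] _ m2 s xW] G_pos by simp
    show "L_op A g f m s u x = 1 / (G x)\<^sup>2 * weighted_divergence A g f (\<lambda>c y. (G y)\<^sup>2 *\<^sub>R grad g c u y) x"
      unfolding 1 weighted_divergence_def divergence_eq_chart_div wl gi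
      using weighted_div_drift[OF on_patch[OF f' c(1)] on_patch[OF G c(1)] _ m2 s on_patch[OF u c(1)] xW] G_pos G_pos[OF x] by simp
  next
    fix c x assume c: "c \<in> A" and x: "x \<in> fst c" "x \<noteq> p"
    interpret metric_patch c "fst c - {p}" g using c by (rule patch)
    have xW: "x \<in> fst c - {p}" using x by simp
    let ?v = "\<lambda>y. (s y)\<^sup>2" and ?n = "real CARD('n)"
    have n: "?n > 0" "m - ?n > 0" "m > 0" using assms(5) m2 by auto
    have pde: "chart_wlaplacian g c f G z = m * (m - 2) * k / 4 * G z" if "z \<in> fst c - {p}" for z
      using M.green_function_pde[OF assms(3,4,9) c] that by auto
    have lap: "laplacian A g ?v x = chart_laplacian g c ?v x"
      by (rule M.laplacian_chart[OF Cv _ _ c x(1)]) (use x in auto)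
    have fv: "grad_inner A g f ?v x = chart_inner g c f ?v x"
      by (rule inner[OF f' Cv c x])
    let ?a = "chart_laplacian g c ?v x" and ?b = "chart_inner g c f ?v x" and ?X = "grad g c ?v x"
    have "L_op A g f m s ?w x = chart_wlaplacian g c f ?w x + (2 - m) / (s x)\<^sup>2 * chart_inner g c ?v ?w x"
      unfolding L_op_def inner[OF Cv Cw c x]
      using M.weighted_laplacian_chart[OF Cw f' _ _ c x(1)] x by auto
    also have "\<dots> = chart_wlaplacian g c f (\<lambda>z. 4 * chart_inner g c s s z + k * ?v z) x
        + (2 - m) / (s x)\<^sup>2 * chart_inner g c ?v (\<lambda>z. 4 * chart_inner g c s s z + k * ?v z) x"
      using chart_wlaplacian_cong[OF w[OF c] xW] chart_inner_cong[OF w[OF c] xW] by presburger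
    also have "\<dots> = 2 / (s x)\<^sup>2 * (tensor_norm2 g c x (hess g c ?v x) - (chart_wlaplacian g c f ?v x)\<^sup>2 / m
      + ?X \<bullet> ((ricci g c x + hess g c f x) *v ?X) - (m - 1) * k * chart_inner g c ?v ?v x)"
      by (rule conformal_identity[OF on_patch[OF f' c] on_patch[OF G c] _ m2 s pde xW]) (auto simp: G_pos)
    also have "tensor_norm2 g c x (hess g c ?v x) - (chart_wlaplacian g c f ?v x)\<^sup>2 / m
        + ?X \<bullet> ((ricci g c x + hess g c f x) *v ?X) - (m - 1) * k * chart_inner g c ?v ?v x
      = tensor_norm2 g c x (hess_traceless A g c ?v x) + D_term A g f m s x
        + ?X \<bullet> ((ricci_fm g f m c x - ((m - 1) * k) *\<^sub>R g c x) *v ?X)"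
    proof -
      have T: "tensor_norm2 g c x (hess_traceless A g c ?v x) = tensor_norm2 g c x (hess g c ?v x) - ?a\<^sup>2 / ?n"
        unfolding hess_traceless_def lap tensor_norm2_traceless[OF xW]
          chart_laplacian_eq_hess[OF on_patch[OF Cv c] xW, symmetric]
        using n by (simp add: field_simps power2_eq_square)
      \<comment> \<open>df (x) df on the pair (grad v, grad v) is <grad f, grad v>^2, which accounts
        for the last term of \<open>weighted_square_split\<close>.\<close>
      have "?X \<bullet> ((\<chi> i j. pd c i f x * pd c j f x) *v ?X) = ?b\<^sup>2"
        by (simp add: chart_inner_def power2_eq_square inner_vec_def matrix_vector_mult_def sum_product
            sum_distrib_left mult_ac)
      then have R: "?X \<bullet> ((ricci_fm g f m c x - ((m - 1) * k) *\<^sub>R g c x) *v ?X)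
          = ?X \<bullet> ((ricci g c x + hess g c f x) *v ?X) - ?b\<^sup>2 / (m - ?n) - (m - 1) * k * chart_inner g c ?v ?v x"
        by (simp add: ricci_fm_def matrix_vector_mult_diff_rdistrib scaleR_matrix_vector_assoc[symmetric]
            inner_diff_right chart_inner_eq(1)[OF xW])
      have "- ((?a - ?b)\<^sup>2 / m) = - (?a\<^sup>2 / ?n) + ?n / (m * (m - ?n)) * ((m - ?n) / ?n * ?a + ?b)\<^sup>2 - ?b\<^sup>2 / (m - ?n)"
        by (rule weighted_square_split) (use n in auto)
      then show ?thesis
        unfolding T R D_term_def lap fv Let_def chart_wlaplacian_def by simp
    qed
    finally show "L_op A g f m s ?w x = 2 / (s x)\<^sup>2 * (tensor_norm2 g c x (hess_traceless A g c ?v x)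
        + D_term A g f m s x + ?X \<bullet> ((ricci_fm g f m c x - ((m - 1) * k) *\<^sub>R g c x) *v ?X))" .
  qed
qed

end
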